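(* Let $\gamma$ be Euler's constant and define $\gamma_k$ by $\sum_{k\ge0}\gamma_ku^k=e^{\gamma u}\Gamma(1+u)$. Let $R_{1,1}:\mathbb{C}[T]\to\mathbb{C}[T]$ be the $\mathbb{C}$-linear map $T^n\mapsto n!\sum_{k=0}^n\frac{\gamma_k}{(n-k)!}T^{n-k}$. Then $\zeta^{\mu,T}_{\sqcup\!\sqcup,1}(\varphi_\mu(w))=R_{1,1}(\zeta^{\mu,T}_{*,1}(w))$ for all $w\in\mathbb{Q}[\mu]\langle Y\rangle$ (so $\rho^\mu_{1,1}=R_{1,1}$). More generally, for $m,m'\in\mathbb{Q}_{>0}$, with $c_{a,b}(\mu)=H(b/\mu-1)-H(a/\mu-1)$, the $\mathbb{C}$-linear map $$R_{m,m'}:T^n\mapsto\sum_{k=0}^n\binom{n}{k}c_{m,1}(\mu)^{n-k}\left(k!\sum_{l=0}^k\frac{\gamma_l}{(k-l)!}\big(T+c_{1,m'}(\mu)\big)^{k-l}\right)$$ satisfies $\zeta^{\mu,T}_{\sqcup\!\sqcup,m'}(\varphi_\mu(w))=R_{m,m'}(\zeta^{\mu,T}_{*,m}(w))$ for all $w\in\mathbb{Q}[\mu]\langle Y\rangle$ (so $\rho^\mu_{m,m'}=R_{m,m'}$).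
   Context: Fix $\mu\in\mathbb{C}$, $\mathrm{Re}(\mu)>0$; $\mathbb{Q}[\mu]\subset\mathbb{C}$ the ring generated by $\mu$; $H(x)=\int_0^1\frac{1-t^x}{1-t}dt$. Bi-indices $(\mathbf{k};\mathbf{m})\in\mathbb{N}^r\times\mathbb{Q}^r$: positive if all $m_i>0$, admissible if positive and $k_r>1$; $\zeta^{\mu}(\mathbf{k};\mathbf{m})=\sum_{0\le n_1\le\cdots\le n_r}\mu^r\prod_i(n_i\mu+m_i)^{-k_i}$. Special triples $(\mathbf{k};\mathbf{m};\tilde{\mathbf{m}})$: $\mathbf{k}=(k_1,\dots,k_{r-1},1)$, $\tilde{\mathbf{m}}$ equals $\mathbf{m}$ except last entry $\tilde m_r\ne m_r$, entries in $\mathbb{Q}_{>0}$; $\mathcal{D}^{\mu}(\mathbf{k};\mathbf{m};\tilde{\mathbf{m}})=(\tilde m_r-m_r)\sum\frac{\mu^r}{\prod_{i<r}(n_i\mu+m_i)^{k_i}(n_r\mu+m_r)(n_r\mu+\tilde m_r)}$. $\mathcal{Z}^\mu$ = $\mathbb{Q}[\mu]$-span of $1$ and these values. $Y=\{y_{k,m}:k\in\mathbb{N},m\in\mathbb{Q}_{>0}\}$, $\mathbb{Q}[\mu]\langle Y\rangle$ free noncommutative algebra on words, $y_{\mathbf{k};\mathbf{m}}=y_{k_1,m_1}\cdots y_{k_r,m_r}$; $\odot$: $y_{k_1,m}\odot y_{k_2,m}=y_{k_1+k_2,m}$, and for $m_1\ne m_2$, $y_{k_1,m_1}\odot y_{k_2,m_2}=\sum_{i\le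 k_1}a_iy_{i,m_1}+\sum_{j\le k_2}b_jy_{j,m_2}$ with $\frac{1}{(x+m_1)^{k_1}(x+m_2)^{k_2}}=\sum\frac{a_i}{(x+m_1)^i}+\sum\frac{b_j}{(x+m_2)^j}$; $\ast_\mu$: $1\ast_\mu w=w\ast_\mu1=w$, $ux\ast_\mu vy=(u\ast_\mu vy)x+(ux\ast_\mu v)y-\mu(u\ast_\mu v)(x\odot y)$. $\mathbb{Q}[\mu]\langle Y\rangle^0$ = span of $1$, admissible $y_{\mathbf{k};\mathbf{m}}$ and $y_{\mathbf{k};\mathbf{m}}-y_{\mathbf{k};\tilde{\mathbf{m}}}$; $\zeta^\mu_*(w)=\lim_{M\to\infty}\zeta^\mu_{*,M}(w)$, $\zeta^\mu_{*,M}(y_{\mathbf{k};\mathbf{m}})=\sum_{0\le n_1\le\dots\le n_r\le M}\mu^r\prod(n_i\mu+m_i)^{-k_i}$. $\zeta^{\mu,T}_{*,m}$: the unique $\mathbb{Q}[\mu]$-linear map $\mathbb{Q}[\mu]\langle Y\rangle\to\mathcal{Z}^\mu[T]$ extending $\zeta^\mu_*$, $y_{1,m}\mapsto T$, multiplicative for $\ast_\mu$. $X^\mu=\{x\}\cup\{y^\mu_l:l\in\mathbb{Q}\}$; shuffle: $1\sqcup\!\sqcup w=w\sqcup\!\sqcup 1=w$, $w_1u\sqcup\!\sqcup w_2v=(w_1\sqcup\!\sqcup w_2v)u+(w_1u\sqcup\!\sqcup w_2)v$. $(y,x)^\mu_{\mathbf{k};\mathbf{m}}=y^\mu_{m_1}x^{k_1-1}y^\mu_{m_2-m_1}x^{k_2-1}\cdots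 y^\mu_{m_r-m_{r-1}}x^{k_r-1}$; $\mathbb{Q}[\mu]\langle X^\mu\rangle^1$ = span of these for positive bi-indices (incl. $1$); $\mathbb{Q}[\mu]\langle X^\mu\rangle^0$ = span of $1$, admissible ones and $(y,x)^\mu_{\mathbf{k};\mathbf{m}}-(y,x)^\mu_{\mathbf{k};\tilde{\mathbf{m}}}$; $\zeta^\mu_{\sqcup\!\sqcup}$ linear on it with values $1,\zeta^\mu(\mathbf{k};\mathbf{m}),\mathcal{D}^\mu(\mathbf{k};\mathbf{m};\tilde{\mathbf{m}})$. $\zeta^{\mu,T}_{\sqcup\!\sqcup,m}$: the unique $\mathbb{Q}[\mu]$-linear map $\mathbb{Q}[\mu]\langle X^\mu\rangle^1\to\mathcal{Z}^\mu[T]$ extending $\zeta^\mu_{\sqcup\!\sqcup}$, $y^\mu_m\mapsto T$, multiplicative for $\sqcup\!\sqcup$. $\varphi_\mu$: linear bijection $y_{\mathbf{k};\mathbf{m}}\mapsto(y,x)^\mu_{\mathbf{k};\mathbf{m}}$. $\rho^\mu_{m,m'}$ denotes the unique $\mathbb{C}$-linear map $\mathbb{C}[T]\to\mathbb{C}[T]$ with $\zeta^{\mu,T}_{\sqcup\!\sqcup,m'}(\varphi_\mu(w))=\rho^\mu_{m,m'}(\zeta^{\mu,T}_{*,m}(w))$ for all $w$. *)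

theory Defs
  imports "HOL-Library.Poly_Mapping" "HOL-Library.FuncSet" "HOL-Complex_Analysis.Complex_Analysis"
begin

section \<open>Free modules on words\<close>

text \<open>
  Elements of the free noncommutative algebras are finitely supported functions from words to
  \<^typ>\<open>complex\<close>; that the coefficients lie in the ring generated by \<open>\<mu>\<close> is imposed by the
  carrier sets below.
\<close>

type_synonym 'a nc = "'a list \<Rightarrow>\<^sub>0 complex"

definition word :: "'a list \<Rightarrow> 'a nc" where
  "word w = Poly_Mapping.single w 1"

definition scale :: "complex \<Rightarrow> 'a nc \<Rightarrow> 'a nc" where
  "scale c p = Poly_Mapping.map ((*) c) p"

definition conc :: "'a nc \<Rightarrow> 'a nc \<Rightarrow> 'a nc" where
  "conc p q = (\<Sum>u\<in>Poly_Mapping.keys p. \<Sum>v\<in>Poly_Mapping.keys q.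
     Poly_Mapping.single (u @ v) (Poly_Mapping.lookup p u * Poly_Mapping.lookup q v))"

definition bilinear_ext :: "('a list \<Rightarrow> 'a list \<Rightarrow> 'a nc) \<Rightarrow> 'a nc \<Rightarrow> 'a nc \<Rightarrow> 'a nc" where
  "bilinear_ext F p q = (\<Sum>u\<in>Poly_Mapping.keys p. \<Sum>v\<in>Poly_Mapping.keys q.
     scale (Poly_Mapping.lookup p u * Poly_Mapping.lookup q v) (F u v))"

definition span_over ::
  "complex set \<Rightarrow> (complex \<Rightarrow> 'b \<Rightarrow> 'b) \<Rightarrow> 'b set \<Rightarrow> 'b::comm_monoid_add set" where
  "span_over R s B = {\<Sum>b\<in>F. s (c b) b | F c. finite F \<and> F \<subseteq> B \<and> c ` F \<subseteq> R}"

definition linear_over ::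
  "complex set \<Rightarrow> 'b::plus set \<Rightarrow> (complex \<Rightarrow> 'b \<Rightarrow> 'b) \<Rightarrow> (complex \<Rightarrow> 'c \<Rightarrow> 'c::plus) \<Rightarrow>
   ('b \<Rightarrow> 'c) \<Rightarrow> bool" where
  "linear_over R V s t f \<longleftrightarrow>
     (\<forall>v\<in>V. \<forall>w\<in>V. f (v + w) = f v + f w) \<and> (\<forall>a\<in>R. \<forall>v\<in>V. f (s a v) = t a (f v))"

definition Qmu :: "complex \<Rightarrow> complex set" where
  "Qmu \<mu> = {poly (map_poly of_rat p) \<mu> | p :: rat poly. True}"

section \<open>Bi-indices and multiple series\<close>

text \<open>
  A bi-index \<open>(k\<^sub>1,\<dots>,k\<^sub>r; m\<^sub>1,\<dots>,m\<^sub>r)\<close> is the list of pairs \<open>(k\<^sub>i, m\<^sub>i)\<close>, which is at the same time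
  the word \<open>y\<^bsub>k\<^sub>1,m\<^sub>1\<^esub> \<cdots> y\<^bsub>k\<^sub>r,m\<^sub>r\<^esub>\<close>.
\<close>

type_synonym biindex = "(nat \<times> rat) list"

definition positive :: "biindex \<Rightarrow> bool" where
  "positive w \<longleftrightarrow> (\<forall>(k, m)\<in>set w. k \<ge> 1 \<and> m > 0)"

definition admissible :: "biindex \<Rightarrow> bool" where
  "admissible w \<longleftrightarrow> positive w \<and> w \<noteq> [] \<and> fst (last w) > 1"

definition factor :: "complex \<Rightarrow> nat \<Rightarrow> nat \<times> rat \<Rightarrow> complex" where
  "factor \<mu> n y = (of_nat n * \<mu> + of_rat (snd y)) ^ fst y"

definition chains :: "nat \<Rightarrow> nat list set" where
  "chains r = {ns. length ns = r \<and> sorted ns}"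

definition zeta :: "complex \<Rightarrow> biindex \<Rightarrow> complex" where
  "zeta \<mu> w = (\<Sum>\<^sub>\<infinity>ns\<in>chains (length w).
     \<mu> ^ length w / (\<Prod>i<length w. factor \<mu> (ns ! i) (w ! i)))"

text \<open>
  The special triple with bi-indices \<open>u @ [(1, a)]\<close> and \<open>u @ [(1, b)]\<close> is given by \<open>u\<close>, \<open>a\<close>, \<open>b\<close>.
\<close>

definition special :: "biindex \<Rightarrow> rat \<Rightarrow> rat \<Rightarrow> bool" where
  "special u a b \<longleftrightarrow> positive u \<and> a > 0 \<and> b > 0 \<and> a \<noteq> b"

definition Dmu :: "complex \<Rightarrow> biindex \<Rightarrow> rat \<Rightarrow> rat \<Rightarrow> complex" where
  "Dmu \<mu> u a b = of_rat (b - a) * (\<Sum>\<^sub>\<infinity>ns\<in>chains (Suc (length u)).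
     \<mu> ^ Suc (length u) / ((\<Prod>i<length u. factor \<mu> (ns ! i) (u ! i)) *
       (of_nat (ns ! length u) * \<mu> + of_rat a) * (of_nat (ns ! length u) * \<mu> + of_rat b)))"

definition Zmu :: "complex \<Rightarrow> complex set" where
  "Zmu \<mu> = span_over (Qmu \<mu>) (*)
     ({1} \<union> {zeta \<mu> w | w. admissible w} \<union> {Dmu \<mu> u a b | u a b. special u a b})"

definition ZmuT :: "complex \<Rightarrow> complex poly set" where
  "ZmuT \<mu> = {P. \<forall>i. coeff P i \<in> Zmu \<mu>}"

section \<open>The harmonic side\<close>

definition QY :: "complex \<Rightarrow> (nat \<times> rat) nc set" where
  "QY \<mu> = span_over (Qmu \<mu>) scale {word w | w. positive w}"

definition QY0 :: "complex \<Rightarrow> (nat \<times> rat) nc set" where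
  "QY0 \<mu> = span_over (Qmu \<mu>) scale
     ({word []} \<union> {word w | w. admissible w} \<union>
      {word (u @ [(1, a)]) - word (u @ [(1, b)]) | u a b. special u a b})"

text \<open>The vanishing outside the index range only serves to make the pair of functions unique.\<close>

definition partial_fraction ::
  "nat \<Rightarrow> rat \<Rightarrow> nat \<Rightarrow> rat \<Rightarrow> (nat \<Rightarrow> rat) \<times> (nat \<Rightarrow> rat)" where
  "partial_fraction k1 m1 k2 m2 = (THE (a, b).
     (\<forall>i. i \<notin> {1..k1} \<longrightarrow> a i = 0) \<and> (\<forall>j. j \<notin> {1..k2} \<longrightarrow> b j = 0) \<and>
     (\<forall>x::rat. x + m1 \<noteq> 0 \<longrightarrow> x + m2 \<noteq> 0 \<longrightarrow>
        1 / ((x + m1) ^ k1 * (x + m2) ^ k2) =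
        (\<Sum>i=1..k1. a i / (x + m1) ^ i) + (\<Sum>j=1..k2. b j / (x + m2) ^ j)))"

definition odot :: "nat \<times> rat \<Rightarrow> nat \<times> rat \<Rightarrow> (nat \<times> rat) nc" where
  "odot y y' = (case (y, y') of ((k1, m1), (k2, m2)) \<Rightarrow>
     if m1 = m2 then word [(k1 + k2, m1)]
     else (case partial_fraction k1 m1 k2 m2 of (a, b) \<Rightarrow>
       (\<Sum>i=1..k1. scale (of_rat (a i)) (word [(i, m1)])) +
       (\<Sum>j=1..k2. scale (of_rat (b j)) (word [(j, m2)]))))"

function harm_word :: "complex \<Rightarrow> biindex \<Rightarrow> biindex \<Rightarrow> (nat \<times> rat) nc" where
  "harm_word \<mu> u v =
     (if u = [] then word v else if v = [] then word u
      else conc (harm_word \<mu> (butlast u) v) (word [last u])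
         + conc (harm_word \<mu> u (butlast v)) (word [last v])
         - scale \<mu> (conc (harm_word \<mu> (butlast u) (butlast v)) (odot (last u) (last v))))"
  by pat_completeness auto
termination by (relation "Wellfounded.measure (\<lambda>(_, u, v). length u + length v)") (auto simp: neq_Nil_conv)

declare harm_word.simps [simp del]

lemma harm_word_Nil [simp]: "harm_word \<mu> [] w = word w" "harm_word \<mu> w [] = word w"
  by (simp_all add: harm_word.simps)

lemma harm_word_snoc:
  "harm_word \<mu> (u @ [x]) (v @ [y]) =
     conc (harm_word \<mu> u (v @ [y])) (word [x]) + conc (harm_word \<mu> (u @ [x]) v) (word [y])
     - scale \<mu> (conc (harm_word \<mu> u v) (odot x y))"
  by (simp add: harm_word.simps[of \<mu> "u @ [x]" "v @ [y]"])

definition harm :: "complex \<Rightarrow> (nat \<times> rat) nc \<Rightarrow> (nat \<times> rat) nc \<Rightarrow> (nat \<times> rat) nc" where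
  "harm \<mu> = bilinear_ext (harm_word \<mu>)"

definition zeta_trunc :: "complex \<Rightarrow> nat \<Rightarrow> biindex \<Rightarrow> complex" where
  "zeta_trunc \<mu> M w = (\<Sum>ns\<in>{ns \<in> chains (length w). set ns \<subseteq> {..M}}.
     \<mu> ^ length w / (\<Prod>i<length w. factor \<mu> (ns ! i) (w ! i)))"

definition zeta_star_trunc :: "complex \<Rightarrow> nat \<Rightarrow> (nat \<times> rat) nc \<Rightarrow> complex" where
  "zeta_star_trunc \<mu> M p =
     (\<Sum>w\<in>Poly_Mapping.keys p. Poly_Mapping.lookup p w * zeta_trunc \<mu> M w)"

definition zeta_star :: "complex \<Rightarrow> (nat \<times> rat) nc \<Rightarrow> complex" where
  "zeta_star \<mu> p = lim (\<lambda>M. zeta_star_trunc \<mu> M p)"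

definition is_zeta_star_reg ::
  "complex \<Rightarrow> rat \<Rightarrow> ((nat \<times> rat) nc \<Rightarrow> complex poly) \<Rightarrow> bool" where
  "is_zeta_star_reg \<mu> m f \<longleftrightarrow>
     f \<in> QY \<mu> \<rightarrow>\<^sub>E ZmuT \<mu> \<and>
     linear_over (Qmu \<mu>) (QY \<mu>) scale smult f \<and>
     (\<forall>p\<in>QY0 \<mu>. f p = [:zeta_star \<mu> p:]) \<and>
     f (word [(1, m)]) = [:0, 1:] \<and>
     (\<forall>p\<in>QY \<mu>. \<forall>q\<in>QY \<mu>. f (harm \<mu> p q) = f p * f q)"

definition zeta_star_reg :: "complex \<Rightarrow> rat \<Rightarrow> (nat \<times> rat) nc \<Rightarrow> complex poly" where
  "zeta_star_reg \<mu> m = (THE f. is_zeta_star_reg \<mu> m f)"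

section \<open>The shuffle side\<close>

text \<open>\<open>LX\<close> is the letter \<open>x\<close> and \<open>LY l\<close> the letter \<open>y\<^bsub>l\<^esub>\<close>; these are formal symbols, so \<open>\<mu>\<close> is not recorded.\<close>

datatype letter = LX | LY rat

fun yx_from :: "rat \<Rightarrow> biindex \<Rightarrow> letter list" where
  "yx_from m0 [] = []"
| "yx_from m0 ((k, m) # w) = LY (m - m0) # replicate (k - 1) LX @ yx_from m w"

definition yx :: "biindex \<Rightarrow> letter list" where
  "yx w = yx_from 0 w"

function shuffle_word :: "'a list \<Rightarrow> 'a list \<Rightarrow> 'a nc" where
  "shuffle_word u v =
     (if u = [] then word v else if v = [] then word u
      else conc (shuffle_word (butlast u) v) (word [last u])
         + conc (shuffle_word u (butlast v)) (word [last v]))"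
  by pat_completeness auto
termination by (relation "Wellfounded.measure (\<lambda>(u, v). length u + length v)") (auto simp: neq_Nil_conv)

declare shuffle_word.simps [simp del]

lemma shuffle_word_Nil [simp]: "shuffle_word [] w = word w" "shuffle_word w [] = word w"
  by (simp_all add: shuffle_word.simps)

lemma shuffle_word_snoc:
  "shuffle_word (u @ [x]) (v @ [y]) =
     conc (shuffle_word u (v @ [y])) (word [x]) + conc (shuffle_word (u @ [x]) v) (word [y])"
  by (simp add: shuffle_word.simps[of "u @ [x]" "v @ [y]"])

definition shuffle :: "'a nc \<Rightarrow> 'a nc \<Rightarrow> 'a nc" where
  "shuffle = bilinear_ext shuffle_word"

definition QX1 :: "complex \<Rightarrow> letter nc set" where
  "QX1 \<mu> = span_over (Qmu \<mu>) scale {word (yx w) | w. positive w}"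

definition QX0 :: "complex \<Rightarrow> letter nc set" where
  "QX0 \<mu> = span_over (Qmu \<mu>) scale
     ({word []} \<union> {word (yx w) | w. admissible w} \<union>
      {word (yx (u @ [(1, a)])) - word (yx (u @ [(1, b)])) | u a b. special u a b})"

definition is_zeta_sh :: "complex \<Rightarrow> (letter nc \<Rightarrow> complex) \<Rightarrow> bool" where
  "is_zeta_sh \<mu> f \<longleftrightarrow>
     f \<in> extensional (QX0 \<mu>) \<and>
     linear_over (Qmu \<mu>) (QX0 \<mu>) scale (*) f \<and>
     f (word []) = 1 \<and>
     (\<forall>w. admissible w \<longrightarrow> f (word (yx w)) = zeta \<mu> w) \<and>
     (\<forall>u a b. special u a b \<longrightarrow>
        f (word (yx (u @ [(1, a)])) - word (yx (u @ [(1, b)]))) = Dmu \<mu> u a b)"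

definition zeta_sh :: "complex \<Rightarrow> letter nc \<Rightarrow> complex" where
  "zeta_sh \<mu> = (THE f. is_zeta_sh \<mu> f)"

definition is_zeta_sh_reg :: "complex \<Rightarrow> rat \<Rightarrow> (letter nc \<Rightarrow> complex poly) \<Rightarrow> bool" where
  "is_zeta_sh_reg \<mu> m f \<longleftrightarrow>
     f \<in> QX1 \<mu> \<rightarrow>\<^sub>E ZmuT \<mu> \<and>
     linear_over (Qmu \<mu>) (QX1 \<mu>) scale smult f \<and>
     (\<forall>p\<in>QX0 \<mu>. f p = [:zeta_sh \<mu> p:]) \<and>
     f (word [LY m]) = [:0, 1:] \<and>
     (\<forall>p\<in>QX1 \<mu>. \<forall>q\<in>QX1 \<mu>. f (shuffle p q) = f p * f q)"

definition zeta_sh_reg :: "complex \<Rightarrow> rat \<Rightarrow> letter nc \<Rightarrow> complex poly" where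
  "zeta_sh_reg \<mu> m = (THE f. is_zeta_sh_reg \<mu> m f)"

section \<open>Comparison of the regularizations\<close>

definition phi :: "(nat \<times> rat) nc \<Rightarrow> letter nc" where
  "phi p = (\<Sum>w\<in>Poly_Mapping.keys p. scale (Poly_Mapping.lookup p w) (word (yx w)))"

definition rho :: "complex \<Rightarrow> rat \<Rightarrow> rat \<Rightarrow> complex poly \<Rightarrow> complex poly" where
  "rho \<mu> m m' = (THE \<rho>. Vector_Spaces.linear smult smult \<rho> \<and>
     (\<forall>w\<in>QY \<mu>. zeta_sh_reg \<mu> m' (phi w) = \<rho> (zeta_star_reg \<mu> m w)))"

definition H :: "complex \<Rightarrow> complex" where
  "H x = integral {0..1} (\<lambda>t::real. (1 - of_real t powr x) / (1 - of_real t))"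

definition cmu :: "complex \<Rightarrow> rat \<Rightarrow> rat \<Rightarrow> complex" where
  "cmu \<mu> a b = H (of_rat b / \<mu> - 1) - H (of_rat a / \<mu> - 1)"

definition gamma_coeff :: "nat \<Rightarrow> complex" where
  "gamma_coeff k =
     fps_nth (fps_expansion (\<lambda>u. exp (euler_mascheroni * u) * Gamma (1 + u)) 0) k"

definition poly_linear_ext :: "(nat \<Rightarrow> complex poly) \<Rightarrow> complex poly \<Rightarrow> complex poly" where
  "poly_linear_ext F P = (\<Sum>n\<le>Polynomial.degree P. smult (coeff P n) (F n))"

definition R11 :: "complex poly \<Rightarrow> complex poly" where
  "R11 = poly_linear_ext (\<lambda>n.
     smult (fact n) (\<Sum>k\<le>n. smult (gamma_coeff k / fact (n - k)) ([:0, 1:] ^ (n - k))))"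

definition R :: "complex \<Rightarrow> rat \<Rightarrow> rat \<Rightarrow> complex poly \<Rightarrow> complex poly" where
  "R \<mu> m m' = poly_linear_ext (\<lambda>n.
     \<Sum>k\<le>n. smult (of_nat (n choose k) * cmu \<mu> m 1 ^ (n - k))
       (smult (fact k)
         (\<Sum>l\<le>k. smult (gamma_coeff l / fact (k - l)) ([:cmu \<mu> 1 m', 1:] ^ (k - l)))))"

end

theory Submission
  imports Defs "HOL-Real_Asymp.Real_Asymp"
begin

text \<open>
  Let \<open>S\<^sub>n(w)\<close> be the truncated nested sum of a word and \<open>F\<^sub>w(q)\<close> the power series whose partial sums
  of coefficients are \<open>S\<^sub>n(w)\<close>.  Truncation is multiplicative for the harmonic product, and
  \<open>w \<mapsto> F\<^sub>w(q)\<close> is multiplicative for the shuffle product, because on the series the iterated integrals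
  become divisions by \<open>n\<mu> + m\<close> and the derivation \<open>\<mu> q d/dq + m\<close> obeys a product rule.
  Every word is generated over the convergent elements by one divergent letter, so \<open>S\<^sub>n(w)\<close> and \<open>F\<^sub>w(q)\<close>
  are, up to errors smaller than any power of \<open>1/log\<close>, polynomials in their value at that letter;
  these polynomials are the two regularizations.

  Since \<open>F\<^sub>w(q) = (1 - q) \<Sum>\<^sub>n S\<^sub>n(w) q\<^sup>n\<close>, the comparison map is read off from the Abel means of powers
  of the harmonic numbers \<open>H\<^sub>n\<close>.  Writing \<open>e\<^bsup>u H\<^sub>n\<^esup> = (\<Prod>j\<le>n. 1 + u/j) V\<^sub>n(u)\<close>, the Abel mean of the product
  is \<open>(1 - q)\<^bsup>-u\<^esup>\<close> and \<open>V\<^sub>n(u)\<close> tends coefficientwise to \<open>e\<^bsup>\<gamma>u\<^esup> \<Gamma>(1 + u)\<close>.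
\<close>

section \<open>Linear algebra over words\<close>

text \<open>Errors must beat every power of 1/log because the value at the divergent letter grows
  like log: a product of two expansions contains error times polynomial in log, and mere convergence
  to 0 would not survive it. Only the final comparison is content with limits, since a polynomial
  along an unbounded sequence that tends to 0 is the zero polynomial. Series are sampled at q =
  N/(N+1). Then -log(1-q) = log(N+1), and one scale of harmonic numbers measures the errors on both
  sides. For the letter with parameter m, the truncated sum is H_n + h and the series is log(N+1) +
  h up to such errors, with the same constant h = -H(m/\<mu> - 1). After the substitution T -> T + h
  neither regularization depends on its parameter any more, and the comparison between the
  substituted polynomials is \<open>R11\<close>. The constants c in \<open>R\<close> only undo these
  substitutions. They can be collected in one place because \<open>R11\<close> acts as \<Sum>
  \<gamma>_k (d/dT)^k and so commutes with translations.\<close>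

abbreviation "keys \<equiv> Poly_Mapping.keys"
abbreviation "lookup \<equiv> Poly_Mapping.lookup"

lemma lookup_scale [simp]: "lookup (scale c p) w = c * lookup p w"
  by (simp add: scale_def Poly_Mapping.map.rep_eq when_def)

lemma scale_add_right: "scale c (p + q) = scale c p + scale c q"
  by (rule poly_mapping_eqI) (simp add: lookup_add algebra_simps)

lemma scale_diff_right: "scale c (p - q) = scale c p - scale c q"
  by (rule poly_mapping_eqI) (simp add: lookup_minus algebra_simps)

lemma scale_add_left: "scale (c + d) p = scale c p + scale d p"
  by (rule poly_mapping_eqI) (simp add: lookup_add algebra_simps)

lemma scale_scale [simp]: "scale c (scale d p) = scale (c * d) p"
  by (rule poly_mapping_eqI) simp

lemma scale_zero [simp]: "scale c 0 = 0" "scale 0 p = 0" "scale 1 p = p"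
  by (rule poly_mapping_eqI; simp)+

lemma scale_minus_one [simp]: "scale (-1) p = - p"
  by (rule poly_mapping_eqI) simp

lemma scale_sum: "scale c (sum f A) = (\<Sum>x\<in>A. scale c (f x))"
  by (induction A rule: infinite_finite_induct) (auto simp: scale_add_right)

lemma keys_word [simp]: "keys (word w) = {w}"
  by (simp add: word_def)

lemma lookup_word: "lookup (word w) v = (if v = w then 1 else 0)"
  by (simp add: word_def lookup_single when_def)

definition lin :: "('a list \<Rightarrow> complex) \<Rightarrow> 'a nc \<Rightarrow> complex" where
  "lin \<phi> p = (\<Sum>w\<in>keys p. lookup p w * \<phi> w)"

definition lext :: "('a list \<Rightarrow> 'b nc) \<Rightarrow> 'a nc \<Rightarrow> 'b nc" where
  "lext F p = (\<Sum>w\<in>keys p. scale (lookup p w) (F w))"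

text \<open>The support of a sum may be smaller than the union of the supports; summing over a
  common finite superset is what makes additivity provable.\<close>

lemma lin_superset:
  assumes "finite S" "keys p \<subseteq> S"
  shows "lin \<phi> p = (\<Sum>w\<in>S. lookup p w * \<phi> w)"
  unfolding lin_def using assms by (intro sum.mono_neutral_left) (auto simp: in_keys_iff)

lemma lext_superset:
  assumes "finite S" "keys p \<subseteq> S"
  shows "lext \<phi> p = (\<Sum>w\<in>S. scale (lookup p w) (\<phi> w))"
  unfolding lext_def using assms by (intro sum.mono_neutral_left) (auto simp: in_keys_iff)

lemma lin_zero [simp]: "lin \<phi> 0 = 0"
  by (simp add: lin_def)

lemma lin_word [simp]: "lin \<phi> (word w) = \<phi> w"
  by (simp add: lin_def lookup_word)

lemma lin_add: "lin \<phi> (p + q) = lin \<phi> p + lin \<phi> q"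
proof -
  let ?S = "keys p \<union> keys q"
  have "keys (p + q) \<subseteq> ?S" by (rule keys_add)
  thus ?thesis
    by (simp add: lin_superset[of ?S] lookup_add algebra_simps sum.distrib)
qed

lemma lin_scale: "lin \<phi> (scale c p) = c * lin \<phi> p"
proof -
  have "keys (scale c p) \<subseteq> keys p" by (auto simp: in_keys_iff)
  thus ?thesis
    by (simp add: lin_superset[of "keys p"] sum_distrib_left mult.assoc)
qed

lemma lin_diff: "lin \<phi> (p - q) = lin \<phi> p - lin \<phi> q"
  using lin_add[of \<phi> p "scale (-1) q"] by (simp add: lin_scale del: scale_minus_one) simp

lemma lin_sum: "lin \<phi> (sum f A) = (\<Sum>x\<in>A. lin \<phi> (f x))"
  by (induction A rule: infinite_finite_induct) (auto simp: lin_add)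

lemma lin_cong: "(\<And>w. w \<in> keys p \<Longrightarrow> \<phi> w = \<psi> w) \<Longrightarrow> lin \<phi> p = lin \<psi> p"
  by (simp add: lin_def)

lemma lin_mult_const: "lin (\<lambda>w. c * \<phi> w) p = c * lin \<phi> p"
  by (simp add: lin_def sum_distrib_left mult_ac)

lemma lin_sum_fun: "lin (\<lambda>w. \<Sum>x\<in>A. \<phi> x w) p = (\<Sum>x\<in>A. lin (\<phi> x) p)"
  unfolding lin_def sum_distrib_left by (rule sum.swap)

lemma lext_zero [simp]: "lext \<phi> 0 = 0"
  by (simp add: lext_def)

lemma lext_word [simp]: "lext \<phi> (word w) = \<phi> w"
  by (simp add: lext_def lookup_word)

lemma lext_add: "lext \<phi> (p + q) = lext \<phi> p + lext \<phi> q"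
proof -
  let ?S = "keys p \<union> keys q"
  have "keys (p + q) \<subseteq> ?S" by (rule keys_add)
  thus ?thesis
    by (simp add: lext_superset[of ?S] lookup_add scale_add_left sum.distrib)
qed

lemma lext_scale: "lext \<phi> (scale c p) = scale c (lext \<phi> p)"
proof -
  have "keys (scale c p) \<subseteq> keys p" by (auto simp: in_keys_iff)
  thus ?thesis
    by (simp add: lext_superset[of "keys p"] scale_sum)
qed

lemma lext_diff: "lext \<phi> (p - q) = lext \<phi> p - lext \<phi> q"
  using lext_add[of \<phi> p "scale (-1) q"] by (simp add: lext_scale del: scale_minus_one) simp

lemma lext_sum: "lext \<phi> (sum f A) = (\<Sum>x\<in>A. lext \<phi> (f x))"
  by (induction A rule: infinite_finite_induct) (auto simp: lext_add)

lemma lext_fun_add: "lext (\<lambda>w. F w + G w) p = lext F p + lext G p"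
  by (simp add: lext_def scale_add_right sum.distrib)

lemma lext_fun_diff: "lext (\<lambda>w. F w - G w) p = lext F p - lext G p"
  by (simp add: lext_def scale_diff_right sum_subtractf)

lemma lext_fun_scale: "lext (\<lambda>w. scale c (F w)) p = scale c (lext F p)"
  by (simp add: lext_def scale_sum mult.commute)

lemma lext_word_id [simp]: "lext word p = p"
proof (rule poly_mapping_eqI)
  fix w
  show "lookup (lext word p) w = lookup p w"
    by (auto simp: lext_def lookup_sum lookup_word if_distrib[of "\<lambda>x. _ * x"] sum.delta in_keys_iff
        cong: if_cong)
qed

lemma lin_lext: "lin \<phi> (lext F p) = lin (\<lambda>w. lin \<phi> (F w)) p"
  by (simp add: lext_def lin_sum lin_scale) (simp add: lin_def)

lemma lext_lext: "lext G (lext F p) = lext (\<lambda>w. lext G (F w)) p"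
  by (simp add: lext_def[of F] lext_sum lext_scale) (simp add: lext_def)

section \<open>Bilinear extension and concatenation\<close>

lemma bilinear_ext_eq: "bilinear_ext F p q = lext (\<lambda>u. lext (F u) q) p"
  by (simp add: bilinear_ext_def lext_def scale_sum)

lemma conc_eq: "conc p q = lext (\<lambda>u. lext (\<lambda>v. word (u @ v)) q) p"
proof -
  have "Poly_Mapping.single w c = scale c (word w)" for c and w :: "'a list"
    by (rule poly_mapping_eqI) (simp add: lookup_word lookup_single when_def)
  thus ?thesis by (simp add: conc_def lext_def scale_sum)
qed

lemma conc_word: "conc p (word v) = lext (\<lambda>u. word (u @ v)) p"
  by (simp add: conc_eq)

lemma word_conc: "conc (word u) q = lext (\<lambda>v. word (u @ v)) q"
  by (simp add: conc_eq)

lemma conc_add: "conc (p + p') q = conc p q + conc p' q" "conc p (q + q') = conc p q + conc p q'"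
  by (simp_all add: conc_eq lext_add lext_fun_add)

lemma conc_diff: "conc (p - p') q = conc p q - conc p' q" "conc p (q - q') = conc p q - conc p q'"
  by (simp_all add: conc_eq lext_diff lext_fun_diff)

lemma conc_scale: "conc (scale c p) q = scale c (conc p q)" "conc p (scale c q) = scale c (conc p q)"
  by (simp_all add: conc_eq lext_scale lext_fun_scale)

lemma conc_zero [simp]: "conc 0 q = 0" "conc p 0 = 0"
  using conc_scale[of 0 0 q] conc_scale(2)[of p 0 0] by simp_all

lemma conc_sum_right: "conc p (sum f A) = (\<Sum>x\<in>A. conc p (f x))"
  by (induction A rule: infinite_finite_induct) (auto simp: conc_add)

lemma conc_word_word [simp]: "conc (word u) (word v) = word (u @ v)"
  by (simp add: conc_eq)

lemma conc_conc_word: "conc (conc p (word u)) (word v) = conc p (word (u @ v))"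
  by (simp add: conc_word lext_lext)

lemma conc_Nil [simp]: "conc p (word []) = p"
  by (simp add: conc_word)

lemma lin_conc_word: "lin \<phi> (conc p (word v)) = lin (\<lambda>u. \<phi> (u @ v)) p"
  by (simp add: conc_word lin_lext)

lemma lin_conc: "lin \<phi> (conc p q) = lin (\<lambda>u. lin (\<lambda>v. \<phi> (u @ v)) q) p"
  by (simp add: conc_eq lin_lext)

lemma keys_lextD:
  assumes "w \<in> keys (lext F p)"
  shows "\<exists>u\<in>keys p. w \<in> keys (F u)"
proof (rule ccontr)
  assume "\<not> ?thesis"
  hence "lookup (F u) w = 0" if "u \<in> keys p" for u
    using that by (auto simp: in_keys_iff)
  hence "lookup (lext F p) w = 0"
    by (simp add: lext_def lookup_sum)
  thus False using assms by (simp add: in_keys_iff)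
qed

subsection \<open>Submodules and spans\<close>

text \<open>Closure is asked for scalars in \<open>K\<close> only: the spans over Q[\<mu>] are not
  complex subspaces in general.\<close>

definition submod :: "complex set \<Rightarrow> (complex \<Rightarrow> 'b \<Rightarrow> 'b) \<Rightarrow> 'b::comm_monoid_add set \<Rightarrow> bool" where
  "submod K s M \<longleftrightarrow> 0 \<in> M \<and> (\<forall>x\<in>M. \<forall>y\<in>M. x + y \<in> M) \<and> (\<forall>c\<in>K. \<forall>x\<in>M. s c x \<in> M)"

lemma submodI:
  "0 \<in> M \<Longrightarrow> (\<And>x y. x \<in> M \<Longrightarrow> y \<in> M \<Longrightarrow> x + y \<in> M) \<Longrightarrow>
   (\<And>c x. c \<in> K \<Longrightarrow> x \<in> M \<Longrightarrow> s c x \<in> M) \<Longrightarrow> submod K s M"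
  by (auto simp: submod_def)

lemma submodD:
  assumes "submod K s M"
  shows "0 \<in> M" "x \<in> M \<Longrightarrow> y \<in> M \<Longrightarrow> x + y \<in> M" "c \<in> K \<Longrightarrow> x \<in> M \<Longrightarrow> s c x \<in> M"
  using assms by (auto simp: submod_def)

lemma submod_sum:
  assumes "submod K s M" "\<And>x. x \<in> A \<Longrightarrow> f x \<in> M"
  shows "sum f A \<in> M"
  using assms(2) by (induction A rule: infinite_finite_induct) (auto intro: submodD[OF assms(1)])

lemma span_subset:
  assumes "submod K s M" "B \<subseteq> M"
  shows "span_over K s B \<subseteq> M"
proof
  fix x assume "x \<in> span_over K s B"
  then obtain F c where "finite F" "F \<subseteq> B" "c ` F \<subseteq> K" "x = (\<Sum>b\<in>F. s (c b) b)"
    by (auto simp: span_over_def)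
  thus "x \<in> M"
    using assms by (auto intro!: submod_sum[OF assms(1)] submodD(3)[OF assms(1)])
qed

text \<open>Instantiated twice, for words with \<open>scale\<close> and for complex numbers with
  multiplication.\<close>

locale scalars =
  fixes K :: "complex set" and s :: "complex \<Rightarrow> 'b::comm_monoid_add \<Rightarrow> 'b"
  assumes K: "0 \<in> K" "1 \<in> K" "a \<in> K \<Longrightarrow> b \<in> K \<Longrightarrow> a + b \<in> K" "a \<in> K \<Longrightarrow> b \<in> K \<Longrightarrow> a * b \<in> K"
    and s: "s 0 x = 0" "s 1 x = x" "s (a + b) x = s a x + s b x" "s a (x + y) = s a x + s a y"
      "s a (s b x) = s (a * b) x" "s a 0 = 0"
begin

lemma span_base: "x \<in> B \<Longrightarrow> x \<in> span_over K s B"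
  unfolding span_over_def using K(2) s(2)
  by (auto intro!: exI[of _ "{x}"] exI[of _ "\<lambda>_. 1"])

lemma submod_span: "submod K s (span_over K s B)"
proof (rule submodI)
  show "0 \<in> span_over K s B"
    unfolding span_over_def by (auto intro!: exI[of _ "{}"])
next
  fix x y assume "x \<in> span_over K s B" "y \<in> span_over K s B"
  then obtain F c G d where *: "finite F" "F \<subseteq> B" "c ` F \<subseteq> K" "x = (\<Sum>b\<in>F. s (c b) b)"
    "finite G" "G \<subseteq> B" "d ` G \<subseteq> K" "y = (\<Sum>b\<in>G. s (d b) b)"
    by (auto simp: span_over_def)
  define c' where "c' b = (if b \<in> F then c b else 0)" for b
  define d' where "d' b = (if b \<in> G then d b else 0)" for b
  have "x = (\<Sum>b\<in>F \<union> G. s (c' b) b)" "y = (\<Sum>b\<in>F \<union> G. s (d' b) b)"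
    unfolding * using *(1,5) s(1)
    by (auto intro!: sum.mono_neutral_cong_left simp: c'_def d'_def)
  hence "x + y = (\<Sum>b\<in>F \<union> G. s (c' b + d' b) b)"
    by (simp add: s(3) sum.distrib)
  moreover have "(\<lambda>b. c' b + d' b) ` (F \<union> G) \<subseteq> K"
  proof -
    have "c' b \<in> K" "d' b \<in> K" for b
      using *(3,7) K(1) by (auto simp: c'_def d'_def)
    thus ?thesis by (auto intro: K(3))
  qed
  ultimately show "x + y \<in> span_over K s B"
    unfolding span_over_def using *(1,2,5,6)
    by (intro CollectI exI[of _ "F \<union> G"] exI[of _ "\<lambda>b. c' b + d' b"] conjI) auto
next
  fix a x assume a: "a \<in> K" and "x \<in> span_over K s B"
  then obtain F c where *: "finite F" "F \<subseteq> B" "c ` F \<subseteq> K" "x = (\<Sum>b\<in>F. s (c b) b)"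
    by (auto simp: span_over_def)
  have "s a (sum f F) = (\<Sum>b\<in>F. s a (f b))" for f
    using *(1) by (induction F rule: finite_induct) (auto simp: s)
  hence "s a x = (\<Sum>b\<in>F. s (a * c b) b)"
    by (simp add: * s(5))
  moreover have "(\<lambda>b. a * c b) ` F \<subseteq> K"
    using * a K(4) by auto
  ultimately show "s a x \<in> span_over K s B"
    unfolding span_over_def using *(1,2)
    by (intro CollectI exI[of _ F] exI[of _ "\<lambda>b. a * c b"] conjI) auto
qed

end

section \<open>The ring of scalars Q[\<mu>]\<close>

lemma map_poly_of_rat_add: "map_poly of_rat (p + q) = (map_poly of_rat p + map_poly of_rat q :: complex poly)"
  by (rule poly_eqI) (simp add: coeff_map_poly of_rat_add)

lemma map_poly_of_rat_mult: "map_poly of_rat (p * q) = (map_poly of_rat p * map_poly of_rat q :: complex poly)"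
  by (rule poly_eqI) (simp add: coeff_map_poly coeff_mult of_rat_sum of_rat_mult)

lemma Qmu_of_rat [simp]: "of_rat r \<in> Qmu \<mu>"
  unfolding Qmu_def by (auto intro!: exI[of _ "[:r:]"] simp: map_poly_pCons)

lemma Qmu_mu [simp]: "\<mu> \<in> Qmu \<mu>"
  unfolding Qmu_def by (auto intro!: exI[of _ "[:0,1:]"] simp: map_poly_pCons)

lemma Qmu_add: "a \<in> Qmu \<mu> \<Longrightarrow> b \<in> Qmu \<mu> \<Longrightarrow> a + b \<in> Qmu \<mu>"
proof -
  assume "a \<in> Qmu \<mu>" "b \<in> Qmu \<mu>"
  then obtain p q where "a = poly (map_poly of_rat p) \<mu>" "b = poly (map_poly of_rat q) \<mu>"
    by (auto simp: Qmu_def)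
  hence "a + b = poly (map_poly of_rat (p + q)) \<mu>"
    by (simp add: map_poly_of_rat_add)
  thus ?thesis unfolding Qmu_def by blast
qed

lemma Qmu_mult: "a \<in> Qmu \<mu> \<Longrightarrow> b \<in> Qmu \<mu> \<Longrightarrow> a * b \<in> Qmu \<mu>"
proof -
  assume "a \<in> Qmu \<mu>" "b \<in> Qmu \<mu>"
  then obtain p q where "a = poly (map_poly of_rat p) \<mu>" "b = poly (map_poly of_rat q) \<mu>"
    by (auto simp: Qmu_def)
  hence "a * b = poly (map_poly of_rat (p * q)) \<mu>"
    by (simp add: map_poly_of_rat_mult)
  thus ?thesis unfolding Qmu_def by blast
qed

text \<open>Inverses of natural numbers are included because \<open>generated_by_letter\<close>
  divides by j + 1, and -1 because submodules have to be closed under differences.\<close>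

lemma Qmu_consts [simp]: "0 \<in> Qmu \<mu>" "1 \<in> Qmu \<mu>" "-1 \<in> Qmu \<mu>" "of_nat n \<in> Qmu \<mu>"
    "inverse (of_nat n) \<in> Qmu \<mu>"
  using Qmu_of_rat[of 0 \<mu>] Qmu_of_rat[of 1 \<mu>] Qmu_of_rat[of "-1" \<mu>] Qmu_of_rat[of "of_nat n" \<mu>]
    Qmu_of_rat[of "inverse (of_nat n)" \<mu>]
  by (simp_all add: of_rat_inverse)

interpretation nc: scalars "Qmu \<mu>" scale
  by standard (auto simp: scale_add_left scale_add_right intro: Qmu_add Qmu_mult)

interpretation cx: scalars "Qmu \<mu>" "(*)"
  by standard (auto simp: algebra_simps intro: Qmu_add Qmu_mult)

lemma submod_diff:
  assumes "submod (Qmu \<mu>) scale M" "p \<in> M" "q \<in> M"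
  shows "p - q \<in> M"
proof -
  have "p + scale (-1) q \<in> M"
    by (intro submodD(2,3)[OF assms(1)] assms) auto
  thus ?thesis by simp
qed

lemma lext_in_submod:
  assumes "submod (Qmu \<mu>) scale M" "p \<in> span_over (Qmu \<mu>) scale {word w | w. P w}"
    and "\<And>w. P w \<Longrightarrow> F w \<in> M"
  shows "lext F p \<in> M"
proof -
  have "submod (Qmu \<mu>) scale {p. lext F p \<in> M}"
    by (rule submodI) (auto simp: lext_add lext_scale intro: submodD[OF assms(1)])
  hence "span_over (Qmu \<mu>) scale {word w | w. P w} \<subseteq> {p. lext F p \<in> M}"
    by (rule span_subset) (auto intro: assms(3))
  thus ?thesis using assms(2) by auto
qed

lemma lin_eq_on_span:
  assumes "p \<in> span_over (Qmu \<mu>) scale {word w | w. P w}" "\<And>w. P w \<Longrightarrow> \<phi> w = \<psi> w"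
  shows "lin \<phi> p = lin \<psi> p"
proof -
  have "submod (Qmu \<mu>) scale {p. lin \<phi> p = lin \<psi> p}"
    by (rule submodI) (auto simp: lin_add lin_scale)
  moreover have "{word w |w. P w} \<subseteq> {p. lin \<phi> p = lin \<psi> p}" using assms(2) by auto
  ultimately show ?thesis using span_subset assms(1) by blast
qed

section \<open>Partial fractions\<close>

text \<open>The condition inside the definite description \<open>partial_fraction\<close>, so that
  existence and uniqueness can be argued separately.\<close>

definition is_pf :: "nat \<Rightarrow> rat \<Rightarrow> nat \<Rightarrow> rat \<Rightarrow> (nat \<Rightarrow> rat) \<Rightarrow> (nat \<Rightarrow> rat) \<Rightarrow> bool" where
  "is_pf k1 m1 k2 m2 a b \<longleftrightarrow>
     (\<forall>i. i \<notin> {1..k1} \<longrightarrow> a i = 0) \<and> (\<forall>j. j \<notin> {1..k2} \<longrightarrow> b j = 0) \<and>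
     (\<forall>x::rat. x + m1 \<noteq> 0 \<longrightarrow> x + m2 \<noteq> 0 \<longrightarrow>
        1 / ((x + m1) ^ k1 * (x + m2) ^ k2) =
        (\<Sum>i=1..k1. a i / (x + m1) ^ i) + (\<Sum>j=1..k2. b j / (x + m2) ^ j))"

lemma sum_support_extend:
  fixes a :: "nat \<Rightarrow> rat" and f :: "nat \<Rightarrow> complex"
  assumes "\<forall>i. i \<notin> {1..k} \<longrightarrow> a i = 0" "k \<le> l"
  shows "(\<Sum>i=1..l. of_rat (a i) / f i) = (\<Sum>i=1..k. of_rat (a i) / f i)"
  using assms by (intro sum.mono_neutral_right) auto

text \<open>The induction rests on \<open>(m\<^sub>2 - m\<^sub>1)/(AB) = 1/A - 1/B\<close> for \<open>A = x + m\<^sub>1\<close>, \<open>B = x + m\<^sub>2\<close>.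
  The sum \<open>a 1 + b 1\<close> is the residue at infinity.\<close>

lemma pf_exists_complex:
  fixes m1 m2 :: rat
  assumes "m1 \<noteq> m2" "k1 + k2 \<ge> 1"
  shows "\<exists>a b :: nat \<Rightarrow> rat.
     (\<forall>i. i \<notin> {1..k1} \<longrightarrow> a i = 0) \<and> (\<forall>j. j \<notin> {1..k2} \<longrightarrow> b j = 0) \<and>
     a 1 + b 1 = (if k1 + k2 = 1 then 1 else 0) \<and>
     (\<forall>x::complex. x + of_rat m1 \<noteq> 0 \<longrightarrow> x + of_rat m2 \<noteq> 0 \<longrightarrow>
        1 / ((x + of_rat m1) ^ k1 * (x + of_rat m2) ^ k2) =
        (\<Sum>i=1..k1. of_rat (a i) / (x + of_rat m1) ^ i) + (\<Sum>j=1..k2. of_rat (b j) / (x + of_rat m2) ^ j))"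
  using assms(2)
proof (induction "k1 + k2" arbitrary: k1 k2 rule: less_induct)
  case less
  consider (a) "k2 = 0" | (b) "k1 = 0" "k2 \<noteq> 0" | (c) "k1 \<noteq> 0" "k2 \<noteq> 0" by blast
  thus ?case
  proof cases
    case a
    show ?thesis using a less.prems
      by (intro exI[of _ "\<lambda>i. if i = k1 then 1 else 0"] exI[of _ "\<lambda>_. 0"])
         (auto simp: if_distrib[of of_rat] if_distrib[of "\<lambda>x. x / _"] sum.delta' sum.delta cong: if_cong)
  next
    case b
    show ?thesis using b
      by (intro exI[of _ "\<lambda>_. 0"] exI[of _ "\<lambda>i. if i = k2 then 1 else 0"])
         (auto simp: if_distrib[of of_rat] if_distrib[of "\<lambda>x. x / _"] sum.delta' sum.delta cong: if_cong)
  next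
    case c
    then obtain l1 l2 where l: "k1 = Suc l1" "k2 = Suc l2"
      by (meson not0_implies_Suc)
    define d where "d = 1 / (m2 - m1)"
    from less.hyps[of k1 l2] l obtain a b where ab:
      "\<forall>i. i \<notin> {1..k1} \<longrightarrow> a i = 0" "\<forall>j. j \<notin> {1..l2} \<longrightarrow> b j = 0"
      "a 1 + b 1 = (if k1 + l2 = 1 then 1 else 0)"
      "\<And>x::complex. x + of_rat m1 \<noteq> 0 \<Longrightarrow> x + of_rat m2 \<noteq> 0 \<Longrightarrow>
        1 / ((x + of_rat m1) ^ k1 * (x + of_rat m2) ^ l2) =
        (\<Sum>i=1..k1. of_rat (a i) / (x + of_rat m1) ^ i) + (\<Sum>j=1..l2. of_rat (b j) / (x + of_rat m2) ^ j)"
      by auto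
    from less.hyps[of l1 k2] l obtain a' b' where ab':
      "\<forall>i. i \<notin> {1..l1} \<longrightarrow> a' i = 0" "\<forall>j. j \<notin> {1..k2} \<longrightarrow> b' j = 0"
      "a' 1 + b' 1 = (if l1 + k2 = 1 then 1 else 0)"
      "\<And>x::complex. x + of_rat m1 \<noteq> 0 \<Longrightarrow> x + of_rat m2 \<noteq> 0 \<Longrightarrow>
        1 / ((x + of_rat m1) ^ l1 * (x + of_rat m2) ^ k2) =
        (\<Sum>i=1..l1. of_rat (a' i) / (x + of_rat m1) ^ i) + (\<Sum>j=1..k2. of_rat (b' j) / (x + of_rat m2) ^ j)"
      by auto
    have "d * (a i - a' i) = 0" if "i \<notin> {1..k1}" for i
      using ab(1) ab'(1) l that by auto
    moreover have "d * (b i - b' i) = 0" if "i \<notin> {1..k2}" for i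
      using ab(2) ab'(2) l that by auto
    \<comment> \<open>Both smaller exponent pairs have the same sum k1 + k2 - 1, so their residues
      at infinity agree and cancel.\<close>
    moreover have "d * (a 1 - a' 1) + d * (b 1 - b' 1) = (if k1 + k2 = 1 then 1 else 0)"
    proof -
      have "d * (a 1 - a' 1) + d * (b 1 - b' 1) = d * ((a 1 + b 1) - (a' 1 + b' 1))"
        by (simp add: algebra_simps)
      thus ?thesis unfolding ab(3) ab'(3) using l by simp
    qed
    moreover have "1 / ((x + of_rat m1) ^ k1 * (x + of_rat m2) ^ k2) =
        (\<Sum>i=1..k1. of_rat (d * (a i - a' i)) / (x + of_rat m1) ^ i) +
        (\<Sum>j=1..k2. of_rat (d * (b j - b' j)) / (x + of_rat m2) ^ j)"
      if x: "x + of_rat m1 \<noteq> 0" "x + of_rat m2 \<noteq> 0" for x :: complex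
    proof -
      define A B where "A = x + of_rat m1" and "B = x + of_rat m2"
      have AB: "A \<noteq> 0" "B \<noteq> 0" using x by (auto simp: A_def B_def)
      have BA: "B - A = of_rat (m2 - m1)" by (simp add: A_def B_def of_rat_diff)
      have d: "of_rat d * (B - A) = 1"
        unfolding BA d_def of_rat_mult[symmetric] using assms(1) by simp
      have "1 / (A ^ k1 * B ^ k2) = of_rat d * (B - A) * (1 / (A ^ k1 * B ^ k2))"
        by (simp add: d)
      also have "\<dots> = of_rat d * (1 / (A ^ k1 * B ^ l2) - 1 / (A ^ l1 * B ^ k2))"
        using AB by (simp add: l field_simps)
      also have "1 / (A ^ k1 * B ^ l2) = (\<Sum>i=1..k1. of_rat (a i) / A ^ i) + (\<Sum>j=1..k2. of_rat (b j) / B ^ j)"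
        using ab(4)[OF x] sum_support_extend[OF ab(2), of k2 "\<lambda>j. B ^ j"] unfolding A_def B_def by (simp only: l le_SucI order_refl)
      also have "1 / (A ^ l1 * B ^ k2) = (\<Sum>i=1..k1. of_rat (a' i) / A ^ i) + (\<Sum>j=1..k2. of_rat (b' j) / B ^ j)"
        using ab'(4)[OF x] sum_support_extend[OF ab'(1), of k1 "\<lambda>i. A ^ i"] unfolding A_def B_def by (simp only: l le_SucI order_refl)
      also have "of_rat d * (((\<Sum>i=1..k1. of_rat (a i) / A ^ i) + (\<Sum>j=1..k2. of_rat (b j) / B ^ j)) -
          ((\<Sum>i=1..k1. of_rat (a' i) / A ^ i) + (\<Sum>j=1..k2. of_rat (b' j) / B ^ j))) =
          of_rat d * ((\<Sum>i=1..k1. of_rat (a i) / A ^ i) - (\<Sum>i=1..k1. of_rat (a' i) / A ^ i)) +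
          of_rat d * ((\<Sum>j=1..k2. of_rat (b j) / B ^ j) - (\<Sum>j=1..k2. of_rat (b' j) / B ^ j))"
        by (simp only: algebra_simps)
      finally show ?thesis
        unfolding A_def B_def sum_subtractf[symmetric] sum_distrib_left of_rat_mult of_rat_diff
        by (simp only: diff_divide_distrib[symmetric] times_divide_eq_right)
    qed
    ultimately show ?thesis
      by (intro exI[of _ "\<lambda>i. d * (a i - a' i)"] exI[of _ "\<lambda>i. d * (b i - b' i)"]) blast
  qed
qed

lemma poly_zero_of_cofinite_roots:
  fixes p :: "rat poly"
  assumes "finite S" "\<And>x. x \<notin> S \<Longrightarrow> poly p x = 0"
  shows "p = 0"
proof (rule ccontr)
  assume "p \<noteq> 0"
  hence "finite {x. poly p x = 0}" by (rule poly_roots_finite)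
  moreover have "UNIV = S \<union> {x. poly p x = 0}" using assms(2) by auto
  ultimately have "finite (UNIV :: rat set)" using assms(1) by (metis finite_Un)
  thus False by (simp add: infinite_UNIV_char_0)
qed

text \<open>A pole of highest order k at -m1 cannot be cancelled. Multiplying by (x + m1)^k (x +
  m2)^k2 gives a polynomial that vanishes off two points, hence everywhere, whereas its value at -m1
  is a_k (m2 - m1)^k2.\<close>

lemma pf_zero_left:
  fixes m1 m2 :: rat
  assumes "m1 \<noteq> m2" and supp: "\<And>i. i \<notin> {1..k1} \<Longrightarrow> a i = 0"
    and eq: "\<And>x. x + m1 \<noteq> 0 \<Longrightarrow> x + m2 \<noteq> 0 \<Longrightarrow>
        (\<Sum>i=1..k1. a i / (x + m1) ^ i) + (\<Sum>j=1..k2. b j / (x + m2) ^ j) = 0"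
  shows "a i = 0"
proof (rule ccontr)
  assume "a i \<noteq> 0"
  define k where "k = Max {i. a i \<noteq> 0}"
  have fin: "finite {i. a i \<noteq> 0}"
    by (rule finite_subset[of _ "{1..k1}"]) (use supp in blast, simp)
  have "a k \<noteq> 0" using Max_in[OF fin] \<open>a i \<noteq> 0\<close> by (auto simp: k_def)
  hence k: "k \<in> {1..k1}" using supp by blast
  have gt: "a j = 0" if "j > k" for j
    using Max_ge[OF fin, of j] that by (auto simp: k_def)
  define A B where "A = [:m1, 1::rat:]" and "B = [:m2, 1::rat:]"
  define p where "p = (\<Sum>i=1..k. smult (a i) (A ^ (k - i))) * B ^ k2 + A ^ k * (\<Sum>j=1..k2. smult (b j) (B ^ (k2 - j)))"
  have "p = 0"
  proof (rule poly_zero_of_cofinite_roots)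
    show "finite {-m1, -m2}" by simp
    fix x assume "x \<notin> {-m1, -m2}"
    hence x: "x + m1 \<noteq> 0" "x + m2 \<noteq> 0" by (auto simp: add_eq_0_iff2)
    have "(\<Sum>i=1..k1. a i / (x + m1) ^ i) = (\<Sum>i=1..k. a i / (x + m1) ^ i)"
      using k gt by (intro sum.mono_neutral_right) auto
    moreover have "(\<Sum>i=1..k. a i * (x + m1) ^ (k - i)) = (\<Sum>i=1..k. a i / (x + m1) ^ i) * (x + m1) ^ k"
      unfolding sum_distrib_right using x by (intro sum.cong refl) (auto simp: power_diff)
    moreover have "(\<Sum>j=1..k2. b j * (x + m2) ^ (k2 - j)) = (\<Sum>j=1..k2. b j / (x + m2) ^ j) * (x + m2) ^ k2"
      unfolding sum_distrib_right using x by (intro sum.cong refl) (auto simp: power_diff)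
    ultimately have "poly p x = ((\<Sum>i=1..k1. a i / (x + m1) ^ i) + (\<Sum>j=1..k2. b j / (x + m2) ^ j))
        * ((x + m1) ^ k * (x + m2) ^ k2)"
      by (simp add: p_def A_def B_def poly_sum ring_distribs add.commute mult_ac)
    thus "poly p x = 0" using eq[OF x] by simp
  qed
  moreover have "poly p (-m1) = a k * (m2 - m1) ^ k2"
  proof -
    have "(\<Sum>i=1..k. a i * 0 ^ (k - i)) = (\<Sum>i\<in>{k}. a i * 0 ^ (k - i))"
      using k by (intro sum.mono_neutral_right) auto
    thus ?thesis using k by (simp add: p_def A_def B_def poly_sum power_0_left)
  qed
  ultimately show False using \<open>a k \<noteq> 0\<close> assms(1) by simp
qed

lemma is_pf_unique:
  assumes "m1 \<noteq> m2" "is_pf k1 m1 k2 m2 a b" "is_pf k1 m1 k2 m2 a' b'"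
  shows "a = a'" "b = b'"
proof -
  have *: "(\<Sum>i=1..k1. (a i - a' i) / (x + m1) ^ i) + (\<Sum>j=1..k2. (b j - b' j) / (x + m2) ^ j) = 0"
    if "x + m1 \<noteq> 0" "x + m2 \<noteq> 0" for x
  proof -
    have "(\<Sum>i=1..k1. a i / (x + m1) ^ i) + (\<Sum>j=1..k2. b j / (x + m2) ^ j) =
          (\<Sum>i=1..k1. a' i / (x + m1) ^ i) + (\<Sum>j=1..k2. b' j / (x + m2) ^ j)"
      using assms(2,3) that unfolding is_pf_def by metis
    thus ?thesis by (simp add: diff_divide_distrib sum_subtractf)
  qed
  have "a i - a' i = 0" for i
    by (rule pf_zero_left[OF assms(1), where ?k1.0 = k1 and a = "\<lambda>i. a i - a' i" and ?k2.0 = k2 and b = "\<lambda>i. b i - b' i"])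
       (use assms(2,3) * in \<open>auto simp: is_pf_def\<close>)
  thus "a = a'" by (auto simp: fun_eq_iff)
  have "b i - b' i = 0" for i
    by (rule pf_zero_left[OF assms(1)[symmetric], where ?k1.0 = k2 and a = "\<lambda>i. b i - b' i" and ?k2.0 = k1 and b = "\<lambda>i. a i - a' i"])
       (use assms(2,3) * in \<open>auto simp: is_pf_def add.commute\<close>)
  thus "b = b'" by (auto simp: fun_eq_iff)
qed

lemma partial_fraction_props:
  assumes "m1 \<noteq> m2" "k1 + k2 \<ge> 2" "partial_fraction k1 m1 k2 m2 = (a, b)"
  shows "\<forall>i. i \<notin> {1..k1} \<longrightarrow> a i = 0" "\<forall>j. j \<notin> {1..k2} \<longrightarrow> b j = 0" "a 1 + b 1 = 0"
    "x + of_rat m1 \<noteq> 0 \<Longrightarrow> x + of_rat m2 \<noteq> 0 \<Longrightarrow>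
        1 / ((x + of_rat m1) ^ k1 * (x + of_rat m2) ^ k2) =
        (\<Sum>i=1..k1. of_rat (a i) / (x + of_rat m1) ^ i) +
        (\<Sum>j=1..k2. of_rat (b j) / (x + of_rat m2 :: complex) ^ j)"
proof -
  from pf_exists_complex[OF assms(1), of k1 k2] assms(2) obtain a' b' where ab:
    "\<forall>i. i \<notin> {1..k1} \<longrightarrow> a' i = 0" "\<forall>j. j \<notin> {1..k2} \<longrightarrow> b' j = 0" "a' 1 + b' 1 = 0"
    "\<And>x::complex. x + of_rat m1 \<noteq> 0 \<Longrightarrow> x + of_rat m2 \<noteq> 0 \<Longrightarrow>
        1 / ((x + of_rat m1) ^ k1 * (x + of_rat m2) ^ k2) =
        (\<Sum>i=1..k1. of_rat (a' i) / (x + of_rat m1) ^ i) + (\<Sum>j=1..k2. of_rat (b' j) / (x + of_rat m2) ^ j)"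
    by auto
  \<comment> \<open>The definite description quantifies over rational x, so the complex identity is
    restricted; its complex form is what gets evaluated at x = n \<mu>.\<close>
  have "1 / ((x + m1) ^ k1 * (x + m2) ^ k2) =
        (\<Sum>i=1..k1. a' i / (x + m1) ^ i) + (\<Sum>j=1..k2. b' j / (x + m2) ^ j)"
    if x: "x + m1 \<noteq> 0" "x + m2 \<noteq> 0" for x :: rat
  proof -
    have nz: "of_rat x + of_rat m1 \<noteq> (0::complex)" "of_rat x + of_rat m2 \<noteq> (0::complex)"
      using x by (simp_all flip: of_rat_add)
    have "(of_rat (1 / ((x + m1) ^ k1 * (x + m2) ^ k2)) :: complex) =
        of_rat ((\<Sum>i=1..k1. a' i / (x + m1) ^ i) + (\<Sum>j=1..k2. b' j / (x + m2) ^ j))"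
      using ab(4)[OF nz] by (simp add: of_rat_sum of_rat_add of_rat_divide of_rat_mult of_rat_power)
    thus ?thesis by (simp only: of_rat_eq_iff)
  qed
  hence pf': "is_pf k1 m1 k2 m2 a' b'"
    using ab by (auto simp: is_pf_def)
  have "partial_fraction k1 m1 k2 m2 = (THE (a, b). is_pf k1 m1 k2 m2 a b)"
    by (simp only: partial_fraction_def is_pf_def)
  also have "\<dots> = (a', b')"
  proof (rule the_equality)
    fix ab assume "case ab of (a, b) \<Rightarrow> is_pf k1 m1 k2 m2 a b"
    thus "ab = (a', b')"
      by (cases ab) (use is_pf_unique[OF assms(1) _ pf'] in auto)
  qed (use pf' in auto)
  finally have [simp]: "a = a'" "b = b'" using assms(3) by auto
  show "\<forall>i. i \<notin> {1..k1} \<longrightarrow> a i = 0" "\<forall>j. j \<notin> {1..k2} \<longrightarrow> b j = 0" "a 1 + b 1 = 0"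
    using ab by auto
  show "x + of_rat m1 \<noteq> 0 \<Longrightarrow> x + of_rat m2 \<noteq> 0 \<Longrightarrow>
        1 / ((x + of_rat m1) ^ k1 * (x + of_rat m2) ^ k2) =
        (\<Sum>i=1..k1. of_rat (a i) / (x + of_rat m1) ^ i) +
        (\<Sum>j=1..k2. of_rat (b j) / (x + of_rat m2 :: complex) ^ j)"
    using ab(4) by simp
qed

section \<open>Nested sums\<close>

text \<open>The head of the list belongs to the outermost, largest index; a bi-index therefore
  enters reversed. The type is polymorphic so that the same sums can be formed with norms.\<close>

fun nsum :: "(nat \<Rightarrow> 'a) list \<Rightarrow> nat \<Rightarrow> 'a :: comm_semiring_1" where
  "nsum [] M = 1"
| "nsum (g # gs) M = (\<Sum>n\<le>M. g n * nsum gs n)"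

lemma finite_chains: "finite {ns \<in> chains r. set ns \<subseteq> {..M}}"
  by (rule finite_subset[OF _ finite_lists_length_eq[of "{..M}" r]]) (auto simp: chains_def)

lemma chains_0: "{ns \<in> chains 0. set ns \<subseteq> {..M}} = {[]}"
  by (auto simp: chains_def)

text \<open>The last entry of a weakly increasing chain is its maximum, so it bounds the remaining
  chain and the sum becomes iterated.\<close>

lemma chains_Suc:
  "{ns \<in> chains (Suc r). set ns \<subseteq> {..M}} =
     (\<lambda>(n, ns). ns @ [n]) ` (SIGMA n:{..M}. {ns \<in> chains r. set ns \<subseteq> {..n}})"
proof (intro equalityI subsetI)
  fix ns assume ns: "ns \<in> {ns \<in> chains (Suc r). set ns \<subseteq> {..M}}"
  then obtain ms n where "ns = ms @ [n]"
    by (cases ns rule: rev_cases) (auto simp: chains_def)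
  thus "ns \<in> (\<lambda>(n, ns). ns @ [n]) ` (SIGMA n:{..M}. {ns \<in> chains r. set ns \<subseteq> {..n}})"
    using ns by (auto simp: chains_def sorted_append intro!: image_eqI[of _ _ "(n, ms)"])
next
  fix ns assume "ns \<in> (\<lambda>(n, ns). ns @ [n]) ` (SIGMA n:{..M}. {ns \<in> chains r. set ns \<subseteq> {..n}})"
  thus "ns \<in> {ns \<in> chains (Suc r). set ns \<subseteq> {..M}}"
    by (fastforce simp: chains_def sorted_append)
qed

lemma sum_chains_eq_nsum:
  "(\<Sum>ns\<in>{ns \<in> chains (length gs). set ns \<subseteq> {..M}}. \<Prod>i<length gs. (gs ! i) (ns ! i)) = nsum (rev gs) M"
proof (induction gs arbitrary: M rule: rev_induct)
  case Nil
  thus ?case by (simp only: list.size chains_0) simp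
next
  case (snoc g gs)
  have inj: "inj_on (\<lambda>(n, ns). ns @ [n]) A" for A :: "(nat \<times> nat list) set"
    by (auto simp: inj_on_def)
  have "(\<Sum>ns\<in>{ns \<in> chains (Suc (length gs)). set ns \<subseteq> {..M}}. \<Prod>i<Suc (length gs). ((gs @ [g]) ! i) (ns ! i))
     = (\<Sum>(n, ns)\<in>(SIGMA n:{..M}. {ns \<in> chains (length gs). set ns \<subseteq> {..n}}).
          g n * (\<Prod>i<length gs. (gs ! i) (ns ! i)))"
    unfolding chains_Suc sum.reindex[OF inj]
    by (intro sum.cong refl) (auto simp: chains_def nth_append mult.commute)
  also have "\<dots> = (\<Sum>n\<le>M. g n * nsum (rev gs) n)"
    by (subst sum.Sigma[symmetric]) (auto simp: finite_chains simp flip: snoc sum_distrib_left)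
  finally show ?case by simp
qed

text \<open>The factor \<open>\<mu> ^ r\<close> of the series is distributed over the
  letters.\<close>

definition lterm :: "complex \<Rightarrow> nat \<times> rat \<Rightarrow> nat \<Rightarrow> complex" where
  "lterm \<mu> y n = \<mu> / factor \<mu> n y"

lemma prod_lterm:
  "(\<Prod>i<length w. (map (lterm \<mu>) w ! i) (ns ! i)) = \<mu> ^ length w / (\<Prod>i<length w. factor \<mu> (ns ! i) (w ! i))"
  by (simp add: lterm_def prod_dividef)

lemma zeta_trunc_nsum: "zeta_trunc \<mu> M w = nsum (rev (map (lterm \<mu>) w)) M"
  using sum_chains_eq_nsum[of "map (lterm \<mu>) w" M] unfolding length_map prod_lterm
  by (simp add: zeta_trunc_def)

lemma zeta_trunc_Nil [simp]: "zeta_trunc \<mu> M [] = 1"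
  by (simp add: zeta_trunc_nsum)

lemma zeta_trunc_snoc: "zeta_trunc \<mu> M (w @ [y]) = (\<Sum>n\<le>M. lterm \<mu> y n * zeta_trunc \<mu> n w)"
  by (simp add: zeta_trunc_nsum)

lemma zeta_star_trunc_eq: "zeta_star_trunc \<mu> M = lin (zeta_trunc \<mu> M)"
  by (simp add: fun_eq_iff zeta_star_trunc_def lin_def)

section \<open>The harmonic product\<close>

lemma nmu_nonzero:
  assumes "Re \<mu> > 0" "m > 0"
  shows "of_nat n * \<mu> + of_rat m \<noteq> 0"
proof -
  have r: "Re (of_rat m) = real_of_rat m"
    by (cases m) (simp add: of_rat_rat)
  have "Re (of_nat n * \<mu> + of_rat m) > 0"
    using assms by (simp add: r add_nonneg_pos)
  thus ?thesis by (metis less_irrefl zero_complex.sel(1))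
qed

lemma positive_simps [simp]:
  "positive []" "positive (y # w) \<longleftrightarrow> fst y \<ge> 1 \<and> snd y > 0 \<and> positive w"
  "positive (u @ v) \<longleftrightarrow> positive u \<and> positive v"
  by (auto simp: positive_def)

text \<open>This is the partial fraction identity at x = n \<mu>. The extra \<open>\<mu>\<close>
  balances the two factors \<open>\<mu>\<close> of the product against the single one carried by
  each letter of \<open>odot x y\<close>; \<open>last v\<close> reads off that letter, all words
  involved having length one.\<close>

lemma lin_odot:
  assumes \<mu>: "Re \<mu> > 0" and "positive [x, y]"
  shows "\<mu> * lin (\<lambda>v. lterm \<mu> (last v) n) (odot x y) = lterm \<mu> x n * lterm \<mu> y n"
proof -
  obtain k1 m1 k2 m2 where xy: "x = (k1, m1)" "y = (k2, m2)" by (cases x, cases y)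
  have pos: "k1 \<ge> 1" "k2 \<ge> 1" "m1 > 0" "m2 > 0" using assms xy by auto
  let ?t = "of_nat n * \<mu>"
  have nz: "?t + of_rat m1 \<noteq> 0" "?t + of_rat m2 \<noteq> 0" using nmu_nonzero[OF \<mu>] pos by auto
  show ?thesis
  proof (cases "m1 = m2")
    case True
    thus ?thesis by (simp add: xy odot_def lterm_def factor_def power_add)
  next
    case False
    obtain a b where ab: "partial_fraction k1 m1 k2 m2 = (a, b)" by (cases "partial_fraction k1 m1 k2 m2")
    have "\<mu> * lin (\<lambda>v. lterm \<mu> (last v) n) (odot x y) = \<mu> * \<mu> *
       ((\<Sum>i=1..k1. of_rat (a i) / (?t + of_rat m1) ^ i) + (\<Sum>j=1..k2. of_rat (b j) / (?t + of_rat m2) ^ j))"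
      using False by (simp add: odot_def xy ab lin_add lin_sum lin_scale lterm_def factor_def
          sum_distrib_left algebra_simps)
    also have "(\<Sum>i=1..k1. of_rat (a i) / (?t + of_rat m1) ^ i) + (\<Sum>j=1..k2. of_rat (b j) / (?t + of_rat m2) ^ j)
       = 1 / ((?t + of_rat m1) ^ k1 * (?t + of_rat m2) ^ k2)"
      by (rule partial_fraction_props(4)[OF False _ ab nz, symmetric]) (use pos in auto)
    finally show ?thesis by (simp add: lterm_def factor_def xy)
  qed
qed

lemma odot_single: "v \<in> keys (odot x y) \<Longrightarrow> \<exists>z. v = [z]"
proof -
  assume v: "v \<in> keys (odot x y)"
  have sc: "keys (scale c p) \<subseteq> keys p" for c and p :: "'a nc" by (auto simp: in_keys_iff)
  have "keys (sum f A) \<subseteq> (\<Union>x\<in>A. keys (f x))" for f :: "nat \<Rightarrow> (nat \<times> rat) nc" and A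
    by (induction A rule: infinite_finite_induct) (auto dest!: subsetD[OF keys_add])
  moreover have "keys (scale c (word [z])) \<subseteq> {[z]}" for c and z :: "nat \<times> rat" using sc[of c "word [z]"] by simp
  ultimately have "keys (\<Sum>i\<in>A. scale (g i) (word [h i])) \<subseteq> (\<lambda>i. [h i]) ` A" for g and h :: "nat \<Rightarrow> nat \<times> rat" and A
    by blast
  hence *: "v \<in> keys (\<Sum>i\<in>A. scale (g i) (word [h i])) \<Longrightarrow> \<exists>z. v = [z]" for g and h :: "nat \<Rightarrow> nat \<times> rat" and A
    by blast
  show ?thesis using v
    by (cases x; cases y) (auto simp: odot_def split: if_splits prod.splits dest!: subsetD[OF keys_add] *)
qed

text \<open>The square of index pairs is cut along the diagonal. With weak inequalities both halves
  contain the diagonal, whence the minus sign, which is also the sign in the harmonic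
  product.\<close>

lemma sum_mult_sum_atMost:
  fixes \<alpha> \<beta> :: "nat \<Rightarrow> 'a::comm_ring"
  shows "(\<Sum>n\<le>M. \<alpha> n) * (\<Sum>n\<le>M. \<beta> n) =
    (\<Sum>n\<le>M. \<alpha> n * (\<Sum>k\<le>n. \<beta> k) + (\<Sum>k\<le>n. \<alpha> k) * \<beta> n - \<alpha> n * \<beta> n)"
  by (induction M) (auto simp: algebra_simps)

text \<open>The recursion of \<open>harm_word\<close> is the identity
  \<open>sum_mult_sum_atMost\<close> for the outermost indices of the two sums, the diagonal being
  rewritten by \<open>lin_odot\<close>.\<close>

lemma zeta_trunc_harm_word:
  assumes \<mu>: "Re \<mu> > 0"
  shows "positive u \<Longrightarrow> positive v \<Longrightarrow>
     lin (zeta_trunc \<mu> M) (harm_word \<mu> u v) = zeta_trunc \<mu> M u * zeta_trunc \<mu> M v"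
proof (induction "length u + length v" arbitrary: u v M rule: less_induct)
  case less
  show ?case
  proof (cases "u = [] \<or> v = []")
    case False
    then obtain u' x v' y where uv: "u = u' @ [x]" "v = v' @ [y]"
      by (metis rev_exhaust)
    have *: "lin (zeta_trunc \<mu> M) (conc p (word [z])) = (\<Sum>n\<le>M. lterm \<mu> z n * lin (zeta_trunc \<mu> n) p)" for p z
      by (simp add: lin_conc_word zeta_trunc_snoc lin_sum_fun lin_mult_const)
    have o: "lin (zeta_trunc \<mu> M) (conc p (odot x y)) = (\<Sum>n\<le>M. lin (\<lambda>v. lterm \<mu> (last v) n) (odot x y) * lin (zeta_trunc \<mu> n) p)" for p
    proof -
      have "lin (\<lambda>v. zeta_trunc \<mu> M (u @ v)) (odot x y) =
            (\<Sum>n\<le>M. lin (\<lambda>v. lterm \<mu> (last v) n) (odot x y) * zeta_trunc \<mu> n u)" for u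
      proof -
        have "lin (\<lambda>v. zeta_trunc \<mu> M (u @ v)) (odot x y) = lin (\<lambda>v. \<Sum>n\<le>M. zeta_trunc \<mu> n u * lterm \<mu> (last v) n) (odot x y)"
          by (rule lin_cong) (auto dest!: odot_single simp: zeta_trunc_snoc mult.commute)
        thus ?thesis by (simp add: lin_sum_fun lin_mult_const mult.commute)
      qed
      thus ?thesis by (simp add: lin_conc lin_sum_fun lin_mult_const)
    qed
    define A B where "A = (\<lambda>n. zeta_trunc \<mu> n u')" and "B = (\<lambda>n. zeta_trunc \<mu> n v')"
    have xy: "positive [x, y]" using less.prems uv by auto
    have "lin (zeta_trunc \<mu> M) (harm_word \<mu> u v) =
      (\<Sum>n\<le>M. lterm \<mu> x n * (zeta_trunc \<mu> n u' * zeta_trunc \<mu> n v))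
      + (\<Sum>n\<le>M. lterm \<mu> y n * (zeta_trunc \<mu> n u * zeta_trunc \<mu> n v'))
      - (\<Sum>n\<le>M. (\<mu> * lin (\<lambda>v. lterm \<mu> (last v) n) (odot x y)) * (zeta_trunc \<mu> n u' * zeta_trunc \<mu> n v'))"
      unfolding uv harm_word_snoc lin_diff lin_add lin_scale * o
      using less.hyps[of u' "v' @ [y]"] less.hyps[of "u' @ [x]" v'] less.hyps[of u' v'] less.prems uv
      by (simp add: sum_distrib_left mult.assoc)
    also have "\<dots> = zeta_trunc \<mu> M u * zeta_trunc \<mu> M v"
      unfolding lin_odot[OF \<mu> xy] unfolding uv zeta_trunc_snoc sum_mult_sum_atMost
      by (simp add: sum_subtractf sum.distrib mult_ac)
    finally show ?thesis .
  qed auto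
qed

lemma harm_eq: "harm \<mu> p q = lext (\<lambda>u. lext (harm_word \<mu> u) q) p"
  by (simp add: harm_def bilinear_ext_eq)

lemma QY_submod: "submod (Qmu \<mu>) scale (QY \<mu>)"
  unfolding QY_def by (rule nc.submod_span)

lemma QY_word: "positive w \<Longrightarrow> word w \<in> QY \<mu>"
  unfolding QY_def by (rule nc.span_base) auto

lemma QY_lext:
  assumes "submod (Qmu \<mu>) scale M" "p \<in> QY \<mu>" "\<And>w. positive w \<Longrightarrow> F w \<in> M"
  shows "lext F p \<in> M"
  using lext_in_submod[OF assms(1) assms(2)[unfolded QY_def]] assms(3) by blast

lemma QY_conc_word:
  assumes "p \<in> QY \<mu>" "positive v"
  shows "conc p (word v) \<in> QY \<mu>"
  unfolding conc_word using assms by (intro QY_lext[OF QY_submod]) (auto intro!: QY_word)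

lemmas lin_eq_on_QY = lin_eq_on_span[of _ \<mu> positive for \<mu>, folded QY_def]

lemma zeta_star_trunc_harm:
  assumes \<mu>: "Re \<mu> > 0" and "p \<in> QY \<mu>" "q \<in> QY \<mu>"
  shows "lin (zeta_trunc \<mu> M) (harm \<mu> p q) = lin (zeta_trunc \<mu> M) p * lin (zeta_trunc \<mu> M) q"
proof -
  have "lin (zeta_trunc \<mu> M) (harm \<mu> p q) = lin (\<lambda>u. lin (\<lambda>v. lin (zeta_trunc \<mu> M) (harm_word \<mu> u v)) q) p"
    by (simp add: harm_eq lin_lext)
  also have "\<dots> = lin (\<lambda>u. lin (zeta_trunc \<mu> M) q * zeta_trunc \<mu> M u) p"
  proof (rule lin_eq_on_QY[OF assms(2)])
    fix u assume u: "positive u"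
    have "lin (\<lambda>v. lin (zeta_trunc \<mu> M) (harm_word \<mu> u v)) q = lin (\<lambda>v. zeta_trunc \<mu> M u * zeta_trunc \<mu> M v) q"
      by (rule lin_eq_on_QY[OF assms(3)]) (simp add: zeta_trunc_harm_word[OF \<mu> u])
    thus "lin (\<lambda>v. lin (zeta_trunc \<mu> M) (harm_word \<mu> u v)) q = lin (zeta_trunc \<mu> M) q * zeta_trunc \<mu> M u"
      by (simp add: lin_mult_const)
  qed
  finally show ?thesis by (simp add: lin_mult_const)
qed

section \<open>Generation by one letter\<close>

text \<open>\<open>D\<close> stands for multiplication by the letter y. On p y^j with p in
  \<open>A0\<close> it yields (j + 1) p y^(j+1) modulo elements with at most j trailing letters y,
  and j + 1 is invertible in Q[\<mu>]; so closure under \<open>D\<close> gives closure under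
  appending y, and \<open>gen\<close> says that appending y reaches all of \<open>A\<close>. Leaving
  \<open>D\<close> abstract covers both products: the error in \<open>step\<close> is 0 for the
  shuffle product and comes from y \<odot> y for the harmonic one.\<close>

lemma generated_by_letter:
  fixes y :: 'a and D :: "'a nc \<Rightarrow> 'a nc"
  assumes A: "submod (Qmu \<mu>) scale A" and A0: "A0 = span_over (Qmu \<mu>) scale G" and sub: "A0 \<subseteq> A"
    and Ay: "\<And>p. p \<in> A \<Longrightarrow> conc p (word [y]) \<in> A"
    and D: "\<And>p q. D (p + q) = D p + D q" "\<And>c p. D (scale c p) = scale c (D p)"
    and base_gen: "\<And>p. p \<in> G \<Longrightarrow> D p - conc p (word [y]) \<in> A0"
    and step: "\<And>q. q \<in> A \<Longrightarrow> D (conc q (word [y])) - conc (D q) (word [y]) - conc q (word [y, y]) \<in> A0"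
    and gen: "\<And>M. submod (Qmu \<mu>) scale M \<Longrightarrow> A0 \<subseteq> M \<Longrightarrow> (\<And>p. p \<in> M \<Longrightarrow> conc p (word [y]) \<in> M) \<Longrightarrow> A \<subseteq> M"
    and B: "submod (Qmu \<mu>) scale B" "A0 \<subseteq> B" "\<And>p. p \<in> B \<Longrightarrow> p \<in> A \<Longrightarrow> D p \<in> B"
  shows "A \<subseteq> B"
proof -
  have sA0: "submod (Qmu \<mu>) scale A0" unfolding A0 by (rule nc.submod_span)
  have D0: "D 0 = 0" using D(2)[of 0 0] by simp
  have base: "D p - conc p (word [y]) \<in> A0" if "p \<in> A0" for p
  proof -
    define E where "E p = D p - conc p (word [y])" for p
    have "E (p + q) = E p + E q" "E (scale c p) = scale c (E p)" "E 0 = 0" for p q c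
      by (simp_all add: E_def D D0 conc_add conc_scale scale_diff_right)
    hence "submod (Qmu \<mu>) scale {p. E p \<in> A0}"
      by (intro submodI) (auto intro: submodD[OF sA0])
    hence "A0 \<subseteq> {p. E p \<in> A0}"
      unfolding A0 by (rule span_subset) (use base_gen in \<open>auto simp: E_def A0\<close>)
    thus ?thesis using that by (auto simp: E_def)
  qed
  \<comment> \<open>Filtration of \<open>A\<close> by the number of trailing letters y.\<close>
  define F where "F j = span_over (Qmu \<mu>) scale {conc p (word (replicate i y)) | p i. p \<in> A0 \<and> i \<le> j}" for j
  have F: "submod (Qmu \<mu>) scale (F j)" for j
    unfolding F_def by (rule nc.submod_span)
  have F_base: "conc p (word (replicate i y)) \<in> F j" if "p \<in> A0" "i \<le> j" for p i j
    unfolding F_def by (rule nc.span_base) (use that in blast)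
  have F_sub: "F j \<subseteq> M" if "submod (Qmu \<mu>) scale M" "\<And>p i. p \<in> A0 \<Longrightarrow> i \<le> j \<Longrightarrow> conc p (word (replicate i y)) \<in> M" for j M
    unfolding F_def by (rule span_subset[OF that(1)]) (use that(2) in auto)
  have F_A0: "p \<in> F j" if "p \<in> A0" for p j
    using F_base[OF that, of 0 j] by simp
  have rep: "conc (conc p (word (replicate i y))) (word [y]) = conc p (word (replicate (Suc i) y))" for p i
    by (simp add: conc_conc_word replicate_append_same)
  have rep2: "conc (conc p (word (replicate i y))) (word [y, y]) = conc p (word (replicate (Suc (Suc i)) y))" for p i
  proof -
    have "replicate i y @ [y, y] = replicate (Suc (Suc i)) y"
      by (induction i) auto
    thus ?thesis by (simp add: conc_conc_word)
  qed
  have F_mono: "F i \<subseteq> F j" if "i \<le> j" for i j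
    by (rule F_sub[OF F]) (use F_base that in force)
  have F_y: "conc p (word [y]) \<in> F (Suc j)" if "p \<in> F j" for p j
  proof -
    have "F j \<subseteq> {p. conc p (word [y]) \<in> F (Suc j)}"
    proof (rule F_sub)
      show "submod (Qmu \<mu>) scale {p. conc p (word [y]) \<in> F (Suc j)}"
        by (rule submodI) (auto simp: conc_add conc_scale intro: submodD[OF F])
      show "conc p (word (replicate i y)) \<in> {p. conc p (word [y]) \<in> F (Suc j)}"
        if "p \<in> A0" "i \<le> j" for p i
        using F_base[OF that(1), of "Suc i" "Suc j"] that(2) by (simp only: rep mem_Collect_eq)
    qed
    thus ?thesis using that by blast
  qed
  have inA: "conc p (word (replicate i y)) \<in> A" if "p \<in> A0" for p i
  proof (induction i)
    case 0
    thus ?case using that sub by auto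
  next
    case (Suc i)
    thus ?case using Ay by (simp only: rep[symmetric])
  qed
  \<comment> \<open>The factor counts the j + 1 positions in which y can be inserted among the j
    trailing letters y.\<close>
  have claim: "D (conc p (word (replicate j y))) - scale (of_nat (Suc j)) (conc p (word (replicate (Suc j) y))) \<in> F j"
    if p: "p \<in> A0" for p j
  proof (induction j)
    case 0
    thus ?case using F_A0[OF base[OF p]] by simp
  next
    case (Suc j)
    let ?q = "conc p (word (replicate j y))"
    let ?f = "D ?q - scale (of_nat (Suc j)) (conc ?q (word [y]))"
    let ?e = "D (conc ?q (word [y])) - conc (D ?q) (word [y]) - conc ?q (word [y, y])"
    have "?f \<in> F j" using Suc by (simp only: rep)
    hence "conc ?f (word [y]) \<in> F (Suc j)" by (rule F_y)
    moreover have "?e \<in> F (Suc j)" by (intro F_A0 step inA p)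
    ultimately have "conc ?f (word [y]) + ?e \<in> F (Suc j)"
      by (rule submodD(2)[OF F])
    moreover have "scale 2 x = x + x" for x :: "'a nc"
      using scale_add_left[of 1 1 x] by simp
    hence "conc ?f (word [y]) + ?e = D (conc ?q (word [y])) - scale (of_nat (Suc (Suc j))) (conc ?q (word [y, y]))"
      by (simp add: conc_diff conc_scale conc_add conc_conc_word scale_add_left)
    ultimately show ?case by (simp only: rep rep2)
  qed
  have FB: "F j \<subseteq> B" for j
  proof (induction j)
    case 0
    show ?case by (rule F_sub[OF B(1)]) (use B(2) in auto)
  next
    case (Suc j)
    show ?case
    proof (rule F_sub[OF B(1)])
      fix p i assume p: "p \<in> A0" and i: "i \<le> Suc j"
      show "conc p (word (replicate i y)) \<in> B"
      proof (cases "i = Suc j")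
        case False
        thus ?thesis using F_base[OF p, of i j] i Suc by auto
      next
        case True
        let ?q = "conc p (word (replicate j y))"
        let ?r = "conc p (word (replicate (Suc j) y))"
        have "?q \<in> B" using F_base[OF p order_refl] Suc by blast
        hence "D ?q \<in> B" using B(3) inA[OF p] by blast
        moreover have "D ?q - scale (of_nat (Suc j)) ?r \<in> B" using claim[OF p] Suc by blast
        ultimately have "D ?q - (D ?q - scale (of_nat (Suc j)) ?r) \<in> B"
          by (rule submod_diff[OF B(1)])
        hence "scale (of_nat (Suc j)) ?r \<in> B" by simp
        from submodD(3)[OF B(1) Qmu_consts(5)[of "Suc j"] this]
        have "?r \<in> B" by (simp del: of_nat_Suc replicate_Suc)
        thus ?thesis using True by simp
      qed
    qed
  qed
  have "A \<subseteq> (\<Union>j. F j)"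
  proof (rule gen)
    show "submod (Qmu \<mu>) scale (\<Union>j. F j)"
    proof (rule submodI)
      fix p q assume "p \<in> (\<Union>j. F j)" "q \<in> (\<Union>j. F j)"
      then obtain i j where "p \<in> F i" "q \<in> F j" by auto
      hence "p \<in> F (max i j)" "q \<in> F (max i j)"
        using F_mono[of i "max i j"] F_mono[of j "max i j"] by auto
      hence "p + q \<in> F (max i j)" by (rule submodD(2)[OF F])
      thus "p + q \<in> (\<Union>j. F j)" by blast
    next
      show "0 \<in> (\<Union>j. F j)" using submodD(1)[OF F] by blast
      show "scale c p \<in> (\<Union>j. F j)" if "c \<in> Qmu \<mu>" "p \<in> (\<Union>j. F j)" for c p
        using that(2) submodD(3)[OF F that(1)] by blast
    qed
    show "A0 \<subseteq> (\<Union>j. F j)" using F_A0 by blast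
    show "conc p (word [y]) \<in> (\<Union>j. F j)" if "p \<in> (\<Union>j. F j)" for p
      using that F_y by blast
  qed
  thus ?thesis using FB by blast
qed

section \<open>Rapidly decreasing sequences and regularization\<close>

text \<open>The shift of the index makes \<open>hn\<close> at least 1, so that bounds of the form C
  * \<open>hn\<close> n ^ k absorb constants.\<close>

definition hn :: "nat \<Rightarrow> real" where
  "hn n = Harmonic_Numbers.harm (Suc n)"

lemma hn_ge_1: "hn n \<ge> 1"
  using harm_mono[of 1 "Suc n", where ?'a = real] by (simp add: hn_def harm_expand)

lemma hn_pos: "hn n > 0" using hn_ge_1[of n] by linarith

lemma hn_mono: "m \<le> n \<Longrightarrow> hn m \<le> hn n"
  unfolding hn_def by (rule harm_mono) auto

definition rapid :: "(nat \<Rightarrow> complex) \<Rightarrow> bool" where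
  "rapid \<epsilon> \<longleftrightarrow> (\<forall>i. (\<lambda>n. \<epsilon> n * of_real (hn n) ^ i) \<longlonglongrightarrow> 0)"

lemma rapid_tendsto: "rapid \<epsilon> \<Longrightarrow> \<epsilon> \<longlonglongrightarrow> 0"
  unfolding rapid_def by (drule spec[of _ 0]) simp

lemma rapid_0 [simp]: "rapid (\<lambda>_. 0)"
  by (simp add: rapid_def)

lemma rapid_add: "rapid \<epsilon> \<Longrightarrow> rapid \<delta> \<Longrightarrow> rapid (\<lambda>n. \<epsilon> n + \<delta> n)"
  unfolding rapid_def by (auto simp: ring_distribs intro!: tendsto_add_zero)

lemma rapid_cmult: "rapid \<epsilon> \<Longrightarrow> rapid (\<lambda>n. c * \<epsilon> n)"
  unfolding rapid_def by (auto simp: mult.assoc intro!: tendsto_mult_right_zero)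

lemma rapid_diff: "rapid \<epsilon> \<Longrightarrow> rapid \<delta> \<Longrightarrow> rapid (\<lambda>n. \<epsilon> n - \<delta> n)"
  using rapid_add[OF _ rapid_cmult[of \<delta> "-1"], of \<epsilon>] by simp

lemma rapid_sum: "(\<And>x. x \<in> A \<Longrightarrow> rapid (\<epsilon> x)) \<Longrightarrow> rapid (\<lambda>n. \<Sum>x\<in>A. \<epsilon> x n)"
  by (induction A rule: infinite_finite_induct) (auto intro: rapid_add)

lemma rapid_mult_bounded:
  assumes "rapid \<epsilon>" "\<And>n. norm (t n) \<le> C * hn n ^ k"
  shows "rapid (\<lambda>n. \<epsilon> n * t n)"
  unfolding rapid_def
proof
  fix i
  have "(\<lambda>n. norm (\<epsilon> n * of_real (hn n) ^ (i + k)) * C) \<longlonglongrightarrow> 0"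
    using assms(1) unfolding rapid_def by (intro tendsto_mult_left_zero tendsto_norm_zero) blast
  thus "(\<lambda>n. \<epsilon> n * t n * of_real (hn n) ^ i) \<longlonglongrightarrow> 0"
  proof (rule Lim_null_comparison[rotated], intro always_eventually allI)
    fix n
    have "norm (\<epsilon> n * t n * of_real (hn n) ^ i) = norm (\<epsilon> n) * hn n ^ i * norm (t n)"
      using hn_pos[of n] by (simp add: norm_mult norm_power)
    also have "\<dots> \<le> norm (\<epsilon> n) * hn n ^ i * (C * hn n ^ k)"
      using hn_pos[of n] by (intro mult_left_mono assms) auto
    also have "\<dots> = norm (\<epsilon> n * of_real (hn n) ^ (i + k)) * C"
      using hn_pos[of n] by (simp add: norm_mult norm_power power_add)
    finally show "norm (\<epsilon> n * t n * of_real (hn n) ^ i) \<le> norm (\<epsilon> n * of_real (hn n) ^ (i + k)) * C" .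
  qed
qed

lemma rapid_mult_rapid:
  assumes "rapid \<epsilon>" "rapid \<delta>"
  shows "rapid (\<lambda>n. \<epsilon> n * \<delta> n)"
proof -
  have "Bseq \<delta>" using rapid_tendsto[OF assms(2)] by (intro convergent_imp_Bseq convergentI)
  then obtain C where "\<And>n. norm (\<delta> n) \<le> C" by (auto simp: Bseq_def)
  thus ?thesis using rapid_mult_bounded[OF assms(1), of \<delta> C 0] by simp
qed

lemma rapid_mult_poly:
  assumes "rapid \<epsilon>" "\<And>n. norm (t n) \<le> C * hn n"
  shows "rapid (\<lambda>n. \<epsilon> n * poly P (t n))"
proof (induction P)
  case (pCons a P)
  have "rapid (\<lambda>n. a * \<epsilon> n + \<epsilon> n * poly P (t n) * t n)"
    using rapid_mult_bounded[OF pCons(2), of t C 1] assms(2)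
    by (intro rapid_add rapid_cmult assms(1)) auto
  thus ?case by (simp add: algebra_simps)
qed simp

text \<open>Descent in the degree: if a + t P(t) tends to 0 and t is unbounded, then dividing by t
  shows that P(t) tends to 0 as well; once P = 0, the constant a is its own limit.\<close>

lemma poly_tendsto_0_imp_0:
  fixes P :: "complex poly"
  assumes t: "filterlim t at_infinity sequentially" and "(\<lambda>n::nat. poly P (t n)) \<longlonglongrightarrow> 0"
  shows "P = 0"
  using assms(2)
proof (induction P)
  case (pCons a P)
  have inv: "(\<lambda>n. inverse (t n)) \<longlonglongrightarrow> 0"
    using tendsto_inverse_0 t by (rule filterlim_compose)
  have "(\<lambda>n. (poly (pCons a P) (t n) - a) * inverse (t n)) \<longlonglongrightarrow> (0 - a) * 0"
    by (intro tendsto_intros inv pCons.prems)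
  moreover have "eventually (\<lambda>n. (poly (pCons a P) (t n) - a) * inverse (t n) = poly P (t n)) sequentially"
    using filterlim_at_infinity_imp_eventually_ne[OF t, of 0] by eventually_elim simp
  ultimately have "(\<lambda>n. poly P (t n)) \<longlonglongrightarrow> 0"
    by (auto elim: Lim_transform_eventually)
  hence "P = 0" by (rule pCons.IH)
  thus ?case using pCons.prems by (simp add: LIMSEQ_const_iff)
qed simp

lemma Zmu_submod: "submod (Qmu \<mu>) (*) (Zmu \<mu>)"
  unfolding Zmu_def by (rule cx.submod_span)

text \<open>What the harmonic and the shuffle side have in common. \<open>ev n\<close> is a
  truncated sum or the value of a series at the n-th sample point, \<open>y\<close> the divergent
  generator, and \<open>z\<close> the limit on convergent elements. The regularization is then
  recovered as the polynomial that expresses \<open>ev n p\<close> through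
  \<open>ev n y\<close>.\<close>

locale regularization =
  fixes \<mu> :: complex and A A0 :: "'a nc set" and prd :: "'a nc \<Rightarrow> 'a nc \<Rightarrow> 'a nc" and y :: "'a nc"
    and ev :: "nat \<Rightarrow> 'a nc \<Rightarrow> complex" and z :: "'a nc \<Rightarrow> complex" and C :: real
  assumes A: "submod (Qmu \<mu>) scale A" and A0: "submod (Qmu \<mu>) scale A0" and sub: "A0 \<subseteq> A"
    and y: "y \<in> A" and prd: "p \<in> A \<Longrightarrow> q \<in> A \<Longrightarrow> prd p q \<in> A"
    and gen: "submod (Qmu \<mu>) scale B \<Longrightarrow> A0 \<subseteq> B \<Longrightarrow> (\<And>p. p \<in> B \<Longrightarrow> p \<in> A \<Longrightarrow> prd p y \<in> B) \<Longrightarrow> A \<subseteq> B"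
    and ev: "ev n (p + q) = ev n p + ev n q" "ev n (scale c p) = c * ev n p"
      "p \<in> A \<Longrightarrow> q \<in> A \<Longrightarrow> ev n (prd p q) = ev n p * ev n q"
    and inf: "filterlim (\<lambda>n. ev n y) at_infinity sequentially"
    and bound: "norm (ev n y) \<le> C * hn n"
    and z: "p \<in> A0 \<Longrightarrow> rapid (\<lambda>n. ev n p - z p)" "p \<in> A0 \<Longrightarrow> z p \<in> Zmu \<mu>"
begin

definition asymp :: "'a nc \<Rightarrow> complex poly \<Rightarrow> bool" where
  "asymp p P \<longleftrightarrow> rapid (\<lambda>n. ev n p - poly P (ev n y))"

lemma asymp_unique: "asymp p P \<Longrightarrow> asymp p Q \<Longrightarrow> P = Q"
proof -
  assume "asymp p P" "asymp p Q"
  hence "rapid (\<lambda>n. (ev n p - poly Q (ev n y)) - (ev n p - poly P (ev n y)))"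
    unfolding asymp_def by (rule rapid_diff[rotated])
  hence "rapid (\<lambda>n. poly (P - Q) (ev n y))" by simp
  hence "P - Q = 0"
    by (intro poly_tendsto_0_imp_0[OF inf] rapid_tendsto)
  thus ?thesis by simp
qed

lemma asymp_add: "asymp p P \<Longrightarrow> asymp q Q \<Longrightarrow> asymp (p + q) (P + Q)"
  unfolding asymp_def by (drule (1) rapid_add) (simp add: ev algebra_simps)

lemma asymp_scale: "asymp p P \<Longrightarrow> asymp (scale c p) (smult c P)"
  unfolding asymp_def by (drule rapid_cmult[of _ c]) (simp add: ev algebra_simps)

lemma asymp_y: "asymp y [:0, 1:]"
  by (simp add: asymp_def)

lemma asymp_A0: "p \<in> A0 \<Longrightarrow> asymp p [:z p:]"
  using z by (simp add: asymp_def)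

text \<open>With errors \<epsilon> and \<delta> the product has error \<epsilon> Q + \<delta> P +
  \<epsilon> \<delta>; the first two terms are rapid because \<open>ev n y\<close> grows at most
  like \<open>hn\<close>.\<close>

lemma asymp_prd:
  assumes "p \<in> A" "q \<in> A" "asymp p P" "asymp q Q"
  shows "asymp (prd p q) (P * Q)"
proof -
  define \<epsilon> \<delta> where "\<epsilon> n = ev n p - poly P (ev n y)" and "\<delta> n = ev n q - poly Q (ev n y)" for n
  have r: "rapid \<epsilon>" "rapid \<delta>" using assms(3,4) by (auto simp: asymp_def \<epsilon>_def[abs_def] \<delta>_def[abs_def])
  have "rapid (\<lambda>n. \<epsilon> n * poly Q (ev n y) + \<delta> n * poly P (ev n y) + \<epsilon> n * \<delta> n)"
    by (intro rapid_add rapid_mult_poly[where C = C] rapid_mult_rapid r bound)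
  thus ?thesis by (simp add: asymp_def \<epsilon>_def \<delta>_def ev assms(1,2) algebra_simps)
qed

text \<open>The induction multiplies by the generator only, that is, by T. The coefficients
  therefore stay in \<open>Zmu\<close> by its module structure alone, and no closure of
  \<open>Zmu\<close> under products enters.\<close>

lemma asymp_exists: "p \<in> A \<Longrightarrow> \<exists>P\<in>ZmuT \<mu>. asymp p P"
proof -
  let ?M = "{p \<in> A. \<exists>P\<in>ZmuT \<mu>. asymp p P}"
  have "A \<subseteq> ?M"
  proof (rule gen)
    show "submod (Qmu \<mu>) scale ?M"
    proof (rule submodI)
      show "0 \<in> ?M"
        using submodD(1)[OF A] submodD(1)[OF Zmu_submod] ev(2)[of _ 0 0]
        by (intro CollectI conjI bexI[of _ 0]) (simp_all add: asymp_def ZmuT_def)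
    next
      fix p q assume "p \<in> ?M" "q \<in> ?M"
      then obtain P Q where "p \<in> A" "q \<in> A" "P \<in> ZmuT \<mu>" "Q \<in> ZmuT \<mu>" "asymp p P" "asymp q Q" by auto
      thus "p + q \<in> ?M"
        using submodD[OF A] submodD[OF Zmu_submod]
        by (intro CollectI conjI bexI[of _ "P + Q"] asymp_add) (auto simp: ZmuT_def)
    next
      fix c p assume "c \<in> Qmu \<mu>" "p \<in> ?M"
      then obtain P where "p \<in> A" "P \<in> ZmuT \<mu>" "asymp p P" by auto
      thus "scale c p \<in> ?M"
        using submodD[OF A] submodD[OF Zmu_submod] \<open>c \<in> Qmu \<mu>\<close>
        by (intro CollectI conjI bexI[of _ "smult c P"] asymp_scale) (auto simp: ZmuT_def)
    qed
  next
    show "A0 \<subseteq> ?M"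
    proof
      fix p assume p: "p \<in> A0"
      have "[:z p:] \<in> ZmuT \<mu>"
        using z(2)[OF p] submodD(1)[OF Zmu_submod[of \<mu>]] by (auto simp: ZmuT_def coeff_pCons split: nat.splits)
      thus "p \<in> ?M"
        using asymp_A0[OF p] p sub by auto
    qed
  next
    fix p assume "p \<in> ?M"
    then obtain P where P: "p \<in> A" "P \<in> ZmuT \<mu>" "asymp p P" by auto
    have "P * [:0, 1:] \<in> ZmuT \<mu>"
      using P(2) submodD(1)[OF Zmu_submod[of \<mu>]] by (auto simp: ZmuT_def coeff_pCons split: nat.splits)
    thus "prd p y \<in> ?M"
      using asymp_prd[OF P(1) y P(3) asymp_y] prd[OF P(1) y] by auto
  qed
  thus "p \<in> A \<Longrightarrow> ?thesis" by blast
qed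

definition is_reg :: "('a nc \<Rightarrow> complex poly) \<Rightarrow> bool" where
  "is_reg f \<longleftrightarrow> f \<in> A \<rightarrow>\<^sub>E ZmuT \<mu> \<and> linear_over (Qmu \<mu>) A scale smult f \<and>
     (\<forall>p\<in>A0. f p = [:z p:]) \<and> f y = [:0, 1:] \<and> (\<forall>p\<in>A. \<forall>q\<in>A. f (prd p q) = f p * f q)"

text \<open>The restriction matches the extensional function space in \<open>is_reg\<close>, without
  which uniqueness would fail outside \<open>A\<close>.\<close>

definition reg :: "'a nc \<Rightarrow> complex poly" where
  "reg = restrict (\<lambda>p. THE P. asymp p P) A"

lemma asymp_reg: "p \<in> A \<Longrightarrow> asymp p (reg p)"
proof -
  assume p: "p \<in> A"
  then obtain P where "asymp p P" using asymp_exists by blast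
  hence "asymp p (THE P. asymp p P)" by (rule theI) (use asymp_unique \<open>asymp p P\<close> in blast)
  thus ?thesis using p by (simp add: reg_def)
qed

lemma reg_eqI: "p \<in> A \<Longrightarrow> asymp p P \<Longrightarrow> reg p = P"
  using asymp_reg asymp_unique by blast

lemma is_reg_reg: "is_reg reg"
  unfolding is_reg_def
proof (intro conjI ballI)
  have "reg p \<in> ZmuT \<mu>" if "p \<in> A" for p
    using asymp_exists[OF that] reg_eqI[OF that] by blast
  thus "reg \<in> A \<rightarrow>\<^sub>E ZmuT \<mu>" by (auto simp: reg_def)
  show "linear_over (Qmu \<mu>) A scale smult reg"
    unfolding linear_over_def
    by (auto intro!: reg_eqI asymp_add asymp_scale asymp_reg submodD[OF A])
qed (use sub in \<open>auto intro!: reg_eqI asymp_prd asymp_reg asymp_A0 asymp_y prd y\<close>)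

text \<open>Two candidates agree on \<open>A0\<close> and on \<open>y\<close>; multiplicativity
  carries agreement from p to its product with y, so \<open>gen\<close> spreads it over
  \<open>A\<close>.\<close>

lemma is_reg_unique:
  assumes f: "is_reg f"
  shows "f = reg"
proof -
  have lin: "g (p + q) = g p + g q" "c \<in> Qmu \<mu> \<Longrightarrow> g (scale c p) = smult c (g p)"
    if "is_reg g" "p \<in> A" "q \<in> A" for g p q c
    using that by (auto simp: is_reg_def linear_over_def)
  have zero: "g 0 = 0" if "is_reg g" for g
    using lin(2)[OF that y y, of 0] by simp
  have "A \<subseteq> {p \<in> A. f p = reg p}"
  proof (rule gen)
    show "submod (Qmu \<mu>) scale {p \<in> A. f p = reg p}"
      using zero[OF f] zero[OF is_reg_reg] lin[OF f] lin[OF is_reg_reg]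
      by (intro submodI) (auto intro: submodD[OF A])
    show "A0 \<subseteq> {p \<in> A. f p = reg p}"
      using f is_reg_reg sub by (auto simp: is_reg_def)
    show "prd p y \<in> {p \<in> A. f p = reg p}" if "p \<in> {p \<in> A. f p = reg p}" for p
      using f is_reg_reg that y prd by (auto simp: is_reg_def)
  qed
  moreover have "f \<in> extensional A" "reg \<in> extensional A"
    using f is_reg_reg by (auto simp: is_reg_def PiE_def)
  ultimately show ?thesis by (intro extensionalityI[of _ A]) auto
qed

lemma the_reg: "(THE f. is_reg f) = reg"
  using is_reg_reg is_reg_unique by blast

lemma reg_asymp: "p \<in> A \<Longrightarrow> rapid (\<lambda>n. ev n p - poly (reg p) (ev n y))"
  using asymp_reg by (simp add: asymp_def)

end

section \<open>The shuffle product\<close>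

fun lval :: "letter \<Rightarrow> rat" where
  "lval LX = 0"
| "lval (LY l) = l"

definition lsum :: "letter list \<Rightarrow> rat" where
  "lsum w = sum_list (map lval w)"

lemma lsum_simps [simp]: "lsum [] = 0" "lsum (c # w) = lval c + lsum w" "lsum (u @ v) = lsum u + lsum v"
    "lsum (rev w) = lsum w" "lsum (replicate k LX) = 0"
  by (simp_all add: lsum_def sum_list_replicate flip: rev_map)

text \<open>The words \<open>(y,x)\<^bsub>k;m\<^esub>\<close> of positive bi-indices are those all of whose nonempty prefixes
  have a positive letter sum.\<close>

definition good :: "letter list \<Rightarrow> bool" where
  "good w \<longleftrightarrow> (\<forall>i\<in>{1..length w}. lsum (take i w) > 0)"

lemma good_Nil [simp]: "good []"
  by (simp add: good_def)

lemma good_snoc [simp]: "good (w @ [c]) \<longleftrightarrow> good w \<and> lsum w + lval c > 0"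
proof -
  have "{1..length (w @ [c])} = insert (length (w @ [c])) {1..length w}" by auto
  thus ?thesis by (auto simp: good_def)
qed

lemma good_lsum: "good w \<Longrightarrow> lsum w \<ge> 0" "good w \<Longrightarrow> w \<noteq> [] \<Longrightarrow> lsum w > 0"
  by (cases w rule: rev_cases; auto)+

text \<open>The letters are differences of consecutive parameters, so the letter sum telescopes:
  \<open>m0 + lsum (yx_from m0 w)\<close> is the last parameter of \<open>w\<close>.\<close>

lemma yx_from_snoc:
  "yx_from m0 (w @ [(k, m)]) =
     yx_from m0 w @ LY (m - (m0 + lsum (yx_from m0 w))) # replicate (k - 1) LX"
  by (induction m0 w rule: yx_from.induct) auto

lemma yx_Nil [simp]: "yx [] = []" by (simp add: yx_def)

lemma yx_snoc: "yx (w @ [(k, m)]) = yx w @ LY (m - lsum (yx w)) # replicate (k - 1) LX"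
  by (simp add: yx_def yx_from_snoc)

lemma yx_eq_Nil_iff [simp]: "yx w = [] \<longleftrightarrow> w = []"
  by (cases w rule: rev_cases) (auto simp: yx_snoc)

lemma good_append_LX: "good (v @ replicate k LX) \<longleftrightarrow> good v \<and> (k = 0 \<or> lsum v > 0)"
proof (induction k)
  case (Suc k)
  have "v @ replicate (Suc k) LX = (v @ replicate k LX) @ [LX]"
    by (simp add: replicate_append_same)
  thus ?case using Suc by (simp only: good_snoc) auto
qed simp

lemma good_yx: "positive w \<Longrightarrow> good (yx w)"
proof (induction w rule: rev_induct)
  case (snoc y w)
  obtain k m where y: "y = (k, m)" by (cases y)
  have "good ((yx w @ [LY (m - lsum (yx w))]) @ replicate (k - 1) LX)"
    unfolding good_append_LX using snoc y by auto
  thus ?case by (simp add: y yx_snoc)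
qed auto

text \<open>Decoding from the right: a final x raises the last exponent by one, and a final y_l
  opens a new pair (1, m) with m the total letter sum.\<close>

lemma good_obtain_yx:
  assumes "good v"
  obtains w where "positive w" "yx w = v"
  using assms
proof (induction v arbitrary: thesis rule: rev_induct)
  case Nil
  show ?case by (rule Nil(1)[of "[]"]) auto
next
  case (snoc c v)
  from snoc.prems have "good v" by simp
  then obtain w where w: "positive w" "yx w = v" using snoc.IH by blast
  show ?case
  proof (cases c)
    case (LY l)
    show ?thesis
      by (rule snoc.prems(1)[of "w @ [(1, lsum v + l)]"]) (use w snoc.prems LY in \<open>auto simp: yx_snoc\<close>)
  next
    case LX
    hence "v \<noteq> []" using snoc.prems by auto
    hence "w \<noteq> []" using w by auto
    then obtain w' k m where w': "w = w' @ [(k, m)]"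
      by (metis rev_exhaust surj_pair)
    obtain j where j: "k = Suc j" using w w' by (cases k) auto
    show ?thesis
      by (rule snoc.prems(1)[of "w' @ [(Suc k, m)]"])
         (use w w' LX j in \<open>auto simp: yx_snoc replicate_append_same\<close>)
  qed
qed

lemma last_yx:
  assumes "positive w" "w \<noteq> []"
  shows "last (yx w) = LX \<longleftrightarrow> fst (last w) > 1"
proof -
  obtain w' k m where w': "w = w' @ [(k, m)]"
    using assms(2) by (metis rev_exhaust surj_pair)
  show ?thesis using assms(1) by (auto simp: w' yx_snoc last_append)
qed

lemma QX1_eq: "QX1 \<mu> = span_over (Qmu \<mu>) scale {word v | v. good v}"
proof -
  have "{word (yx w) | w. positive w} = {word v | v. good v}"
    using good_yx good_obtain_yx by (auto, metis)
  thus ?thesis by (simp add: QX1_def)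
qed

text \<open>Describes the generators by their last letter, which is the letter that the recursion of
  the shuffle product removes.\<close>

lemma QX0_eq: "QX0 \<mu> = span_over (Qmu \<mu>) scale ({word []} \<union> {word (v @ [LX]) | v. good (v @ [LX])} \<union>
  {word (v @ [LY a]) - word (v @ [LY b]) | v a b. good (v @ [LY a]) \<and> good (v @ [LY b]) \<and> a \<noteq> b})"
proof -
  have "{word (yx w) | w. admissible w} = {word (v @ [LX]) | v. good (v @ [LX])}"
  proof (intro equalityI subsetI)
    fix p assume "p \<in> {word (yx w) | w. admissible w}"
    then obtain w where w: "p = word (yx w)" "positive w" "w \<noteq> []" "fst (last w) > 1" by (auto simp: admissible_def)
    hence "last (yx w) = LX" "yx w \<noteq> []" by (simp_all add: last_yx)
    hence "yx w = butlast (yx w) @ [LX]" by (metis append_butlast_last_id)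
    thus "p \<in> {word (v @ [LX]) | v. good (v @ [LX])}"
      using good_yx[OF w(2)] w(1) by (metis (mono_tags, lifting) mem_Collect_eq)
  next
    fix p assume "p \<in> {word (v @ [LX]) | v. good (v @ [LX])}"
    then obtain v where v: "p = word (v @ [LX])" "good (v @ [LX])" by auto
    then obtain w where w: "positive w" "yx w = v @ [LX]" using good_obtain_yx by metis
    hence "w \<noteq> []" by auto
    thus "p \<in> {word (yx w) | w. admissible w}"
      using v w last_yx[OF w(1)] by (auto simp: admissible_def intro!: exI[of _ w])
  qed
  moreover have "{word (yx (u @ [(1, a)])) - word (yx (u @ [(1, b)])) | u a b. special u a b} =
     {word (v @ [LY a]) - word (v @ [LY b]) | v a b. good (v @ [LY a]) \<and> good (v @ [LY b]) \<and> a \<noteq> b}"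
  proof (intro equalityI subsetI)
    fix p :: "letter nc" assume "p \<in> {word (yx (u @ [(1, a)])) - word (yx (u @ [(1, b)])) | u a b. special u a b}"
    then obtain u a b where "special u a b" "p = word (yx (u @ [(1, a)])) - word (yx (u @ [(1, b)]))" by auto
    thus "p \<in> {word (v @ [LY a]) - word (v @ [LY b]) | v a b. good (v @ [LY a]) \<and> good (v @ [LY b]) \<and> a \<noteq> b}"
      by (intro CollectI exI[of _ "yx u"] exI[of _ "a - lsum (yx u)"] exI[of _ "b - lsum (yx u)"])
         (auto simp: yx_snoc special_def good_yx)
  next
    fix p :: "letter nc" assume "p \<in> {word (v @ [LY a]) - word (v @ [LY b]) | v a b. good (v @ [LY a]) \<and> good (v @ [LY b]) \<and> a \<noteq> b}"
    then obtain v a b where v: "p = word (v @ [LY a]) - word (v @ [LY b])" "good (v @ [LY a])" "good (v @ [LY b])" "a \<noteq> b" by auto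
    then obtain u where "positive u" "yx u = v" using good_obtain_yx[of v] by auto
    thus "p \<in> {word (yx (u @ [(1, a)])) - word (yx (u @ [(1, b)])) | u a b. special u a b}"
      using v by (intro CollectI exI[of _ u] exI[of _ "a + lsum v"] exI[of _ "b + lsum v"])
         (auto simp: yx_snoc special_def add.commute)
  qed
  ultimately show ?thesis by (simp add: QX0_def)
qed

lemma QX1_submod: "submod (Qmu \<mu>) scale (QX1 \<mu>)"
  unfolding QX1_def by (rule nc.submod_span)

lemma QX0_submod: "submod (Qmu \<mu>) scale (QX0 \<mu>)"
  unfolding QX0_def by (rule nc.submod_span)

lemma QX1_word: "good v \<Longrightarrow> word v \<in> QX1 \<mu>"
  unfolding QX1_eq by (rule nc.span_base) auto

lemma QX0_base:
  "word [] \<in> QX0 \<mu>" "good (v @ [LX]) \<Longrightarrow> word (v @ [LX]) \<in> QX0 \<mu>"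
  "good (v @ [LY a]) \<Longrightarrow> good (v @ [LY b]) \<Longrightarrow> word (v @ [LY a]) - word (v @ [LY b]) \<in> QX0 \<mu>"
proof -
  show "word [] \<in> QX0 \<mu>"
    unfolding QX0_eq by (rule nc.span_base) auto
  show "good (v @ [LX]) \<Longrightarrow> word (v @ [LX]) \<in> QX0 \<mu>"
    unfolding QX0_eq by (rule nc.span_base) auto
  show "good (v @ [LY a]) \<Longrightarrow> good (v @ [LY b]) \<Longrightarrow> word (v @ [LY a]) - word (v @ [LY b]) \<in> QX0 \<mu>"
  proof (cases "a = b")
    case False
    show "good (v @ [LY a]) \<Longrightarrow> good (v @ [LY b]) \<Longrightarrow> ?thesis"
      unfolding QX0_eq by (rule nc.span_base) (use False in blast)
  qed (use submodD(1)[OF QX0_submod] in simp)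
qed

lemma QX0_subset_submod:
  assumes "submod (Qmu \<mu>) scale M" "word [] \<in> M"
    "\<And>v. good (v @ [LX]) \<Longrightarrow> word (v @ [LX]) \<in> M"
    "\<And>v a b. good (v @ [LY a]) \<Longrightarrow> good (v @ [LY b]) \<Longrightarrow> a \<noteq> b \<Longrightarrow> word (v @ [LY a]) - word (v @ [LY b]) \<in> M"
  shows "QX0 \<mu> \<subseteq> M"
  unfolding QX0_eq by (rule span_subset[OF assms(1)]) (use assms in auto)

lemma QX0_sub_QX1: "QX0 \<mu> \<subseteq> QX1 \<mu>"
  by (rule QX0_subset_submod[OF QX1_submod]) (auto intro!: QX1_word submod_diff[OF QX1_submod])

abbreviation wspan :: "complex \<Rightarrow> rat \<Rightarrow> letter nc set" where
  "wspan \<mu> s \<equiv> span_over (Qmu \<mu>) scale {word w | w. good w \<and> lsum w = s}"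

text \<open>Whether a good word stays good after appending a letter depends only on the new total
  letter sum. Carrying this sum through the induction, where it is the positive number
  \<open>lsum u + lsum v\<close>, is what keeps all shuffled words good.\<close>

lemma shuffle_word_wspan: "good u \<Longrightarrow> good v \<Longrightarrow> shuffle_word u v \<in> wspan \<mu> (lsum u + lsum v)"
proof (induction "length u + length v" arbitrary: u v rule: less_induct)
  case less
  show ?case
  proof (cases "u = [] \<or> v = []")
    case True
    thus ?thesis using less.prems by (auto intro!: nc.span_base)
  next
    case False
    then obtain u' c v' d where uv: "u = u' @ [c]" "v = v' @ [d]"
      by (metis rev_exhaust)
    have pos: "lsum u + lsum v > 0"
      using good_lsum(2)[OF less.prems(1)] good_lsum(2)[OF less.prems(2)] False by auto
    have *: "conc p (word [e]) \<in> wspan \<mu> (lsum u + lsum v)" if "p \<in> wspan \<mu> s" "s + lval e = lsum u + lsum v" for p e s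
      unfolding conc_word
      by (rule lext_in_submod[OF nc.submod_span that(1)]) (use that pos in \<open>auto intro!: nc.span_base\<close>)
    have "conc (shuffle_word u' v) (word [c]) \<in> wspan \<mu> (lsum u + lsum v)"
      by (rule *[OF less.hyps]) (use less.prems uv in auto)
    moreover have "conc (shuffle_word u v') (word [d]) \<in> wspan \<mu> (lsum u + lsum v)"
      by (rule *[OF less.hyps]) (use less.prems uv in auto)
    ultimately show ?thesis
      unfolding uv shuffle_word_snoc by (rule submodD(2)[OF nc.submod_span])
  qed
qed

lemma wspan_sub_QX1: "wspan \<mu> s \<subseteq> QX1 \<mu>"
  by (rule span_subset[OF QX1_submod]) (auto intro: QX1_word)

lemma shuffle_eq: "shuffle p q = lext (\<lambda>u. lext (shuffle_word u) q) p"
  by (simp add: shuffle_def bilinear_ext_eq)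

lemma QX1_lext:
  assumes "submod (Qmu \<mu>) scale M" "p \<in> QX1 \<mu>" "\<And>w. good w \<Longrightarrow> F w \<in> M"
  shows "lext F p \<in> M"
  using lext_in_submod[OF assms(1) assms(2)[unfolded QX1_eq]] assms(3) by blast

lemma shuffle_QX1: "p \<in> QX1 \<mu> \<Longrightarrow> q \<in> QX1 \<mu> \<Longrightarrow> shuffle p q \<in> QX1 \<mu>"
  unfolding shuffle_eq
  by (intro QX1_lext[OF QX1_submod]) (use shuffle_word_wspan wspan_sub_QX1 in blast)+

text \<open>Shuffling v c with y_m gives v c y_m plus words that end in c. For c = x the latter are
  convergent, and for a difference of two final letters the differences persist; hence
  multiplication by y_m is appending y_m modulo \<open>QX0\<close>.\<close>

lemma QX1_generated:
  assumes m: "m > 0" and B: "submod (Qmu \<mu>) scale B" "QX0 \<mu> \<subseteq> B"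
    "\<And>p. p \<in> B \<Longrightarrow> p \<in> QX1 \<mu> \<Longrightarrow> shuffle p (word [LY m]) \<in> B"
  shows "QX1 \<mu> \<subseteq> B"
proof -
  define y where "y = LY m"
  define D where "D p = lext (\<lambda>u. shuffle_word u [y]) p" for p
  have Dw: "D (word w) = shuffle_word w [y]" for w by (simp add: D_def)
  have good_y: "good (w @ [y])" if "good w" for w
    using that good_lsum(1)[OF that] m by (simp add: y_def)
  have sh: "shuffle_word (w @ [c]) [y] = conc (shuffle_word w [y]) (word [c]) + word (w @ [c, y])" for w c
    using shuffle_word_snoc[of w c "[]" y] by simp
  have base: "D p - conc p (word [y]) \<in> QX0 \<mu>"
    if "p \<in> {word []} \<union> {word (v @ [LX]) | v. good (v @ [LX])} \<union>
      {word (v @ [LY a]) - word (v @ [LY b]) | v a b. good (v @ [LY a]) \<and> good (v @ [LY b]) \<and> a \<noteq> b}" for p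
    using that
  proof (elim UnE CollectE exE conjE)
    assume "p \<in> {word []}"
    thus ?thesis using submodD(1)[OF QX0_submod] by (simp add: Dw)
  next
    fix v assume p: "p = word (v @ [LX])" and v: "good (v @ [LX])"
    have "conc (shuffle_word v [y]) (word [LX]) \<in> QX0 \<mu>"
      unfolding conc_word
    proof (rule lext_in_submod[OF QX0_submod shuffle_word_wspan])
      show "good v" "good [y]" using v good_y[of "[]"] by auto
    qed (use v m in \<open>auto simp: y_def intro!: QX0_base\<close>)
    thus ?thesis by (simp add: p Dw sh)
  next
    fix v a b assume p: "p = word (v @ [LY a]) - word (v @ [LY b])" and v: "good (v @ [LY a])" "good (v @ [LY b])"
    have "lext (\<lambda>w. word (w @ [LY a]) - word (w @ [LY b])) (shuffle_word v [y]) \<in> QX0 \<mu>"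
    proof (rule lext_in_submod[OF QX0_submod shuffle_word_wspan])
      show "good v" "good [y]" using v good_y[of "[]"] by auto
    qed (use v m in \<open>auto simp: y_def intro!: QX0_base\<close>)
    hence "conc (shuffle_word v [y]) (word [LY a]) - conc (shuffle_word v [y]) (word [LY b]) \<in> QX0 \<mu>"
      by (simp add: conc_word lext_fun_diff)
    thus ?thesis by (simp add: p D_def lext_diff sh conc_diff algebra_simps)
  qed
  show ?thesis
  proof (rule generated_by_letter[OF QX1_submod QX0_eq QX0_sub_QX1, where y = y and D = D])
    show "conc p (word [y]) \<in> QX1 \<mu>" if "p \<in> QX1 \<mu>" for p
      unfolding conc_word by (rule QX1_lext[OF QX1_submod that]) (use good_y in \<open>auto intro!: QX1_word\<close>)
    show "D (p + q) = D p + D q" "D (scale c p) = scale c (D p)" for p q c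
      by (simp_all add: D_def lext_add lext_scale)
    show "D p - conc p (word [y]) \<in> QX0 \<mu>"
      if "p \<in> {word []} \<union> {word (v @ [LX]) | v. good (v @ [LX])} \<union>
      {word (v @ [LY a]) - word (v @ [LY b]) | v a b. good (v @ [LY a]) \<and> good (v @ [LY b]) \<and> a \<noteq> b}" for p
      using base[OF that] .
    show "D (conc q (word [y])) - conc (D q) (word [y]) - conc q (word [y, y]) \<in> QX0 \<mu>" for q
    proof -
      have "D (conc q (word [y])) = conc (D q) (word [y]) + conc q (word [y, y])"
        by (simp add: D_def conc_word lext_lext sh lext_fun_add)
      thus ?thesis using submodD(1)[OF QX0_submod] by simp
    qed
    show "QX1 \<mu> \<subseteq> M" if M: "submod (Qmu \<mu>) scale M" "QX0 \<mu> \<subseteq> M" "\<And>p. p \<in> M \<Longrightarrow> conc p (word [y]) \<in> M" for M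
    proof -
      have "word v \<in> M" if "good v" for v
        using that
      proof (induction v rule: rev_induct)
        case Nil
        thus ?case using QX0_base M by blast
      next
        case (snoc c v)
        show ?case
        proof (cases c)
          case LX
          thus ?thesis using snoc.prems M(2) QX0_base(2) by blast
        next
          case (LY l)
          have "good v" using snoc.prems by simp
          have "word (v @ [LY l]) - word (v @ [y]) \<in> M"
            using snoc.prems good_y[OF \<open>good v\<close>] QX0_base(3)[of v l m] M(2) LY by (auto simp: y_def)
          moreover have "word (v @ [y]) \<in> M"
            using M(3)[OF snoc.IH[OF \<open>good v\<close>]] by simp
          ultimately have "word (v @ [LY l]) - word (v @ [y]) + word (v @ [y]) \<in> M"
            by (rule submodD(2)[OF M(1)])
          thus ?thesis using LY by simp
        qed
      qed
      thus ?thesis unfolding QX1_eq by (intro span_subset[OF M(1)]) auto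
    qed
    show "submod (Qmu \<mu>) scale B" "QX0 \<mu> \<subseteq> B" by fact+
    show "D p \<in> B" if "p \<in> B" "p \<in> QX1 \<mu>" for p
      using B(3)[OF that] by (simp add: D_def shuffle_eq y_def)
  qed
qed

section \<open>Generating series\<close>

text \<open>With \<open>q = t\<^sup>\<mu>\<close>, the multiple polylogarithm attached to a word \<open>w\<close> is \<open>t\<close> to the power \<open>lsum w\<close>
  times a power series in \<open>q\<close>, on which \<open>t d/dt\<close> acts as the operator \<open>Delta\<close>.\<close>

definition Delta :: "complex \<Rightarrow> rat \<Rightarrow> complex fps \<Rightarrow> complex fps" where
  "Delta \<mu> s f = Abs_fps (\<lambda>n. (of_nat n * \<mu> + of_rat s) * fps_nth f n)"

text \<open>With q = t^\<mu>, the differential form of a letter c is t^(\<open>lval c\<close>) times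
  \<open>kern \<mu> c\<close> times dt/t; so y_l stands for \<mu> t^l / (1 - q) dt/t.\<close>

definition kern :: "complex \<Rightarrow> letter \<Rightarrow> complex fps" where
  "kern \<mu> c = (case c of LX \<Rightarrow> 1 | LY l \<Rightarrow> fps_const \<mu> * Abs_fps (\<lambda>_. 1))"

text \<open>The coefficientwise division inverts \<open>Delta\<close>, that is, it integrates
  against dt/t from 0. Words are reversed to recurse on the last letter.\<close>

fun genser_rev :: "complex \<Rightarrow> letter list \<Rightarrow> complex fps" where
  "genser_rev \<mu> [] = 1"
| "genser_rev \<mu> (c # w) =
     Abs_fps (\<lambda>n. fps_nth (kern \<mu> c * genser_rev \<mu> w) n / (of_nat n * \<mu> + of_rat (lsum (c # w))))"

definition genser :: "complex \<Rightarrow> letter list \<Rightarrow> complex fps" where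
  "genser \<mu> w = genser_rev \<mu> (rev w)"

lemma genser_Nil [simp]: "genser \<mu> [] = 1"
  by (simp add: genser_def)

lemma genser_snoc:
  "fps_nth (genser \<mu> (w @ [c])) n = fps_nth (kern \<mu> c * genser \<mu> w) n / (of_nat n * \<mu> + of_rat (lsum (w @ [c])))"
  by (simp add: genser_def add.commute)

lemma Delta_genser:
  assumes "Re \<mu> > 0" "lsum (w @ [c]) > 0"
  shows "Delta \<mu> (lsum (w @ [c])) (genser \<mu> (w @ [c])) = kern \<mu> c * genser \<mu> w"
  using nmu_nonzero[OF assms] by (simp add: fps_eq_iff Delta_def genser_snoc)

text \<open>Leibniz rule: on the term with indices i and n - i the factor n \<mu> + s + s' splits as
  (i \<mu> + s) + ((n - i) \<mu> + s').\<close>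

lemma Delta_mult: "Delta \<mu> (s + s') (f * g) = Delta \<mu> s f * g + f * Delta \<mu> s' g"
proof (rule fps_ext)
  fix n
  have "fps_nth (Delta \<mu> (s + s') (f * g)) n =
    (\<Sum>i=0..n. (of_nat n * \<mu> + of_rat (s + s')) * (fps_nth f i * fps_nth g (n - i)))"
    by (simp add: Delta_def fps_mult_nth sum_distrib_left)
  also have "\<dots> = (\<Sum>i=0..n. (of_nat i * \<mu> + of_rat s) * fps_nth f i * fps_nth g (n - i) +
      fps_nth f i * ((of_nat (n - i) * \<mu> + of_rat s') * fps_nth g (n - i)))"
    by (intro sum.cong refl) (auto simp: of_nat_diff of_rat_add algebra_simps)
  finally show "fps_nth (Delta \<mu> (s + s') (f * g)) n = fps_nth (Delta \<mu> s f * g + f * Delta \<mu> s' g) n"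
    by (simp add: Delta_def fps_mult_nth sum.distrib)
qed

lemma keys_shuffle_lsum: "w \<in> keys (shuffle_word u v) \<Longrightarrow> lsum w = lsum u + lsum v"
proof (induction "length u + length v" arbitrary: u v w rule: less_induct)
  case less
  show ?case
  proof (cases "u = [] \<or> v = []")
    case True
    thus ?thesis using less.prems by auto
  next
    case False
    then obtain u' c v' d where uv: "u = u' @ [c]" "v = v' @ [d]"
      by (metis rev_exhaust)
    have "w \<in> keys (conc (shuffle_word u' v) (word [c])) \<union> keys (conc (shuffle_word u v') (word [d]))"
      using less.prems unfolding uv shuffle_word_snoc by (rule subsetD[OF keys_add])
    thus ?thesis
    proof
      assume "w \<in> keys (conc (shuffle_word u' v) (word [c]))"
      then obtain w' where "w' \<in> keys (shuffle_word u' v)" "w = w' @ [c]"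
        unfolding conc_word by (auto dest!: keys_lextD)
      thus ?thesis using less.hyps[of u' v w'] uv by auto
    next
      assume "w \<in> keys (conc (shuffle_word u v') (word [d]))"
      then obtain w' where "w' \<in> keys (shuffle_word u v')" "w = w' @ [d]"
        unfolding conc_word by (auto dest!: keys_lextD)
      thus ?thesis using less.hyps[of u v' w'] uv by auto
    qed
  qed
qed

text \<open>Both sides have the same image under \<open>Delta\<close>: on the left the shuffle
  recursion strips a last letter, on the right the Leibniz rule does. Since n \<mu> + s never
  vanishes, \<open>Delta\<close> can be cancelled; all words of the shuffle share the letter sum s,
  so one operator serves them all.\<close>

lemma genser_shuffle_word:
  assumes \<mu>: "Re \<mu> > 0"
  shows "good u \<Longrightarrow> good v \<Longrightarrow>
    lin (\<lambda>w. fps_nth (genser \<mu> w) n) (shuffle_word u v) = fps_nth (genser \<mu> u * genser \<mu> v) n"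
proof (induction "length u + length v" arbitrary: u v n rule: less_induct)
  case less
  show ?case
  proof (cases "u = [] \<or> v = []")
    case False
    then obtain u' c v' d where uv: "u = u' @ [c]" "v = v' @ [d]"
      by (metis rev_exhaust)
    define s where "s = lsum u + lsum v"
    have posu: "lsum u > 0" and posv: "lsum v > 0"
      using good_lsum(2)[OF less.prems(1)] good_lsum(2)[OF less.prems(2)] False by auto
    hence nz: "of_nat n * \<mu> + of_rat s \<noteq> 0"
      by (intro nmu_nonzero[OF \<mu>]) (simp add: s_def)
    have *: "(of_nat n * \<mu> + of_rat s) * lin (\<lambda>w. fps_nth (genser \<mu> w) n) (conc (shuffle_word a b) (word [e]))
       = fps_nth (kern \<mu> e * (genser \<mu> a * genser \<mu> b)) n"
      if "good a" "good b" "length a + length b < length u + length v" "lsum a + lsum b + lval e = s" for a b e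
    proof -
      have "(of_nat n * \<mu> + of_rat s) * lin (\<lambda>w. fps_nth (genser \<mu> w) n) (conc (shuffle_word a b) (word [e])) =
            lin (\<lambda>w. (of_nat n * \<mu> + of_rat s) * fps_nth (genser \<mu> (w @ [e])) n) (shuffle_word a b)"
        by (simp add: lin_conc_word lin_mult_const)
      also have "\<dots> = lin (\<lambda>w. \<Sum>i=0..n. fps_nth (kern \<mu> e) i * fps_nth (genser \<mu> w) (n - i)) (shuffle_word a b)"
      proof (rule lin_cong)
        fix w assume "w \<in> keys (shuffle_word a b)"
        hence "lsum (w @ [e]) = s" using keys_shuffle_lsum that(4) by auto
        thus "(of_nat n * \<mu> + of_rat s) * fps_nth (genser \<mu> (w @ [e])) n =
          (\<Sum>i=0..n. fps_nth (kern \<mu> e) i * fps_nth (genser \<mu> w) (n - i))"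
          using nz by (simp add: genser_snoc fps_mult_nth del: lsum_simps)
      qed
      also have "\<dots> = fps_nth (kern \<mu> e * (genser \<mu> a * genser \<mu> b)) n"
        using less.hyps[OF that(3) that(1,2)] by (simp add: lin_sum_fun lin_mult_const fps_mult_nth[of "kern \<mu> e"])
      finally show ?thesis .
    qed
    have "(of_nat n * \<mu> + of_rat s) * lin (\<lambda>w. fps_nth (genser \<mu> w) n) (shuffle_word u v) =
      fps_nth (kern \<mu> c * (genser \<mu> u' * genser \<mu> v)) n + fps_nth (kern \<mu> d * (genser \<mu> u * genser \<mu> v')) n"
      using *[of u' v c] *[of u v' d] less.prems uv
      by (simp add: shuffle_word_snoc lin_add distrib_left s_def)
    also have "\<dots> = fps_nth (Delta \<mu> (lsum u) (genser \<mu> u) * genser \<mu> v + genser \<mu> u * Delta \<mu> (lsum v) (genser \<mu> v)) n"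
      using Delta_genser[OF \<mu>, of u' c] Delta_genser[OF \<mu>, of v' d] posu posv
      unfolding uv[symmetric] by (simp add: mult_ac)
    also have "\<dots> = (of_nat n * \<mu> + of_rat s) * fps_nth (genser \<mu> u * genser \<mu> v) n"
      unfolding Delta_mult[symmetric] by (simp add: s_def Delta_def)
    finally show ?thesis using nz by simp
  qed auto
qed

lemma kern_LY_nth: "fps_nth (kern \<mu> (LY l) * f) n = \<mu> * (\<Sum>j\<le>n. fps_nth f j)"
proof -
  have "fps_nth (Abs_fps (\<lambda>_. 1) * f) n = (\<Sum>j\<le>n. fps_nth f j)"
    unfolding fps_mult_nth by (simp add: atLeast0AtMost) (rule sum.reindex_bij_witness[of _ "\<lambda>i. n - i" "\<lambda>i. n - i"]; auto)
  thus ?thesis by (simp add: kern_def mult.assoc)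
qed

lemma genser_append_LX:
  "fps_nth (genser \<mu> (v @ replicate k LX)) n = fps_nth (genser \<mu> v) n / (of_nat n * \<mu> + of_rat (lsum v)) ^ k"
proof (induction k)
  case (Suc k)
  have "v @ replicate (Suc k) LX = (v @ replicate k LX) @ [LX]"
    by (simp add: replicate_append_same)
  thus ?case using Suc by (simp only: genser_snoc) (simp add: kern_def)
qed simp

text \<open>The new letter y brings the letter sum to m and the x's leave it there, so all k
  divisions are by n \<mu> + m, while multiplication by \<open>kern\<close> of y forms \<mu> times
  the partial sums.\<close>

lemma genser_yx_snoc:
  assumes "positive w" "k \<ge> 1"
  shows "fps_nth (genser \<mu> (yx (w @ [(k, m)]))) n = lterm \<mu> (k, m) n * (\<Sum>j\<le>n. fps_nth (genser \<mu> (yx w)) j)"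
proof -
  have "yx (w @ [(k, m)]) = (yx w @ [LY (m - lsum (yx w))]) @ replicate (k - 1) LX"
    by (simp add: yx_snoc)
  thus ?thesis using assms(2)
    by (simp only: genser_append_LX genser_snoc kern_LY_nth)
       (cases k; simp add: lterm_def factor_def)
qed

lemma sum_genser_yx: "positive w \<Longrightarrow> (\<Sum>j\<le>n. fps_nth (genser \<mu> (yx w)) j) = zeta_trunc \<mu> n w"
proof (induction w arbitrary: n rule: rev_induct)
  case (snoc y w)
  obtain k m where "y = (k, m)" by (cases y)
  thus ?case using snoc by (simp add: genser_yx_snoc zeta_trunc_snoc)
qed simp

section \<open>Generation on the harmonic side\<close>

lemma QY0_submod: "submod (Qmu \<mu>) scale (QY0 \<mu>)"
  unfolding QY0_def by (rule nc.submod_span)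

lemma QY0_base:
  "word [] \<in> QY0 \<mu>" "admissible w \<Longrightarrow> word w \<in> QY0 \<mu>"
  "positive u \<Longrightarrow> a > 0 \<Longrightarrow> b > 0 \<Longrightarrow> word (u @ [(1, a)]) - word (u @ [(1, b)]) \<in> QY0 \<mu>"
proof -
  show "word [] \<in> QY0 \<mu>"
    unfolding QY0_def by (rule nc.span_base) auto
  show "admissible w \<Longrightarrow> word w \<in> QY0 \<mu>"
    unfolding QY0_def by (rule nc.span_base) auto
  show "positive u \<Longrightarrow> a > 0 \<Longrightarrow> b > 0 \<Longrightarrow> word (u @ [(1, a)]) - word (u @ [(1, b)]) \<in> QY0 \<mu>"
  proof (cases "a = b")
    case False
    assume "positive u" "a > 0" "b > 0"
    hence "special u a b" using False by (simp add: special_def)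
    thus ?thesis unfolding QY0_def by (intro nc.span_base) blast
  qed (use submodD(1)[OF QY0_submod] in simp)
qed

lemma QY0_subset_submod:
  assumes "submod (Qmu \<mu>) scale M" "word [] \<in> M"
    "\<And>w. admissible w \<Longrightarrow> word w \<in> M"
    "\<And>u a b. special u a b \<Longrightarrow> word (u @ [(1, a)]) - word (u @ [(1, b)]) \<in> M"
  shows "QY0 \<mu> \<subseteq> M"
  unfolding QY0_def by (rule span_subset[OF assms(1)]) (use assms in auto)

lemma QY0_sub_QY: "QY0 \<mu> \<subseteq> QY \<mu>"
  by (rule QY0_subset_submod[OF QY_submod])
     (auto simp: admissible_def special_def intro!: QY_word submod_diff[OF QY_submod])

text \<open>Both \<open>x\<close> and \<open>y\<close> contribute a pole, so the coefficients of the two letters of exponent one in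
  \<open>x \<odot> y\<close> cancel and no divergent word arises.\<close>

lemma word_conc_odot_QY0:
  assumes "positive u" "positive [x, y]"
  shows "conc (word u) (odot x y) \<in> QY0 \<mu>"
proof -
  obtain k1 m1 k2 m2 where xy: "x = (k1, m1)" "y = (k2, m2)" by (cases x, cases y)
  have pos: "k1 \<ge> 1" "k2 \<ge> 1" "m1 > 0" "m2 > 0" using assms xy by auto
  show ?thesis
  proof (cases "m1 = m2")
    case True
    thus ?thesis using pos assms(1) by (auto simp: xy odot_def admissible_def intro!: QY0_base)
  next
    case False
    obtain a b where ab: "partial_fraction k1 m1 k2 m2 = (a, b)" by (cases "partial_fraction k1 m1 k2 m2")
    have b1: "b 1 = - a 1"
      using partial_fraction_props(3)[OF False _ ab] pos by linarith
    have split: "(\<Sum>i=1..k. scale (of_rat (c i)) (word (u @ [(i, m)]))) =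
        scale (of_rat (c 1)) (word (u @ [(1, m)])) + (\<Sum>i=2..k. scale (of_rat (c i)) (word (u @ [(i, m)])))"
      if "k \<ge> 1" for k m and c :: "nat \<Rightarrow> rat"
    proof -
      have "{1..k} = insert 1 {2..k}" using that by auto
      thus ?thesis by simp
    qed
    have tail: "(\<Sum>i=2..k. scale (of_rat (c i)) (word (u @ [(i, m)]))) \<in> QY0 \<mu>"
      if "m > 0" for k m and c :: "nat \<Rightarrow> rat"
      by (rule submod_sum[OF QY0_submod], rule submodD(3)[OF QY0_submod])
         (use assms(1) that in \<open>auto simp: admissible_def intro!: QY0_base\<close>)
    have "conc (word u) (odot x y) =
        (\<Sum>i=1..k1. scale (of_rat (a i)) (word (u @ [(i, m1)]))) + (\<Sum>j=1..k2. scale (of_rat (b j)) (word (u @ [(j, m2)])))"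
      using False by (simp add: xy odot_def ab conc_add conc_sum_right conc_scale)
    also have "\<dots> = scale (of_rat (a 1)) (word (u @ [(1, m1)]) - word (u @ [(1, m2)])) +
        ((\<Sum>i=2..k1. scale (of_rat (a i)) (word (u @ [(i, m1)]))) + (\<Sum>j=2..k2. scale (of_rat (b j)) (word (u @ [(j, m2)]))))"
    proof -
      have "scale (of_rat (b 1)) p = - scale (of_rat (a 1)) p" for p :: "(nat \<times> rat) nc"
        by (rule poly_mapping_eqI) (simp add: b1[simplified] of_rat_minus)
      thus ?thesis unfolding split[OF pos(1)] split[OF pos(2)] scale_diff_right by (simp add: algebra_simps)
    qed
    also have "\<dots> \<in> QY0 \<mu>"
      by (intro submodD(2,3)[OF QY0_submod] tail QY0_base pos assms(1)) auto
    finally show ?thesis .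
  qed
qed

lemma conc_odot_QY0:
  assumes "p \<in> QY \<mu>" "positive [x, y]"
  shows "conc p (odot x y) \<in> QY0 \<mu>"
  unfolding conc_eq by (rule QY_lext[OF QY0_submod assms(1)])
    (use word_conc_odot_QY0[OF _ assms(2)] in \<open>simp add: word_conc\<close>)

lemma harm_word_QY: "positive u \<Longrightarrow> positive v \<Longrightarrow> harm_word \<mu> u v \<in> QY \<mu>"
proof (induction "length u + length v" arbitrary: u v rule: less_induct)
  case less
  show ?case
  proof (cases "u = [] \<or> v = []")
    case True
    thus ?thesis using less.prems by (auto intro!: QY_word)
  next
    case False
    then obtain u' x v' y where uv: "u = u' @ [x]" "v = v' @ [y]"
      by (metis rev_exhaust)
    have 1: "harm_word \<mu> u' v \<in> QY \<mu>" "harm_word \<mu> u v' \<in> QY \<mu>" "harm_word \<mu> u' v' \<in> QY \<mu>"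
      using less.prems uv by (auto intro!: less.hyps)
    have xy: "positive [x]" "positive [y]" "positive [x, y]" using less.prems uv by auto
    have "conc (harm_word \<mu> u' v') (odot x y) \<in> QY \<mu>"
      using conc_odot_QY0[OF 1(3) xy(3)] QY0_sub_QY by blast
    hence "conc (harm_word \<mu> u' v) (word [x]) + conc (harm_word \<mu> u v') (word [y])
       - scale \<mu> (conc (harm_word \<mu> u' v') (odot x y)) \<in> QY \<mu>"
      by (intro submod_diff[OF QY_submod] submodD(2,3)[OF QY_submod] QY_conc_word 1 xy) auto
    thus ?thesis by (simp add: uv harm_word_snoc)
  qed
qed

lemma harm_QY: "p \<in> QY \<mu> \<Longrightarrow> q \<in> QY \<mu> \<Longrightarrow> harm \<mu> p q \<in> QY \<mu>"
  unfolding harm_eq by (intro QY_lext[OF QY_submod]) (auto intro!: harm_word_QY)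

text \<open>Same scheme as for the shuffle product. The additional terms w (c \<odot> y) always lie
  in \<open>QY0\<close>, so they vanish modulo convergent elements.\<close>

lemma QY_generated:
  assumes m: "m > 0" and B: "submod (Qmu \<mu>) scale B" "QY0 \<mu> \<subseteq> B"
    "\<And>p. p \<in> B \<Longrightarrow> p \<in> QY \<mu> \<Longrightarrow> harm \<mu> p (word [(1, m)]) \<in> B"
  shows "QY \<mu> \<subseteq> B"
proof -
  define y :: "nat \<times> rat" where "y = (1, m)"
  define D where "D p = lext (\<lambda>u. harm_word \<mu> u [y]) p" for p
  have Dw: "D (word w) = harm_word \<mu> w [y]" for w by (simp add: D_def)
  have py: "positive [y]" using m by (simp add: y_def)
  have hw: "harm_word \<mu> (w @ [c]) [y] = conc (harm_word \<mu> w [y]) (word [c]) + word (w @ [c, y]) - scale \<mu> (conc (word w) (odot c y))" for w c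
    using harm_word_snoc[of \<mu> w c "[]" y] by simp
  have sc: "scale \<mu> (conc (word w) (odot c y)) \<in> QY0 \<mu>" if "positive (w @ [c])" for w c
    using that py by (intro submodD(3)[OF QY0_submod] word_conc_odot_QY0) auto
  have base: "D p - conc p (word [y]) \<in> QY0 \<mu>"
    if "p \<in> {word []} \<union> {word w | w. admissible w} \<union>
      {word (u @ [(1, a)]) - word (u @ [(1, b)]) | u a b. special u a b}" for p
    using that
  proof (elim UnE CollectE exE conjE)
    assume "p \<in> {word []}"
    thus ?thesis using submodD(1)[OF QY0_submod] by (simp add: Dw)
  next
    fix w assume pw: "p = word w" and w: "admissible w"
    then obtain v c where v: "w = v @ [c]" unfolding admissible_def by (metis rev_exhaust)
    have p: "positive v" "positive (v @ [c])" using w v by (auto simp: admissible_def)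
    have "conc (harm_word \<mu> v [y]) (word [c]) \<in> QY0 \<mu>"
      unfolding conc_word by (rule QY_lext[OF QY0_submod harm_word_QY[OF p(1) py]])
        (use w v in \<open>auto simp: admissible_def intro!: QY0_base\<close>)
    hence "conc (harm_word \<mu> v [y]) (word [c]) - scale \<mu> (conc (word v) (odot c y)) \<in> QY0 \<mu>"
      by (intro submod_diff[OF QY0_submod] sc p)
    thus ?thesis by (simp add: pw Dw v hw)
  next
    fix u a b assume pu: "p = word (u @ [(1, a)]) - word (u @ [(1, b)])" and s: "special u a b"
    hence p: "positive u" "positive (u @ [(1, a)])" "positive (u @ [(1, b)])" by (auto simp: special_def)
    have "lext (\<lambda>w. word (w @ [(1, a)]) - word (w @ [(1, b)])) (harm_word \<mu> u [y]) \<in> QY0 \<mu>"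
      by (rule QY_lext[OF QY0_submod harm_word_QY[OF p(1) py]])
         (use s in \<open>auto simp: special_def intro!: QY0_base[simplified]\<close>)
    hence "conc (harm_word \<mu> u [y]) (word [(1, a)]) - conc (harm_word \<mu> u [y]) (word [(1, b)]) \<in> QY0 \<mu>"
      by (simp add: conc_word lext_fun_diff)
    moreover have "scale \<mu> (conc (word u) (odot (1, a) y)) - scale \<mu> (conc (word u) (odot (1, b) y)) \<in> QY0 \<mu>"
      by (intro submod_diff[OF QY0_submod] sc p)
    ultimately have "(conc (harm_word \<mu> u [y]) (word [(1, a)]) - conc (harm_word \<mu> u [y]) (word [(1, b)]))
       - (scale \<mu> (conc (word u) (odot (1, a) y)) - scale \<mu> (conc (word u) (odot (1, b) y))) \<in> QY0 \<mu>"
      by (rule submod_diff[OF QY0_submod])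
    thus ?thesis by (simp add: pu D_def lext_diff hw conc_diff algebra_simps)
  qed
  show ?thesis
  proof (rule generated_by_letter[OF QY_submod QY0_def QY0_sub_QY, where y = y and D = D])
    show "conc p (word [y]) \<in> QY \<mu>" if "p \<in> QY \<mu>" for p
      by (rule QY_conc_word[OF that py])
    show "D (p + q) = D p + D q" "D (scale c p) = scale c (D p)" for p q c
      by (simp_all add: D_def lext_add lext_scale)
    show "D p - conc p (word [y]) \<in> QY0 \<mu>"
      if "p \<in> {word []} \<union> {word w | w. admissible w} \<union>
      {word (u @ [(1, a)]) - word (u @ [(1, b)]) | u a b. special u a b}" for p
      using base[OF that] .
    show "D (conc q (word [y])) - conc (D q) (word [y]) - conc q (word [y, y]) \<in> QY0 \<mu>" if "q \<in> QY \<mu>" for q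
    proof -
      have "D (conc q (word [y])) = conc (D q) (word [y]) + conc q (word [y, y]) - scale \<mu> (conc q (odot y y))"
        by (simp add: D_def conc_word lext_lext hw lext_fun_add lext_fun_diff lext_fun_scale)
           (simp add: conc_eq word_conc)
      moreover have "0 - scale \<mu> (conc q (odot y y)) \<in> QY0 \<mu>"
        by (intro submod_diff[OF QY0_submod] submodD(1,3)[OF QY0_submod] conc_odot_QY0 that) (use py in auto)
      ultimately show ?thesis by simp
    qed
    show "QY \<mu> \<subseteq> M" if M: "submod (Qmu \<mu>) scale M" "QY0 \<mu> \<subseteq> M" "\<And>p. p \<in> M \<Longrightarrow> conc p (word [y]) \<in> M" for M
    proof -
      have "word w \<in> M" if "positive w" for w
        using that
      proof (induction w rule: rev_induct)
        case Nil
        thus ?case using QY0_base M by blast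
      next
        case (snoc c w)
        obtain k a where c: "c = (k, a)" by (cases c)
        have w: "positive w" "k \<ge> 1" "a > 0" using snoc.prems c by auto
        show ?case
        proof (cases "k > 1")
          case True
          hence "admissible (w @ [c])" using snoc.prems c by (simp add: admissible_def)
          thus ?thesis using M(2) QY0_base(2) by blast
        next
          case False
          hence k: "k = 1" using w by simp
          have "word (w @ [(1, a)]) - word (w @ [y]) \<in> M"
            using QY0_base(3)[OF w(1,3) m] M(2) by (auto simp: y_def)
          moreover have "word (w @ [y]) \<in> M"
            using M(3)[OF snoc.IH[OF w(1)]] by simp
          ultimately have "word (w @ [(1, a)]) - word (w @ [y]) + word (w @ [y]) \<in> M"
            by (rule submodD(2)[OF M(1)])
          thus ?thesis using c k by simp
        qed
      qed
      thus ?thesis unfolding QY_def by (intro span_subset[OF M(1)]) auto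
    qed
    show "submod (Qmu \<mu>) scale B" "QY0 \<mu> \<subseteq> B" by fact+
    show "D p \<in> B" if "p \<in> B" "p \<in> QY \<mu>" for p
      using B(3)[OF that] by (simp add: D_def harm_eq y_def)
  qed
qed

section \<open>Growth of nested sums\<close>

lemma norm_nmu_ge:
  assumes "Re \<mu> > 0" "m > 0"
  obtains c where "c > 0" "\<And>n. norm (of_nat n * \<mu> + of_rat m) \<ge> c * (real n + 1)"
proof
  define r :: real where "r = of_rat m"
  have r: "r > 0" "Re (of_rat m) = r"
    using assms(2) by (simp add: r_def) (cases m; simp add: of_rat_rat r_def)
  show "min (Re \<mu>) r > 0" using assms(1) r by simp
  fix n
  have "min (Re \<mu>) r * real n \<le> Re \<mu> * real n" by (intro mult_right_mono) auto
  hence "min (Re \<mu>) r * (real n + 1) \<le> Re (of_nat n * \<mu> + of_rat m)"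
    by (simp add: r algebra_simps)
  also have "\<dots> \<le> norm (of_nat n * \<mu> + of_rat m)" by (rule complex_Re_le_cmod)
  finally show "norm (of_nat n * \<mu> + of_rat m) \<ge> min (Re \<mu>) r * (real n + 1)" .
qed

lemma lterm_bound:
  assumes "Re \<mu> > 0" "positive [y]"
  obtains C where "C \<ge> 0" "\<And>n. norm (lterm \<mu> y n) \<le> C / (real n + 1) ^ fst y"
proof -
  obtain k m where y: "y = (k, m)" by (cases y)
  obtain c where c: "c > 0" "\<And>n. norm (of_nat n * \<mu> + of_rat m) \<ge> c * (real n + 1)"
    using norm_nmu_ge[OF assms(1), of m] assms(2) y by auto
  show ?thesis
  proof (rule that)
    show "norm \<mu> / c ^ k \<ge> 0" using c by simp
    fix n
    have "0 < c * (real n + 1)" using c(1) by simp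
    hence "0 < norm (of_nat n * \<mu> + of_rat m)" using c(2)[of n] by linarith
    hence "norm \<mu> / norm (of_nat n * \<mu> + of_rat m) ^ k \<le> norm \<mu> / (c * (real n + 1)) ^ k"
      using c(1) c(2)[of n] \<open>0 < c * (real n + 1)\<close>
      by (intro divide_left_mono power_mono mult_pos_pos zero_less_power) auto
    moreover have "norm (lterm \<mu> y n) = norm \<mu> / norm (of_nat n * \<mu> + of_rat m) ^ k"
      by (simp add: lterm_def factor_def y norm_divide norm_power)
    ultimately show "norm (lterm \<mu> y n) \<le> norm \<mu> / c ^ k / (real n + 1) ^ fst y"
      by (simp add: y power_mult_distrib)
  qed
qed

lemma hn_sum: "hn n = (\<Sum>j\<le>n. 1 / (real j + 1))"
  unfolding hn_def harm_altdef lessThan_Suc_atMost by (simp add: field_simps)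

text \<open>Each summation against a term O(1/(n+1)) costs one factor \<open>hn\<close>;
  monotonicity of \<open>hn\<close> lets the inner bound be pulled out of the sum.\<close>

lemma nsum_norm_bound:
  fixes gs :: "(nat \<Rightarrow> complex) list"
  assumes "\<And>g. g \<in> set gs \<Longrightarrow> \<exists>C. \<forall>n. norm (g n) \<le> C / (real n + 1)"
  shows "\<exists>C\<ge>0. \<forall>n. nsum (map (\<lambda>g n. norm (g n)) gs) n \<le> C * hn n ^ length gs"
  using assms
proof (induction gs)
  case Nil
  thus ?case by (auto intro!: exI[of _ 1])
next
  case (Cons g gs)
  from Cons.IH Cons.prems obtain C where C: "C \<ge> 0" "\<And>n. nsum (map (\<lambda>g n. norm (g n)) gs) n \<le> C * hn n ^ length gs"
    by auto
  from Cons.prems obtain C' where C': "\<And>n. norm (g n) \<le> C' / (real n + 1)" by auto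
  have "C' \<ge> 0" using order_trans[OF norm_ge_zero C'[of 0]] by simp
  show ?case
  proof (intro exI[of _ "C' * C"] conjI allI)
    show "C' * C \<ge> 0" using C \<open>C' \<ge> 0\<close> by simp
    fix n
    have "nsum (map (\<lambda>g n. norm (g n)) (g # gs)) n \<le> (\<Sum>j\<le>n. C' / (real j + 1) * (C * hn n ^ length gs))"
      unfolding list.map nsum.simps
    proof (rule sum_mono)
      fix j assume "j \<in> {..n}"
      have nn: "nsum (map (\<lambda>g n. norm (g n)) gs) i \<ge> 0" for i
        by (induction gs arbitrary: i) (auto intro!: sum_nonneg mult_nonneg_nonneg)
      have "C * hn j ^ length gs \<le> C * hn n ^ length gs"
        using \<open>j \<in> _\<close> C hn_pos[of j] by (intro mult_left_mono power_mono hn_mono) auto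
      with C(2)[of j] have "nsum (map (\<lambda>g n. norm (g n)) gs) j \<le> C * hn n ^ length gs" by linarith
      thus "norm (g j) * nsum (map (\<lambda>g n. norm (g n)) gs) j \<le> C' / (real j + 1) * (C * hn n ^ length gs)"
        using C'[of j] nn \<open>C' \<ge> 0\<close> by (intro mult_mono) auto
    qed
    also have "\<dots> = C' * C * hn n ^ length (g # gs)"
      by (simp add: hn_sum[of n] sum_distrib_left sum_distrib_right mult_ac)
    finally show "nsum (map (\<lambda>g n. norm (g n)) (g # gs)) n \<le> C' * C * hn n ^ length (g # gs)" .
  qed
qed

lemma norm_nsum_le: "norm (nsum gs n :: complex) \<le> nsum (map (\<lambda>g n. norm (g n)) gs) n"
  by (induction gs arbitrary: n)
     (auto intro!: order_trans[OF norm_sum] sum_mono simp: norm_mult mult_left_mono)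

lemma lterm_bound_1:
  assumes "Re \<mu> > 0" "positive [y]"
  shows "\<exists>C. \<forall>n. norm (lterm \<mu> y n) \<le> C / (real n + 1)"
proof -
  obtain C where C: "C \<ge> 0" "\<And>n. norm (lterm \<mu> y n) \<le> C / (real n + 1) ^ fst y"
    using lterm_bound[OF assms] by blast
  have "C / (real n + 1) ^ fst y \<le> C / (real n + 1)" for n
    using C(1) assms(2) self_le_power[of "real n + 1" "fst y"] by (intro divide_left_mono) auto
  thus ?thesis using C(2) order_trans by blast
qed

lemma nsum_lterm_bound:
  assumes "Re \<mu> > 0" "positive w"
  shows "\<exists>C\<ge>0. \<forall>n. nsum (map (\<lambda>g n. norm (g n)) (rev (map (lterm \<mu>) w))) n \<le> C * hn n ^ length w"
proof -
  have "\<exists>C. \<forall>n. norm (g n) \<le> C / (real n + 1)" if "g \<in> set (rev (map (lterm \<mu>) w))" for g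
  proof -
    from that obtain y where "y \<in> set w" "g = lterm \<mu> y" by auto
    moreover have "positive [y]" using assms(2) \<open>y \<in> set w\<close> by (auto simp: positive_def)
    ultimately show ?thesis using lterm_bound_1[OF assms(1)] by blast
  qed
  from nsum_norm_bound[of "rev (map (lterm \<mu>) w)", OF this] show ?thesis by auto
qed

lemma zeta_trunc_bound:
  assumes "Re \<mu> > 0" "positive w"
  shows "\<exists>C\<ge>0. \<forall>n. norm (zeta_trunc \<mu> n w) \<le> C * hn n ^ length w"
  unfolding zeta_trunc_nsum using nsum_lterm_bound[OF assms] norm_nsum_le order_trans by blast

lemma hn_le_ln: "hn n \<le> 1 + ln (real n + 1)"
  using decseqD[OF decseq_harm_diff_ln, of 0 n] by (simp add: hn_def harm_expand add.commute)

lemma hn_power_bound: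
  assumes "\<delta> > 0"
  shows "\<exists>C\<ge>0. \<forall>n. hn n ^ k \<le> C * (real n + 1) powr \<delta>"
proof (intro exI conjI allI)
  \<comment> \<open>Dividing by k + 1 instead of k keeps e meaningful for k = 0 and still gives e k
    \<le> \<delta>.\<close>
  define e where "e = \<delta> / (real k + 1)"
  have e: "e > 0" using assms by (simp add: e_def)
  show "(1 + 1 / e) ^ k \<ge> 0" using e by simp
  fix n
  define x where "x = real n + 1"
  have x: "x \<ge> 1" by (simp add: x_def)
  have "hn n \<le> 1 + ln x" using hn_le_ln by (simp add: x_def)
  also have "ln x \<le> x powr e / e" by (rule ln_powr_bound[OF x e])
  also have "1 + x powr e / e \<le> x powr e + x powr e / e"
    using ge_one_powr_ge_zero[of x e] x e by simp
  finally have "hn n \<le> (1 + 1 / e) * x powr e" by (simp add: algebra_simps)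
  hence "hn n ^ k \<le> ((1 + 1 / e) * x powr e) ^ k"
    using hn_pos[of n] by (intro power_mono) auto
  also have "\<dots> = (1 + 1 / e) ^ k * x powr (e * real k)"
    using x by (simp add: power_mult_distrib powr_powr flip: powr_realpow)
  also have "\<dots> \<le> (1 + 1 / e) ^ k * x powr \<delta>"
  proof -
    have "e * real k \<le> \<delta>" using assms by (simp add: e_def field_simps)
    thus ?thesis using x e by (intro mult_left_mono powr_mono) auto
  qed
  finally show "hn n ^ k \<le> (1 + 1 / e) ^ k * (real n + 1) powr \<delta>" by (simp add: x_def)
qed

text \<open>Half of the exponent pays for the power of \<open>hn\<close>, the other half tends to
  0.\<close>

lemma rapidI_powr:
  assumes "\<delta> > 0" "\<And>n. norm (\<epsilon> n) \<le> C * (real n + 1) powr (- \<delta>)"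
  shows "rapid \<epsilon>"
  unfolding rapid_def
proof
  fix i
  obtain C' where C': "C' \<ge> 0" "\<And>n. hn n ^ i \<le> C' * (real n + 1) powr (\<delta> / 2)"
    using hn_power_bound[of "\<delta> / 2" i] assms(1) by auto
  have "C \<ge> 0" using assms(2)[of 0] norm_ge_zero[of "\<epsilon> 0"] by (simp only: of_nat_0 add_0 powr_one_eq_one mult_1_right)
  have "(\<lambda>n. C * C' * (real n + 1) powr (- (\<delta> / 2))) \<longlonglongrightarrow> 0"
    by (intro tendsto_mult_right_zero tendsto_neg_powr) (use assms(1) in \<open>simp, real_asymp\<close>)
  thus "(\<lambda>n. \<epsilon> n * of_real (hn n) ^ i) \<longlonglongrightarrow> 0"
  proof (rule Lim_null_comparison[rotated], intro always_eventually allI)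
    fix n
    have "norm (\<epsilon> n * of_real (hn n) ^ i) = norm (\<epsilon> n) * hn n ^ i"
      using hn_pos[of n] by (simp add: norm_mult norm_power)
    also have "\<dots> \<le> (C * (real n + 1) powr (- \<delta>)) * (C' * (real n + 1) powr (\<delta> / 2))"
      using assms(2)[of n] C'(2)[of n] \<open>C \<ge> 0\<close> hn_pos[of n] by (intro mult_mono) auto
    also have "\<dots> = C * C' * ((real n + 1) powr (- \<delta>) * (real n + 1) powr (\<delta> / 2))"
      by (simp add: mult_ac)
    also have "(real n + 1) powr (- \<delta>) * (real n + 1) powr (\<delta> / 2) = (real n + 1) powr (- (\<delta> / 2))"
      by (simp flip: powr_add)
    finally show "norm (\<epsilon> n * of_real (hn n) ^ i) \<le> C * C' * (real n + 1) powr (- (\<delta> / 2))" .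
  qed
qed

section \<open>Convergent series\<close>

lemma nsum_norm_nonneg: "nsum (map (\<lambda>g n. norm (g n :: complex)) gs) i \<ge> (0::real)"
  by (induction gs arbitrary: i) (auto intro!: sum_nonneg mult_nonneg_nonneg)

text \<open>The infinite sum over chains is unordered. A uniform bound on truncated sums of norms
  gives absolute summability, and the truncation sets are cofinal among the finite sets of chains,
  so the truncated sums converge to it.\<close>

lemma nsum_tendsto_infsum:
  fixes gs :: "(nat \<Rightarrow> complex) list"
  assumes "\<And>M. nsum (rev (map (\<lambda>g n. norm (g n)) gs)) M \<le> B"
  shows "(\<lambda>M. nsum (rev gs) M) \<longlonglongrightarrow> (\<Sum>\<^sub>\<infinity>ns\<in>chains (length gs). \<Prod>i<length gs. (gs ! i) (ns ! i))"
proof -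
  define f where "f ns = (\<Prod>i<length gs. (gs ! i) (ns ! i))" for ns
  define C where "C M = {ns \<in> chains (length gs). set ns \<subseteq> {..M}}" for M
  have sumC: "sum f (C M) = nsum (rev gs) M" for M
    unfolding f_def C_def by (rule sum_chains_eq_nsum)
  have sumCn: "(\<Sum>ns\<in>C M. norm (f ns)) = nsum (rev (map (\<lambda>g n. norm (g n)) gs)) M" for M
    using sum_chains_eq_nsum[of "map (\<lambda>g n. norm (g n)) gs" M]
    by (simp add: f_def C_def prod_norm)
  have sub: "\<exists>M. X \<subseteq> C M" if "finite X" "X \<subseteq> chains (length gs)" for X
  proof -
    have "finite (\<Union>(set ` X))" using that by auto
    then obtain M where "\<forall>n\<in>\<Union>(set ` X). n \<le> M" by (meson finite_nat_set_iff_bounded_le)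
    hence "X \<subseteq> C M" using that by (auto simp: C_def)
    thus ?thesis by blast
  qed
  have fin: "finite (C M)" for M unfolding C_def by (rule finite_chains)
  have "(\<lambda>ns. norm (f ns)) summable_on chains (length gs)"
  proof (rule nonneg_bdd_above_summable_on)
    show "bdd_above (sum (\<lambda>ns. norm (f ns)) ` {F. F \<subseteq> chains (length gs) \<and> finite F})"
    proof (rule bdd_aboveI2)
      fix X assume "X \<in> {F. F \<subseteq> chains (length gs) \<and> finite F}"
      then obtain M where "X \<subseteq> C M" using sub by blast
      hence "(\<Sum>ns\<in>X. norm (f ns)) \<le> (\<Sum>ns\<in>C M. norm (f ns))"
        using fin by (intro sum_mono2) auto
      also have "\<dots> \<le> B" unfolding sumCn by (rule assms)
      finally show "(\<Sum>ns\<in>X. norm (f ns)) \<le> B" .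
    qed
  qed auto
  hence "f summable_on chains (length gs)"
    by (rule abs_summable_summable)
  hence "(f has_sum (\<Sum>\<^sub>\<infinity>ns\<in>chains (length gs). f ns)) (chains (length gs))"
    by (rule has_sum_infsum)
  hence lim: "(sum f \<longlongrightarrow> (\<Sum>\<^sub>\<infinity>ns\<in>chains (length gs). f ns)) (finite_subsets_at_top (chains (length gs)))"
    by (simp add: has_sum_def)
  have "filterlim C (finite_subsets_at_top (chains (length gs))) sequentially"
    unfolding filterlim_finite_subsets_at_top
  proof (intro allI impI)
    fix X assume X: "finite X \<and> X \<subseteq> chains (length gs)"
    then obtain M where M: "X \<subseteq> C M" using sub by blast
    show "eventually (\<lambda>n. finite (C n) \<and> X \<subseteq> C n \<and> C n \<subseteq> chains (length gs)) sequentially"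
      using eventually_ge_at_top[of M]
    proof eventually_elim
      case (elim n)
      have "C M \<subseteq> C n" using elim by (auto simp: C_def)
      thus ?case using M fin by (auto simp: C_def)
    qed
  qed
  from filterlim_compose[OF lim this] show ?thesis
    by (simp add: sumC) (simp add: f_def)
qed

lemma summable_powr: "s < -1 \<Longrightarrow> summable (\<lambda>n. (real n + 1) powr s)"
  using summable_Suc_iff[of "\<lambda>n. real n powr s"] summable_real_powr_iff[of s] by (simp add: add.commute)

text \<open>Coefficients of convergent elements are n^-2 times powers of log; a quarter of the
  exponent absorbs the logarithms. The remaining 7/4 is later split into 1/4, which gives a rate,
  and 3/2, which is summable.\<close>

definition decays :: "(nat \<Rightarrow> complex) \<Rightarrow> bool" where
  "decays c \<longleftrightarrow> (\<exists>C\<ge>0. \<forall>n. norm (c n) \<le> C * (real n + 1) powr (-7/4))"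

lemma decays_mult_hn:
  assumes "\<And>n. norm (g n) \<le> C / (real n + 1) ^ 2" "\<And>n. norm (s n) \<le> C' * hn n ^ k"
  shows "\<exists>D\<ge>0. \<forall>n. norm (g n) * norm (s n) \<le> D * (real n + 1) powr (-7/4)"
proof -
  have C: "C \<ge> 0" using order_trans[OF norm_ge_zero assms(1)[of 0]] by simp
  have "C' * hn 0 ^ k \<ge> 0" by (rule order_trans[OF norm_ge_zero assms(2)])
  hence C': "C' \<ge> 0" using zero_less_power[OF hn_pos[of 0], of k] by (simp add: zero_le_mult_iff)
  obtain E where E: "E \<ge> 0" "\<And>n. hn n ^ k \<le> E * (real n + 1) powr (1/4)"
    using hn_power_bound[of "1/4" k] by auto
  show ?thesis
  proof (intro exI[of _ "C * (C' * E)"] conjI allI)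
    show "C * (C' * E) \<ge> 0" using C C' E by simp
    fix n
    have "norm (g n) * norm (s n) \<le> (C / (real n + 1) ^ 2) * (C' * (E * (real n + 1) powr (1/4)))"
      using assms(1)[of n] order_trans[OF assms(2)[of n] mult_left_mono[OF E(2) C']] C
      by (intro mult_mono) auto
    also have "\<dots> = C * (C' * E) * ((real n + 1) powr (1/4) / (real n + 1) ^ 2)" by simp
    also have "(real n + 1) ^ 2 = (real n + 1) powr 2" by (simp add: powr_numeral)
    also have "(real n + 1) powr (1/4) / (real n + 1) powr 2 = (real n + 1) powr (-7/4)"
      unfolding powr_diff[symmetric] by simp
    finally show "norm (g n) * norm (s n) \<le> C * (C' * E) * (real n + 1) powr (-7/4)" .
  qed
qed

text \<open>Quadratic decay in the outermost index suffices, as the inner sums contribute only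
  powers of log. The factor \<open>g\<close> is arbitrary so that admissible words and special
  triples are treated alike.\<close>

lemma nested_tendsto_infsum:
  assumes \<mu>: "Re \<mu> > 0" and u: "positive u" and g: "\<And>n. norm (g n) \<le> C / (real n + 1) ^ 2"
  shows "(\<lambda>M. \<Sum>n\<le>M. g n * zeta_trunc \<mu> n u) \<longlonglongrightarrow>
     (\<Sum>\<^sub>\<infinity>ns\<in>chains (Suc (length u)). (\<Prod>i<length u. lterm \<mu> (u ! i) (ns ! i)) * g (ns ! length u))"
proof -
  let ?us = "map (lterm \<mu>) u"
  obtain C' where
    C': "C' \<ge> 0" "\<And>n. nsum (map (\<lambda>g n. norm (g n)) (rev ?us)) n \<le> C' * hn n ^ length u"
    using nsum_lterm_bound[OF \<mu> u] by blast
  \<comment> \<open>The real nested sum of norms is viewed as a complex sequence to fit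
    \<open>decays_mult_hn\<close>.\<close>
  define s where "s n = complex_of_real (nsum (map (\<lambda>g n. norm (g n)) (rev ?us)) n)" for n
  have s: "norm (s n) = nsum (map (\<lambda>g n. norm (g n)) (rev ?us)) n" for n
    using nsum_norm_nonneg[of "rev ?us" n] by (simp add: s_def)
  obtain D where D: "D \<ge> 0" "\<And>n. norm (g n) * norm (s n) \<le> D * (real n + 1) powr (-7/4)"
    using decays_mult_hn[OF g, of s C' "length u"] C'(2) s by auto
  have sm: "summable (\<lambda>n. D * (real n + 1) powr (-7/4))"
    by (intro summable_mult summable_powr) auto
  have "nsum (rev (map (\<lambda>g n. norm (g n)) (?us @ [g]))) M \<le> (suminf (\<lambda>n. D * (real n + 1) powr (-7/4)))" for M
  proof -
    have "nsum (rev (map (\<lambda>g n. norm (g n)) (?us @ [g]))) M = (\<Sum>n\<le>M. norm (g n) * norm (s n))"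
      by (simp add: s rev_map)
    also have "\<dots> \<le> (\<Sum>n\<le>M. D * (real n + 1) powr (-7/4))" by (intro sum_mono D)
    also have "\<dots> \<le> (suminf (\<lambda>n. D * (real n + 1) powr (-7/4)))"
      by (rule sum_le_suminf[OF sm]) (use D(1) in auto)
    finally show ?thesis .
  qed
  from nsum_tendsto_infsum[of "?us @ [g]", OF this]
  have "(\<lambda>M. nsum (rev (?us @ [g])) M) \<longlonglongrightarrow>
     (\<Sum>\<^sub>\<infinity>ns\<in>chains (Suc (length u)). \<Prod>i<Suc (length u). ((?us @ [g]) ! i) (ns ! i))" by simp
  moreover have "(\<Prod>i<Suc (length u). ((?us @ [g]) ! i) (ns ! i)) = (\<Prod>i<length u. lterm \<mu> (u ! i) (ns ! i)) * g (ns ! length u)" for ns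
    by (simp add: nth_append)
  ultimately show ?thesis by (simp add: zeta_trunc_nsum)
qed

lemma lterm_bound_2:
  assumes "Re \<mu> > 0" "positive [y]" "fst y > 1"
  obtains C where "\<And>n. norm (lterm \<mu> y n) \<le> C / (real n + 1) ^ 2"
proof -
  obtain C where C: "C \<ge> 0" "\<And>n. norm (lterm \<mu> y n) \<le> C / (real n + 1) ^ fst y"
    using lterm_bound[OF assms(1,2)] by blast
  have "C / (real n + 1) ^ fst y \<le> C / (real n + 1) ^ 2" for n
    using C(1) assms(3) power_increasing[of 2 "fst y" "real n + 1"] by (intro divide_left_mono) auto
  thus ?thesis using that C(2) order_trans by blast
qed

lemma zeta_trunc_tendsto:
  assumes \<mu>: "Re \<mu> > 0" and w: "admissible w"
  shows "(\<lambda>M. zeta_trunc \<mu> M w) \<longlonglongrightarrow> zeta \<mu> w"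
proof -
  obtain u y where wu: "w = u @ [y]" using w unfolding admissible_def by (metis rev_exhaust)
  have p: "positive u" "positive [y]" "fst y > 1" using w wu by (auto simp: admissible_def)
  obtain C where C: "\<And>n. norm (lterm \<mu> y n) \<le> C / (real n + 1) ^ 2"
    using lterm_bound_2[OF \<mu> p(2,3)] by blast
  have "(\<Prod>i<length u. lterm \<mu> (u ! i) (ns ! i)) * lterm \<mu> y (ns ! length u) =
      \<mu> ^ length w / (\<Prod>i<length w. factor \<mu> (ns ! i) (w ! i))" for ns
    unfolding prod_lterm[symmetric] by (simp add: wu nth_append)
  with nested_tendsto_infsum[OF \<mu> p(1) C] show ?thesis
    by (simp add: zeta_def wu zeta_trunc_snoc)
qed

lemma lterm_diff:
  assumes "Re \<mu> > 0" "a > 0" "b > 0"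
  shows "lterm \<mu> (1, a) n - lterm \<mu> (1, b) n =
    of_rat (b - a) * (\<mu> / ((of_nat n * \<mu> + of_rat a) * (of_nat n * \<mu> + of_rat b)))"
  using nmu_nonzero[OF assms(1,2), of n] nmu_nonzero[OF assms(1,3), of n]
  by (simp add: lterm_def factor_def of_rat_diff divide_simps) (simp add: algebra_simps)

lemma two_factor_bound:
  assumes \<mu>: "Re \<mu> > 0" and "a > 0" "b > 0"
  obtains C where "\<And>n. norm (\<mu> / ((of_nat n * \<mu> + of_rat a) * (of_nat n * \<mu> + of_rat b))) \<le> C / (real n + 1) ^ 2"
proof -
  obtain c where c: "c > 0" "\<And>n. norm (of_nat n * \<mu> + of_rat a) \<ge> c * (real n + 1)"
    using norm_nmu_ge[OF \<mu> assms(2)] by auto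
  obtain d where d: "d > 0" "\<And>n. norm (of_nat n * \<mu> + of_rat b) \<ge> d * (real n + 1)"
    using norm_nmu_ge[OF \<mu> assms(3)] by auto
  show ?thesis
  proof (rule that[of "norm \<mu> / (c * d)"])
    fix n
    have "0 < c * (real n + 1)" "0 < d * (real n + 1)" using c d by simp_all
    moreover from this have "0 < norm (of_nat n * \<mu> + of_rat a)" "0 < norm (of_nat n * \<mu> + of_rat b)"
      using c(2)[of n] d(2)[of n] by linarith+
    ultimately have "norm \<mu> / (norm (of_nat n * \<mu> + of_rat a) * norm (of_nat n * \<mu> + of_rat b)) \<le>
        norm \<mu> / ((c * (real n + 1)) * (d * (real n + 1)))"
      using c d(1) c(2)[of n] d(2)[of n] by (intro divide_left_mono mult_mono mult_pos_pos) auto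
    thus "norm (\<mu> / ((of_nat n * \<mu> + of_rat a) * (of_nat n * \<mu> + of_rat b))) \<le> norm \<mu> / (c * d) / (real n + 1) ^ 2"
      by (simp add: norm_divide norm_mult power2_eq_square mult_ac)
  qed
qed

lemma Dmu_tendsto:
  assumes \<mu>: "Re \<mu> > 0" and s: "special u a b"
  shows "(\<lambda>M. zeta_trunc \<mu> M (u @ [(1, a)]) - zeta_trunc \<mu> M (u @ [(1, b)])) \<longlonglongrightarrow> Dmu \<mu> u a b"
proof -
  have p: "positive u" "a > 0" "b > 0" using s by (auto simp: special_def)
  define g where "g n = \<mu> / ((of_nat n * \<mu> + of_rat a) * (of_nat n * \<mu> + of_rat b))" for n
  obtain C where C: "\<And>n. norm (g n) \<le> C / (real n + 1) ^ 2"
    unfolding g_def using two_factor_bound[OF \<mu> p(2,3)] by blast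
  have 1: "(\<Prod>i<length u. lterm \<mu> (u ! i) (ns ! i)) * g (ns ! length u) =
      \<mu> ^ Suc (length u) / ((\<Prod>i<length u. factor \<mu> (ns ! i) (u ! i)) *
       (of_nat (ns ! length u) * \<mu> + of_rat a) * (of_nat (ns ! length u) * \<mu> + of_rat b))" for ns
    using prod_lterm[of \<mu> u ns] by (simp add: g_def mult_ac)
  have "(\<lambda>M. of_rat (b - a) * (\<Sum>n\<le>M. g n * zeta_trunc \<mu> n u)) \<longlonglongrightarrow> Dmu \<mu> u a b"
    unfolding Dmu_def using nested_tendsto_infsum[OF \<mu> p(1) C] unfolding 1 by (intro tendsto_intros)
  moreover have "of_rat (b - a) * (\<Sum>n\<le>M. g n * zeta_trunc \<mu> n u) =
      zeta_trunc \<mu> M (u @ [(1, a)]) - zeta_trunc \<mu> M (u @ [(1, b)])" for M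
    unfolding zeta_trunc_snoc sum_subtractf[symmetric] sum_distrib_left left_diff_distrib[symmetric]
      lterm_diff[OF \<mu> p(2,3)] by (simp add: g_def mult.assoc)
  ultimately show ?thesis by simp
qed

section \<open>Coefficient sequences\<close>

definition cf :: "complex \<Rightarrow> letter nc \<Rightarrow> nat \<Rightarrow> complex" where
  "cf \<mu> p n = lin (\<lambda>v. fps_nth (genser \<mu> v) n) p"

lemma cf_zero: "cf \<mu> 0 = (\<lambda>_. 0)"
  by (simp add: cf_def fun_eq_iff)

lemma cf_linear: "cf \<mu> (p + q) n = cf \<mu> p n + cf \<mu> q n" "cf \<mu> (p - q) n = cf \<mu> p n - cf \<mu> q n"
    "cf \<mu> (scale c p) n = c * cf \<mu> p n" "cf \<mu> 0 n = 0"
  by (simp_all add: cf_def lin_add lin_diff lin_scale)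

lemma phi_eq: "phi p = lext (\<lambda>w. word (yx w)) p"
  by (simp add: phi_def lext_def)

lemma phi_QX1: "p \<in> QY \<mu> \<Longrightarrow> phi p \<in> QX1 \<mu>"
  unfolding phi_eq by (rule QY_lext[OF QX1_submod]) (auto intro!: QX1_word good_yx)

lemma QX0_yx_base:
  "admissible w \<Longrightarrow> word (yx w) \<in> QX0 \<mu>"
  "special u a b \<Longrightarrow> word (yx (u @ [(1, a)])) - word (yx (u @ [(1, b)])) \<in> QX0 \<mu>"
  unfolding QX0_def by (rule nc.span_base; blast)+

lemma phi_QX0: "p \<in> QY0 \<mu> \<Longrightarrow> phi p \<in> QX0 \<mu>"
proof -
  have "QY0 \<mu> \<subseteq> {p. phi p \<in> QX0 \<mu>}"
  proof (rule QY0_subset_submod)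
    show "submod (Qmu \<mu>) scale {p. phi p \<in> QX0 \<mu>}"
      by (rule submodI) (auto simp: phi_eq lext_add lext_scale intro: submodD[OF QX0_submod])
  qed (auto simp: phi_eq lext_diff intro: QX0_base QX0_yx_base[simplified])
  thus "p \<in> QY0 \<mu> \<Longrightarrow> ?thesis" by blast
qed

lemma sum_cf_phi:
  assumes "p \<in> QY \<mu>"
  shows "(\<Sum>j\<le>n. cf \<mu> (phi p) j) = lin (zeta_trunc \<mu> n) p"
proof -
  have "(\<Sum>j\<le>n. cf \<mu> (phi p) j) = lin (\<lambda>w. \<Sum>j\<le>n. fps_nth (genser \<mu> (yx w)) j) p"
    by (simp add: cf_def phi_eq lin_lext lin_sum_fun)
  also have "\<dots> = lin (zeta_trunc \<mu> n) p"
    by (rule lin_eq_on_QY[OF assms]) (rule sum_genser_yx)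
  finally show ?thesis .
qed

lemma phi_word: "phi (word w) = word (yx w)"
  by (simp add: phi_eq)

lemma sum_cf_yx: "positive w \<Longrightarrow> (\<Sum>j\<le>n. cf \<mu> (word (yx w)) j) = zeta_trunc \<mu> n w"
  using sum_cf_phi[OF QY_word[of w \<mu>], of n] by (simp add: phi_word)

lemma cf_yx_snoc:
  "positive (u @ [(k, m)]) \<Longrightarrow> cf \<mu> (word (yx (u @ [(k, m)]))) n = lterm \<mu> (k, m) n * zeta_trunc \<mu> n u"
  by (simp add: cf_def genser_yx_snoc sum_genser_yx)

section \<open>Decay of the coefficients of convergent elements\<close>

lemma decays_add: "decays c \<Longrightarrow> decays d \<Longrightarrow> decays (\<lambda>n. c n + d n)"
proof -
  assume "decays c" "decays d"
  then obtain C D where CD: "C \<ge> 0" "\<And>n. norm (c n) \<le> C * (real n + 1) powr (-7/4)"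
     "D \<ge> 0" "\<And>n. norm (d n) \<le> D * (real n + 1) powr (-7/4)" by (auto simp: decays_def)
  have "norm (c n + d n) \<le> (C + D) * (real n + 1) powr (-7/4)" for n
    using norm_triangle_ineq[of "c n" "d n"] CD(2)[of n] CD(4)[of n] by (simp add: algebra_simps)
  thus ?thesis using CD by (auto simp: decays_def intro!: exI[of _ "C + D"])
qed

lemma decays_cmult: "decays c \<Longrightarrow> decays (\<lambda>n. a * c n)"
proof -
  assume "decays c"
  then obtain C where C: "C \<ge> 0" "\<And>n. norm (c n) \<le> C * (real n + 1) powr (-7/4)"
    by (auto simp: decays_def)
  have "norm (a * c n) \<le> (norm a * C) * (real n + 1) powr (-7/4)" for n
    using mult_left_mono[OF C(2)[of n] norm_ge_zero[of a]] by (simp add: norm_mult mult.assoc)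
  thus ?thesis using C by (auto simp: decays_def intro!: exI[of _ "norm a * C"])
qed

lemma QX0_subset_submod_yx:
  assumes "submod (Qmu \<mu>) scale M" "word [] \<in> M"
    "\<And>w. admissible w \<Longrightarrow> word (yx w) \<in> M"
    "\<And>u a b. special u a b \<Longrightarrow> word (yx (u @ [(1, a)])) - word (yx (u @ [(1, b)])) \<in> M"
  shows "QX0 \<mu> \<subseteq> M"
  unfolding QX0_def by (rule span_subset[OF assms(1)]) (use assms in auto)

text \<open>In both kinds of generators the outermost factor is O(1/n^2): either the last exponent
  is at least 2, or two simple terms are subtracted.\<close>

lemma decays_cf:
  assumes \<mu>: "Re \<mu> > 0" and "p \<in> QX0 \<mu>"
  shows "decays (cf \<mu> p)"
proof -
  have "QX0 \<mu> \<subseteq> {p. decays (cf \<mu> p)}"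
  proof (rule QX0_subset_submod_yx)
    show "submod (Qmu \<mu>) scale {p. decays (cf \<mu> p)}"
      by (rule submodI)
         (auto simp: cf_linear[abs_def] intro: decays_add decays_cmult, auto simp: decays_def)
    have "norm (cf \<mu> (word []) n) \<le> 1 * (real n + 1) powr (-7/4)" for n
      by (cases n) (auto simp: cf_def)
    thus "word [] \<in> {p. decays (cf \<mu> p)}" by (auto simp: decays_def intro!: exI[of _ 1])
  next
    fix w assume w: "admissible w"
    obtain u k m where wu: "w = u @ [(k, m)]" using w unfolding admissible_def by (metis rev_exhaust surj_pair)
    have p: "positive u" "positive [(k, m)]" "k > 1" using w wu by (auto simp: admissible_def)
    obtain C where C: "\<And>n. norm (lterm \<mu> (k, m) n) \<le> C / (real n + 1) ^ 2"
      using lterm_bound_2[OF \<mu> p(2)] p(3) by auto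
    obtain C' where C': "\<And>n. norm (zeta_trunc \<mu> n u) \<le> C' * hn n ^ length u"
      using zeta_trunc_bound[OF \<mu> p(1)] by blast
    show "word (yx w) \<in> {p. decays (cf \<mu> p)}"
      using decays_mult_hn[OF C C'] p by (simp add: decays_def wu cf_yx_snoc norm_mult)
  next
    fix u a b assume s: "special u a b"
    hence p: "positive u" "a > 0" "b > 0" by (auto simp: special_def)
    define g where "g n = \<mu> / ((of_nat n * \<mu> + of_rat a) * (of_nat n * \<mu> + of_rat b))" for n
    obtain C where C: "\<And>n. norm (g n) \<le> C / (real n + 1) ^ 2"
      unfolding g_def using two_factor_bound[OF \<mu> p(2,3)] by blast
    obtain C' where C': "\<And>n. norm (zeta_trunc \<mu> n u) \<le> C' * hn n ^ length u"
      using zeta_trunc_bound[OF \<mu> p(1)] by blast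
    have "decays (\<lambda>n. g n * zeta_trunc \<mu> n u)"
      using decays_mult_hn[OF C C'] by (simp add: decays_def norm_mult)
    hence "decays (\<lambda>n. of_rat (b - a) * (g n * zeta_trunc \<mu> n u))" by (rule decays_cmult)
    moreover have "cf \<mu> (word (yx (u @ [(1, a)])) - word (yx (u @ [(1, b)]))) n = of_rat (b - a) * (g n * zeta_trunc \<mu> n u)" for n
    proof -
      have "cf \<mu> (word (yx (u @ [(1, a)])) - word (yx (u @ [(1, b)]))) n = (lterm \<mu> (1, a) n - lterm \<mu> (1, b) n) * zeta_trunc \<mu> n u"
        using p by (simp add: cf_linear cf_yx_snoc[where k = 1, simplified] left_diff_distrib)
      thus ?thesis unfolding lterm_diff[OF \<mu> p(2,3)] by (simp add: g_def mult.assoc)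
    qed
    ultimately show "word (yx (u @ [(1, a)])) - word (yx (u @ [(1, b)])) \<in> {p. decays (cf \<mu> p)}"
      by (simp add: decays_def)
  qed
  thus ?thesis using assms(2) by blast
qed

lemma decays_summable: "decays c \<Longrightarrow> summable (\<lambda>n. norm (c n))"
  unfolding decays_def
  by (auto intro!: summable_comparison_test'[OF summable_mult[OF summable_powr[of "-7/4"]]])

text \<open>Behind the cut-off n, the exponent 7/4 is split: the part 1/4 is bounded in terms of n
  and gives the rate, the part 3/2 in terms of the shifted index and is summed.\<close>

lemma decays_tail_rapid:
  assumes "decays c"
  shows "rapid (\<lambda>n. (\<Sum>j\<le>n. c j) - suminf c)"
proof -
  obtain C where C: "C \<ge> 0" "\<And>n. norm (c n) \<le> C * (real n + 1) powr (-7/4)"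
    using assms by (auto simp: decays_def)
  have sm: "summable (\<lambda>j. (real j + 1) powr (-3/2))" by (rule summable_powr) simp
  show ?thesis
  proof (rule rapidI_powr)
    fix n
    have "suminf c = (suminf (\<lambda>j. c (j + Suc n))) + (\<Sum>j<Suc n. c j)"
      by (rule suminf_split_initial_segment) (rule summable_norm_cancel[OF decays_summable[OF assms]])
    hence "norm ((\<Sum>j\<le>n. c j) - suminf c) = norm (suminf (\<lambda>j. c (j + Suc n)))"
      by (simp add: lessThan_Suc_atMost)
    also have "\<dots> \<le> (suminf (\<lambda>j. C * (real n + 1) powr (-1/4) * (real j + 1) powr (-3/2)))"
    proof (rule norm_suminf_le)
      show "summable (\<lambda>j. C * (real n + 1) powr (-1/4) * (real j + 1) powr (-3/2))"
        by (intro summable_mult sm)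
      fix j
      define x where "x = real (j + Suc n) + 1"
      have "norm (c (j + Suc n)) \<le> C * x powr (-7/4)" unfolding x_def by (rule C(2))
      also have "x powr (-7/4) = x powr (-1/4) * x powr (-3/2)" by (simp flip: powr_add)
      also have "\<dots> \<le> (real n + 1) powr (-1/4) * (real j + 1) powr (-3/2)"
        by (intro mult_mono powr_mono2') (auto simp: x_def)
      finally show "norm (c (j + Suc n)) \<le> C * (real n + 1) powr (-1/4) * (real j + 1) powr (-3/2)"
        using C(1) by (simp add: mult_left_mono mult.assoc)
    qed
    also have "\<dots> = (C * (suminf (\<lambda>j. (real j + 1) powr (-3/2)))) * (real n + 1) powr (- (1/4))"
      by (subst suminf_mult) (use sm in auto)
    finally show "norm ((\<Sum>j\<le>n. c j) - suminf c) \<le> (C * (suminf (\<lambda>j. (real j + 1) powr (-3/2)))) * (real n + 1) powr (- (1/4))" .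
  qed simp
qed

section \<open>Radial limits along q = N/(N+1)\<close>

definition qq :: "nat \<Rightarrow> real" where
  "qq N = real N / (real N + 1)"

lemma qq_bounds: "0 \<le> qq N" "qq N < 1" "1 - qq N = 1 / (real N + 1)"
  by (auto simp: qq_def field_simps)

text \<open>The defect v = 1 - q^n lies in [0, 1] and is at most n (1 - q) by Bernoulli. Hence v
  \<le> v^(1/4) \<le> ((n+1)/(N+1))^(1/4), which turns a quarter of the decay in n into a rate in
  N.\<close>

lemma decays_abel_rapid:
  assumes "decays c"
  shows "rapid (\<lambda>N. (suminf (\<lambda>n. c n * of_real (qq N) ^ n)) - suminf c)"
proof -
  obtain C where C: "C \<ge> 0" "\<And>n. norm (c n) \<le> C * (real n + 1) powr (-7/4)"
    using assms by (auto simp: decays_def)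
  have sm: "summable (\<lambda>j. (real j + 1) powr (-3/2))" by (rule summable_powr) simp
  have smc: "summable c" by (rule summable_norm_cancel[OF decays_summable[OF assms]])
  show ?thesis
  proof (rule rapidI_powr)
    fix N
    have smq: "summable (\<lambda>n. c n * of_real (qq N) ^ n)"
    proof (rule summable_comparison_test'[OF decays_summable[OF assms]])
      fix n
      have "qq N ^ n \<le> 1" using qq_bounds[of N] by (intro power_le_one) auto
      thus "norm (c n * of_real (qq N) ^ n) \<le> norm (c n)"
        using qq_bounds(1)[of N] by (simp add: norm_mult norm_power mult_left_le)
    qed
    have "norm ((suminf (\<lambda>n. c n * of_real (qq N) ^ n)) - suminf c) = norm (suminf (\<lambda>n. c n * of_real (qq N) ^ n - c n))"
      by (subst suminf_diff[OF smq smc]) simp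
    also have "\<dots> \<le> (suminf (\<lambda>n. C * (real N + 1) powr (-1/4) * (real n + 1) powr (-3/2)))"
    proof (rule norm_suminf_le)
      show "summable (\<lambda>n. C * (real N + 1) powr (-1/4) * (real n + 1) powr (-3/2))"
        by (intro summable_mult sm)
      fix n
      define v where "v = 1 - qq N ^ n"
      have v: "0 \<le> v" "v \<le> 1" using qq_bounds[of N] by (auto simp: v_def power_le_one)
      have "v \<le> (real n + 1) / (real N + 1)"
      proof -
        have "1 + real n * (qq N - 1) \<le> (1 + (qq N - 1)) ^ n"
          using qq_bounds[of N] by (intro Bernoulli_inequality) auto
        hence "v \<le> real n * (1 - qq N)" by (simp add: v_def algebra_simps)
        also have "\<dots> \<le> (real n + 1) / (real N + 1)" unfolding qq_bounds(3) by (simp add: divide_right_mono)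
        finally show ?thesis .
      qed
      hence "v powr (1/4) \<le> ((real n + 1) / (real N + 1)) powr (1/4)" using v by (intro powr_mono2) auto
      moreover have "v \<le> v powr (1/4)"
        using v powr_mono'[of "1/4" 1 v] by (cases "v = 0") auto
      ultimately have vle: "v \<le> (real n + 1) powr (1/4) * (real N + 1) powr (-1/4)"
        by (simp add: powr_divide powr_minus_divide)
      have "c n * of_real (qq N) ^ n - c n = - (c n * of_real v)"
        by (simp add: v_def algebra_simps)
      hence "norm (c n * of_real (qq N) ^ n - c n) = norm (c n) * v"
        using v by (simp add: norm_mult)
      also have "\<dots> \<le> (C * (real n + 1) powr (-7/4)) * ((real n + 1) powr (1/4) * (real N + 1) powr (-1/4))"
        using C v vle by (intro mult_mono) auto
      also have "\<dots> = C * (real N + 1) powr (-1/4) * ((real n + 1) powr (-7/4) * (real n + 1) powr (1/4))"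
        by (simp add: mult_ac)
      also have "(real n + 1) powr (-7/4) * (real n + 1) powr (1/4) = (real n + 1) powr (-3/2)"
        by (simp flip: powr_add)
      finally show "norm (c n * of_real (qq N) ^ n - c n) \<le> C * (real N + 1) powr (-1/4) * (real n + 1) powr (-3/2)" .
    qed
    also have "\<dots> = (C * (suminf (\<lambda>j. (real j + 1) powr (-3/2)))) * (real N + 1) powr (- (1/4))"
      by (subst suminf_mult) (use sm in auto)
    finally show "norm ((suminf (\<lambda>n. c n * of_real (qq N) ^ n)) - suminf c) \<le> (C * (suminf (\<lambda>j. (real j + 1) powr (-3/2)))) * (real N + 1) powr (- (1/4))" .
  qed simp
qed

text \<open>A concrete value defined by a formula on all elements; it is matched with
  \<open>zeta_sh\<close> on \<open>QX0\<close> and, through \<open>phi\<close>, with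
  \<open>zeta_star\<close> on \<open>QY0\<close>.\<close>

definition zval :: "complex \<Rightarrow> letter nc \<Rightarrow> complex" where
  "zval \<mu> p = suminf (cf \<mu> p)"

lemma cf_sums_zval: "Re \<mu> > 0 \<Longrightarrow> p \<in> QX0 \<mu> \<Longrightarrow> cf \<mu> p sums zval \<mu> p"
  unfolding zval_def using decays_cf decays_summable summable_norm_cancel summable_sums by blast

lemma zval_linear:
  assumes "Re \<mu> > 0"
  shows "p \<in> QX0 \<mu> \<Longrightarrow> q \<in> QX0 \<mu> \<Longrightarrow> zval \<mu> (p + q) = zval \<mu> p + zval \<mu> q"
    "p \<in> QX0 \<mu> \<Longrightarrow> zval \<mu> (scale c p) = c * zval \<mu> p"
proof -
  show "p \<in> QX0 \<mu> \<Longrightarrow> q \<in> QX0 \<mu> \<Longrightarrow> zval \<mu> (p + q) = zval \<mu> p + zval \<mu> q"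
    using sums_add[OF cf_sums_zval[OF assms, of p] cf_sums_zval[OF assms, of q]]
    by (simp add: zval_def[of _ "p + q"] cf_linear[abs_def] sums_unique[symmetric])
  show "p \<in> QX0 \<mu> \<Longrightarrow> zval \<mu> (scale c p) = c * zval \<mu> p"
    using sums_mult[OF cf_sums_zval[OF assms, of p], of c]
    by (simp add: zval_def[of _ "scale c p"] cf_linear[abs_def] sums_unique[symmetric])
qed

lemma sum_cf_tendsto:
  assumes "Re \<mu> > 0" "p \<in> QX0 \<mu>"
  shows "(\<lambda>n. \<Sum>j\<le>n. cf \<mu> p j) \<longlonglongrightarrow> zval \<mu> p"
  using cf_sums_zval[OF assms] by (simp add: sums_def_le)

lemma zval_values:
  assumes \<mu>: "Re \<mu> > 0"
  shows "zval \<mu> (word []) = 1"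
    "admissible w \<Longrightarrow> zval \<mu> (word (yx w)) = zeta \<mu> w"
    "special u a b \<Longrightarrow> zval \<mu> (word (yx (u @ [(1, a)])) - word (yx (u @ [(1, b)]))) = Dmu \<mu> u a b"
proof -
  have "(\<lambda>n. \<Sum>j\<le>n. cf \<mu> (word []) j) \<longlonglongrightarrow> 1"
    using sum_cf_yx[of "[]" \<mu>] by simp
  thus "zval \<mu> (word []) = 1"
    using sum_cf_tendsto[OF \<mu> QX0_base(1)] LIMSEQ_unique by blast
  assume w: "admissible w"
  hence "positive w" by (simp add: admissible_def)
  hence "(\<lambda>n. \<Sum>j\<le>n. cf \<mu> (word (yx w)) j) \<longlonglongrightarrow> zeta \<mu> w"
    using zeta_trunc_tendsto[OF \<mu> w] by (simp add: sum_cf_yx)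
  thus "zval \<mu> (word (yx w)) = zeta \<mu> w"
    using sum_cf_tendsto[OF \<mu> QX0_yx_base(1)[OF w]] LIMSEQ_unique by blast
next
  assume s: "special u a b"
  hence "positive (u @ [(1, a)])" "positive (u @ [(1, b)])" by (auto simp: special_def)
  hence "(\<lambda>n. \<Sum>j\<le>n. cf \<mu> (word (yx (u @ [(1, a)])) - word (yx (u @ [(1, b)]))) j) \<longlonglongrightarrow> Dmu \<mu> u a b"
    using Dmu_tendsto[OF \<mu> s] by (simp only: cf_linear sum_subtractf sum_cf_yx)
  thus "zval \<mu> (word (yx (u @ [(1, a)])) - word (yx (u @ [(1, b)]))) = Dmu \<mu> u a b"
    using sum_cf_tendsto[OF \<mu> QX0_yx_base(2)[OF s]] LIMSEQ_unique by blast
qed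

lemma zval_Zmu:
  assumes \<mu>: "Re \<mu> > 0" and "p \<in> QX0 \<mu>"
  shows "zval \<mu> p \<in> Zmu \<mu>"
proof -
  have Z: "1 \<in> Zmu \<mu>" "admissible w \<Longrightarrow> zeta \<mu> w \<in> Zmu \<mu>" "special u a b \<Longrightarrow> Dmu \<mu> u a b \<in> Zmu \<mu>" for w u a b
    unfolding Zmu_def by (rule cx.span_base; blast)+
  have "QX0 \<mu> \<subseteq> {p \<in> QX0 \<mu>. zval \<mu> p \<in> Zmu \<mu>}"
  proof (rule QX0_subset_submod_yx)
    have "zval \<mu> 0 = 0" by (simp add: zval_def cf_zero)
    thus "submod (Qmu \<mu>) scale {p \<in> QX0 \<mu>. zval \<mu> p \<in> Zmu \<mu>}"
      by (intro submodI) (auto simp: zval_linear[OF \<mu>] intro: submodD[OF QX0_submod] submodD[OF Zmu_submod])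
  qed (use Z in \<open>auto simp: zval_values[OF \<mu>] zval_values[OF \<mu>, simplified] QX0_base QX0_yx_base QX0_yx_base[simplified]\<close>)
  thus ?thesis using assms(2) by blast
qed

lemma zeta_star_eq:
  assumes "Re \<mu> > 0" "p \<in> QY0 \<mu>"
  shows "zeta_star \<mu> p = zval \<mu> (phi p)"
proof -
  have "(\<lambda>n. zeta_star_trunc \<mu> n p) \<longlonglongrightarrow> zval \<mu> (phi p)"
    using sum_cf_tendsto[OF assms(1) phi_QX0[OF assms(2)]] sum_cf_phi[OF subsetD[OF QY0_sub_QY assms(2)]]
    by (simp add: zeta_star_trunc_eq)
  thus ?thesis unfolding zeta_star_def by (rule limI)
qed

text \<open>The prescribed values sit on generators with linear relations (differences of
  differences), so existence is not automatic. It is settled by \<open>zval\<close>, which is linear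
  by construction and takes these values; uniqueness holds because the generators span.\<close>

lemma zeta_sh_eq:
  assumes \<mu>: "Re \<mu> > 0"
  shows "zeta_sh \<mu> = restrict (zval \<mu>) (QX0 \<mu>)"
  unfolding zeta_sh_def
proof (rule the_equality)
  show "is_zeta_sh \<mu> (restrict (zval \<mu>) (QX0 \<mu>))"
    unfolding is_zeta_sh_def linear_over_def
    using QX0_base(1)[of \<mu>] QX0_yx_base[where \<mu> = \<mu>] submodD[OF QX0_submod[of \<mu>]] zval_linear[OF \<mu>] zval_values[OF \<mu>]
    by (simp only: restrict_apply' restrict_extensional) simp
next
  fix f assume f: "is_zeta_sh \<mu> f"
  have lin: "f (p + q) = f p + f q" "c \<in> Qmu \<mu> \<Longrightarrow> f (scale c p) = c * f p"
    if "p \<in> QX0 \<mu>" "q \<in> QX0 \<mu>" for p q c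
    using f that by (auto simp: is_zeta_sh_def linear_over_def)
  have "QX0 \<mu> \<subseteq> {p \<in> QX0 \<mu>. f p = zval \<mu> p}"
  proof (rule QX0_subset_submod_yx)
    show "submod (Qmu \<mu>) scale {p \<in> QX0 \<mu>. f p = zval \<mu> p}"
    proof (rule submodI)
      show "0 \<in> {p \<in> QX0 \<mu>. f p = zval \<mu> p}"
        using lin(2)[OF QX0_base(1) QX0_base(1), of 0] submodD(1)[OF QX0_submod]
        by (simp add: zval_def cf_zero)
    qed (use lin zval_linear[OF \<mu>] submodD[OF QX0_submod[of \<mu>]] in auto)
  qed (use f QX0_base(1)[of \<mu>] QX0_yx_base[where \<mu> = \<mu>] zval_values[OF \<mu>] in \<open>auto simp: is_zeta_sh_def\<close>)
  thus "f = restrict (zval \<mu>) (QX0 \<mu>)"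
    using f by (intro extensionalityI[of _ "QX0 \<mu>"]) (auto simp: is_zeta_sh_def)
qed

section \<open>Abel means\<close>

definition abel :: "nat \<Rightarrow> (nat \<Rightarrow> complex) \<Rightarrow> complex" where
  "abel N s = of_real (1 - qq N) * suminf (\<lambda>n. s n * of_real (qq N) ^ n)"

text \<open>A convenient class of sequences whose power series converge in the unit disc; it
  contains all sequences bounded by a power of \<open>hn\<close>.\<close>

definition slow :: "(nat \<Rightarrow> complex) \<Rightarrow> bool" where
  "slow s \<longleftrightarrow> (\<exists>C. \<forall>n. norm (s n) \<le> C * (real n + 1))"

lemma slowI: "(\<And>n. norm (s n) \<le> C * (real n + 1)) \<Longrightarrow> slow s"
  by (auto simp: slow_def)

lemma slow_hn:
  assumes "\<And>n. norm (s n) \<le> C * hn n ^ k"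
  shows "slow s"
proof -
  obtain D where D: "D \<ge> 0" "\<And>n. hn n ^ k \<le> D * (real n + 1) powr 1"
    using hn_power_bound[of 1 k] by auto
  have "C * hn 0 ^ k \<ge> 0" by (rule order_trans[OF norm_ge_zero assms])
  hence C: "C \<ge> 0" using zero_less_power[OF hn_pos[of 0], of k] by (simp add: zero_le_mult_iff)
  show ?thesis
  proof (rule slowI)
    fix n
    have "norm (s n) \<le> C * (D * (real n + 1))"
      using order_trans[OF assms[of n] mult_left_mono[OF D(2) C]] by simp
    thus "norm (s n) \<le> C * D * (real n + 1)" by (simp add: mult.assoc)
  qed
qed

lemma slow_add: "slow s \<Longrightarrow> slow t \<Longrightarrow> slow (\<lambda>n. s n + t n)"
proof -
  assume "slow s" "slow t"
  then obtain C D where CD: "\<And>n. norm (s n) \<le> C * (real n + 1)" "\<And>n. norm (t n) \<le> D * (real n + 1)"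
    by (auto simp: slow_def)
  show ?thesis
  proof (rule slowI)
    fix n
    show "norm (s n + t n) \<le> (C + D) * (real n + 1)"
      using norm_triangle_ineq[of "s n" "t n"] CD(1)[of n] CD(2)[of n] by (simp add: algebra_simps)
  qed
qed

lemma slow_cmult: "slow s \<Longrightarrow> slow (\<lambda>n. c * s n)"
proof -
  assume "slow s"
  then obtain C where C: "\<And>n. norm (s n) \<le> C * (real n + 1)" by (auto simp: slow_def)
  show ?thesis
  proof (rule slowI)
    fix n
    show "norm (c * s n) \<le> (norm c * C) * (real n + 1)"
      using mult_left_mono[OF C[of n] norm_ge_zero[of c]] by (simp add: norm_mult mult.assoc)
  qed
qed

lemma slow_diff: "slow s \<Longrightarrow> slow t \<Longrightarrow> slow (\<lambda>n. s n - t n)"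
  using slow_add[of s "\<lambda>n. (-1) * t n"] slow_cmult[of t "-1"] by simp

lemma slow_sum: "(\<And>x. x \<in> A \<Longrightarrow> slow (s x)) \<Longrightarrow> slow (\<lambda>n. \<Sum>x\<in>A. s x n)"
  by (induction A rule: infinite_finite_induct) (auto intro: slow_add slowI[of _ 0])

lemma slow_bounded: "(\<And>n. norm (s n) \<le> C) \<Longrightarrow> slow s"
  using slow_hn[of s C 0] by simp

lemma slow_tendsto: "s \<longlonglongrightarrow> l \<Longrightarrow> slow s"
proof -
  assume "s \<longlonglongrightarrow> l"
  hence "Bseq s" by (intro convergent_imp_Bseq convergentI)
  thus ?thesis by (auto simp: Bseq_def intro: slow_bounded)
qed

lemma slow_summable:
  assumes "slow s" "norm z < 1"
  shows "summable (\<lambda>n. norm (s n * z ^ n))"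
proof -
  obtain C where C: "\<And>n. norm (s n) \<le> C * (real n + 1)" using assms(1) by (auto simp: slow_def)
  have "summable (\<lambda>n. C * (of_nat (Suc n) * norm z ^ n))"
    by (intro summable_mult sums_summable[OF geometric_deriv_sums]) (use assms(2) in auto)
  thus ?thesis
  proof (rule summable_comparison_test'[where N = 0])
    fix n
    show "norm (norm (s n * z ^ n)) \<le> C * (of_nat (Suc n) * norm z ^ n)"
      using mult_right_mono[OF C[of n], of "norm z ^ n"] by (simp add: norm_mult norm_power mult_ac add_ac)
  qed
qed

lemma norm_qq: "norm (complex_of_real (qq N)) < 1"
  using qq_bounds[of N] by simp

lemma slow_summable_qq: "slow s \<Longrightarrow> summable (\<lambda>n. s n * of_real (qq N) ^ n)"
  using slow_summable[OF _ norm_qq] by (rule summable_norm_cancel)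

lemma abel_add: "slow s \<Longrightarrow> slow t \<Longrightarrow> abel N (\<lambda>n. s n + t n) = abel N s + abel N t"
  unfolding abel_def distrib_right
  by (subst suminf_add[symmetric]) (auto intro: slow_summable_qq simp: distrib_left)

lemma abel_cmult: "slow s \<Longrightarrow> abel N (\<lambda>n. c * s n) = c * abel N s"
  unfolding abel_def mult.assoc by (subst suminf_mult) (auto intro: slow_summable_qq)

lemma abel_diff: "slow s \<Longrightarrow> slow t \<Longrightarrow> abel N (\<lambda>n. s n - t n) = abel N s - abel N t"
  using abel_add[of s "\<lambda>n. (-1) * t n" N] slow_cmult[of t "-1"] abel_cmult[of t N "-1"] by simp

lemma abel_sum: "(\<And>x. x \<in> A \<Longrightarrow> slow (s x)) \<Longrightarrow> abel N (\<lambda>n. \<Sum>x\<in>A. s x n) = (\<Sum>x\<in>A. abel N (s x))"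
proof (induction A rule: infinite_finite_induct)
  case (insert x A)
  thus ?case by (simp add: abel_add slow_sum)
qed (auto simp: abel_def)

text \<open>Regularity of Abel summation: the weights (1 - q) q^n have total mass 1, and the mass on
  the first K indices is at most K (1 - q) = K/(N + 1).\<close>

lemma abel_tendsto_0:
  assumes "s \<longlonglongrightarrow> 0"
  shows "(\<lambda>N. abel N s) \<longlonglongrightarrow> 0"
proof (rule LIMSEQ_I)
  fix e :: real assume e: "e > 0"
  have "Bseq s" using assms by (intro convergent_imp_Bseq convergentI)
  then obtain B where B: "B > 0" "\<And>n. norm (s n) \<le> B" by (auto simp: Bseq_def)
  obtain K where K: "\<And>n. n \<ge> K \<Longrightarrow> norm (s n) < e / 2"
    using LIMSEQ_D[OF assms, of "e / 2"] e by auto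
  have bound: "norm (abel N s) \<le> real K * B / (real N + 1) + e / 2" for N
  proof -
    have slow: "slow s" by (rule slow_tendsto[OF assms])
    define a where "a n = (if n < K then B else 0)" for n
    have a_sums: "a sums (\<Sum>n<K. B)"
      using sums_finite[of "{..<K}" a] by (auto simp: a_def)
    have g: "(\<lambda>n. e / 2 * qq N ^ n) sums (e / 2 * (1 / (1 - qq N)))"
      by (intro sums_mult geometric_sums) (use qq_bounds[of N] in auto)
    have "norm (suminf (\<lambda>n. s n * of_real (qq N) ^ n)) \<le> suminf (\<lambda>n. a n + e / 2 * qq N ^ n)"
    proof (rule norm_suminf_le)
      show "summable (\<lambda>n. a n + e / 2 * qq N ^ n)"
        using sums_add[OF a_sums g] by (rule sums_summable)
      fix n
      have q: "0 \<le> qq N ^ n" "qq N ^ n \<le> 1" using qq_bounds[of N] by (auto intro: power_le_one)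
      have "norm (s n * of_real (qq N) ^ n) = norm (s n) * qq N ^ n"
        using qq_bounds(1)[of N] by (simp add: norm_mult norm_power)
      also have "\<dots> \<le> a n + e / 2 * qq N ^ n"
      proof (cases "n < K")
        case True
        have "norm (s n) * qq N ^ n \<le> B * 1" using B q by (intro mult_mono) auto
        thus ?thesis using True q e by (simp add: a_def add_increasing2)
      next
        case False
        thus ?thesis using mult_right_mono[of "norm (s n)" "e / 2" "qq N ^ n"] K[of n] q by (simp add: a_def)
      qed
      finally show "norm (s n * of_real (qq N) ^ n) \<le> a n + e / 2 * qq N ^ n" .
    qed
    also have "\<dots> = real K * B + e / 2 * (1 / (1 - qq N))"
      using sums_unique[OF sums_add[OF a_sums g]] by simp
    finally have "(1 - qq N) * norm (suminf (\<lambda>n. s n * of_real (qq N) ^ n)) \<le>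
        (1 - qq N) * (real K * B + e / 2 * (1 / (1 - qq N)))"
      using qq_bounds(2)[of N] by (intro mult_left_mono) auto
    moreover have "norm (abel N s) = (1 - qq N) * norm (suminf (\<lambda>n. s n * of_real (qq N) ^ n))"
      using qq_bounds(2)[of N] unfolding abel_def norm_mult norm_of_real by simp
    moreover have "(1 - qq N) * (real K * B + e / 2 * (1 / (1 - qq N))) = real K * B / (real N + 1) + e / 2"
      unfolding qq_bounds(3) by (simp add: field_simps)
    ultimately show ?thesis by simp
  qed
  have "(\<lambda>N. real K * B / (real N + 1)) \<longlonglongrightarrow> 0" by real_asymp
  from LIMSEQ_D[OF this, of "e / 2"] e obtain N0 where
    N0: "\<And>N. N \<ge> N0 \<Longrightarrow> norm (real K * B / (real N + 1)) < e / 2" by auto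
  show "\<exists>no. \<forall>n\<ge>no. norm (abel n s - 0) < e"
  proof (intro exI[of _ N0] allI impI)
    fix N assume "N \<ge> N0"
    have "real K * B / (real N + 1) < e / 2" using N0[OF \<open>N \<ge> N0\<close>] by (simp only: real_norm_def abs_less_iff)
    thus "norm (abel N s - 0) < e" using bound[of N] unfolding diff_0_right by linarith
  qed
qed

text \<open>Summation by parts, run from the partial sums S_n to the terms c_n by subtracting q
  times the series of S_n from its shift; thus a growth bound on the partial sums alone yields
  convergence.\<close>

lemma abel_parts:
  assumes "slow (\<lambda>n. \<Sum>j\<le>n. c j)"
  shows "(\<lambda>n. c n * of_real (qq N) ^ n) sums abel N (\<lambda>n. \<Sum>j\<le>n. c j)"
proof -
  define q where "q = complex_of_real (qq N)"
  define S where "S n = (\<Sum>j\<le>n. c j)" for n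
  define A where "A = suminf (\<lambda>n. S n * q ^ n)"
  have sA: "(\<lambda>n. S n * q ^ n) sums A"
    unfolding A_def q_def using slow_summable_qq[OF assms] S_def by (intro summable_sums) simp
  have "(\<lambda>n. S (Suc n) * q ^ Suc n) sums (A - S 0)"
    using sA by (subst sums_Suc_iff) simp
  hence "(\<lambda>n. S (Suc n) * q ^ Suc n - q * (S n * q ^ n)) sums (A - S 0 - q * A)"
    by (intro sums_diff sums_mult sA)
  moreover have "S (Suc n) * q ^ Suc n - q * (S n * q ^ n) = c (Suc n) * q ^ Suc n" for n
    by (simp add: S_def algebra_simps)
  ultimately have "(\<lambda>n. c (Suc n) * q ^ Suc n) sums (A - S 0 - q * A)" by simp
  hence "(\<lambda>n. c n * q ^ n) sums (A - S 0 - q * A + c 0)"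
    by (subst (asm) sums_Suc_iff) (simp add: S_def)
  moreover have "A - S 0 - q * A + c 0 = abel N S"
    by (simp add: abel_def A_def q_def S_def algebra_simps)
  ultimately show ?thesis by (simp add: q_def S_def[abs_def])
qed

section \<open>Abel means of powers of harmonic numbers\<close>

text \<open>\<open>es n k\<close> is the elementary symmetric polynomial of degree \<open>k\<close> in \<open>1, 1/2, \<dots>, 1/n\<close>.\<close>

fun es :: "nat \<Rightarrow> nat \<Rightarrow> complex" where
  "es n 0 = 1"
| "es 0 (Suc k) = 0"
| "es (Suc n) (Suc k) = es n (Suc k) + es n k / of_nat (Suc n)"

lemma es_bound: "norm (es n k) \<le> Harmonic_Numbers.harm n ^ k"
proof (induction n k rule: es.induct)
  case (3 n k)
  let ?h = "Harmonic_Numbers.harm n :: real"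
  have h: "?h \<ge> 0" by (rule harm_nonneg)
  have "norm (es (Suc n) (Suc k)) \<le> norm (es n (Suc k)) + norm (es n k) / real (Suc n)"
    using norm_triangle_ineq[of "es n (Suc k)" "es n k / of_nat (Suc n)"]
    by (simp add: norm_divide del: of_nat_Suc)
  also have "\<dots> \<le> ?h ^ Suc k + ?h ^ k / real (Suc n)"
    using 3 by (intro add_mono divide_right_mono) auto
  also have "\<dots> = ?h ^ k * (?h + inverse (of_nat (Suc n)))"
    by (simp add: field_simps)
  also have "\<dots> \<le> (?h + inverse (of_nat (Suc n))) ^ k * (?h + inverse (of_nat (Suc n)))"
    using h by (intro mult_right_mono power_mono) auto
  finally show ?case by (simp only: harm_Suc power_Suc mult.commute)
qed (auto simp: harm_expand)

lemma harm_le_hn: "Harmonic_Numbers.harm n \<le> hn n"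
  unfolding hn_def by (rule harm_mono) simp

lemma es_bound_hn: "norm (es n k) \<le> 1 * hn n ^ k"
  using order_trans[OF es_bound[of n k] power_mono[OF harm_le_hn harm_nonneg]] by simp

section \<open>Generating functions of the elementary symmetric polynomials\<close>

definition geo :: "complex fps" where "geo = Abs_fps (\<lambda>_. 1)"

definition logser :: "complex fps" where
  "logser = Abs_fps (\<lambda>n. if n = 0 then 0 else 1 / of_nat n)"

lemma geo_mult: "(1 - fps_X) * geo = 1"
  by (rule fps_ext) (simp add: geo_def left_diff_distrib fps_X_mult_nth)

lemma geo_radius: "fps_conv_radius geo \<ge> 1"
  unfolding fps_conv_radius_def
proof (rule conv_radius_geI_ex')
  fix r :: real assume "0 < r" "ereal r < 1"
  hence "norm (complex_of_real r) < 1" by (simp add: one_ereal_def)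
  from summable_norm_cancel[OF slow_summable[OF slow_bounded[of "\<lambda>n. fps_nth geo n" 1] this]]
  show "summable (\<lambda>n. fps_nth geo n * of_real r ^ n)" by (simp add: geo_def)
qed

lemma logser_radius: "fps_conv_radius logser \<ge> 1"
  unfolding fps_conv_radius_def
proof (rule conv_radius_geI_ex')
  fix r :: real assume "0 < r" "ereal r < 1"
  hence "norm (complex_of_real r) < 1" by (simp add: one_ereal_def)
  moreover have "norm (fps_nth logser n) \<le> 1" for n by (simp add: logser_def norm_divide)
  ultimately show "summable (\<lambda>n. fps_nth logser n * of_real r ^ n)"
    using summable_norm_cancel[OF slow_summable[OF slow_bounded]] by blast
qed

lemma eval_geo: "norm z < 1 \<Longrightarrow> eval_fps geo z = 1 / (1 - z)"
  using geometric_sums[of z] by (simp add: eval_fps_def geo_def sums_unique[symmetric])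

lemma eval_logser: "eval_fps logser (of_real (qq N)) = of_real (ln (real N + 1))"
proof -
  let ?q = "complex_of_real (qq N)"
  have "(\<lambda>n. - ((- (- ?q)) ^ n) / of_nat n) sums ln (1 + (- ?q))"
    by (rule Ln_series') (use norm_qq[of N] in simp)
  hence "(\<lambda>n. - (- (?q ^ n) / of_nat n)) sums (- ln (1 - ?q))"
    by (intro sums_minus) simp
  moreover have "- (- (?q ^ n) / of_nat n) = fps_nth logser n * ?q ^ n" for n
    by (simp add: logser_def)
  ultimately have "(\<lambda>n. fps_nth logser n * ?q ^ n) sums (- ln (1 - ?q))" by simp
  moreover have "1 - ?q = of_real (1 / (real N + 1))" unfolding qq_bounds(3)[symmetric] by simp
  ultimately show ?thesis
    by (simp add: eval_fps_def sums_unique[symmetric] Ln_of_real ln_div del: of_real_divide)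
qed

text \<open>Let G_k be the left-hand series. The recursion of \<open>es\<close> says that (1 - X)
  G_(k+1) has derivative G_k = \<open>geo\<close> (1 - X) G_k. The series
  \<open>logser\<close>^(k+1) / (k+1)! obeys the same law because \<open>logser\<close> has
  derivative \<open>geo\<close>, and both constant terms are 0.\<close>

lemma es_series: "Abs_fps (\<lambda>n. es n k) = geo * (fps_const (1 / fact k) * logser ^ k)"
proof -
  have dl: "fps_deriv logser = geo"
    by (rule fps_ext) (simp add: logser_def geo_def del: of_nat_Suc)
  have "(1 - fps_X) * Abs_fps (\<lambda>n. es n k) = fps_const (1 / fact k) * logser ^ k"
  proof (induction k)
    case 0
    have "Abs_fps (\<lambda>n. es n 0) = geo" by (simp add: geo_def)
    thus ?case using geo_mult by simp
  next
    case (Suc k)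
    let ?G = "(1 - fps_X) * Abs_fps (\<lambda>n. es n (Suc k))"
    let ?L = "fps_const (1 / fact (Suc k)) * logser ^ Suc k"
    have "fps_deriv ?G = Abs_fps (\<lambda>n. es n k)"
    proof (rule fps_ext)
      fix n
      have "fps_nth ?G (Suc n) = es n k / of_nat (Suc n)"
        by (simp add: left_diff_distrib fps_X_mult_nth)
      thus "fps_nth (fps_deriv ?G) n = fps_nth (Abs_fps (\<lambda>n. es n k)) n"
        by (simp only: fps_deriv_nth Suc_eq_plus1[symmetric] fps_nth_Abs_fps) (simp del: of_nat_Suc)
    qed
    also have "\<dots> = geo * ((1 - fps_X) * Abs_fps (\<lambda>n. es n k))"
      using geo_mult by (simp add: mult_ac flip: mult.assoc)
    also have "\<dots> = geo * (fps_const (1 / fact k) * logser ^ k)" by (simp only: Suc)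
    also have "\<dots> = fps_deriv ?L"
    proof -
      have "fps_deriv ?L = fps_const (1 / fact (Suc k)) * (fps_const (of_nat (Suc k)) * geo * logser ^ k)"
        by (simp add: fps_deriv_power dl del: fact_Suc of_nat_Suc power_Suc)
      also have "\<dots> = fps_const (1 / fact (Suc k) * of_nat (Suc k)) * (geo * logser ^ k)"
        by (simp only: fps_const_mult[symmetric] mult_ac)
      also have "1 / fact (Suc k) * of_nat (Suc k) = (1 / fact k :: complex)"
        by (simp add: divide_simps del: of_nat_Suc)
      finally show ?thesis by (simp add: mult_ac)
    qed
    finally have "?G = fps_const (fps_nth ?G 0 - fps_nth ?L 0) + ?L"
      by (subst (asm) fps_deriv_eq_iff)
    moreover have "fps_nth ?G 0 = 0" "fps_nth ?L 0 = 0"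
      by (simp_all add: left_diff_distrib logser_def)
    ultimately show ?case by simp
  qed
  hence "geo * ((1 - fps_X) * Abs_fps (\<lambda>n. es n k)) = geo * (fps_const (1 / fact k) * logser ^ k)" by simp
  moreover have "geo * ((1 - fps_X) * Abs_fps (\<lambda>n. es n k)) = ((1 - fps_X) * geo) * Abs_fps (\<lambda>n. es n k)"
    by (simp only: mult_ac)
  ultimately show ?thesis by (simp add: geo_mult)
qed

text \<open>The factor 1 - q cancels \<open>geo\<close>, and \<open>logser\<close> at q = N/(N+1) is
  log(N + 1). The value is the coefficient of u^k in (1 - q)^(-u).\<close>

lemma abel_es: "abel N (\<lambda>n. es n k) = of_real (ln (real N + 1)) ^ k / fact k"
proof -
  let ?q = "complex_of_real (qq N)"
  have r: "ereal (norm ?q) < 1" using norm_qq[of N] by (simp add: one_ereal_def)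
  have rg: "ereal (norm ?q) < fps_conv_radius geo" and rl: "ereal (norm ?q) < fps_conv_radius logser"
    using less_le_trans[OF r geo_radius] less_le_trans[OF r logser_radius] by auto
  have rp: "ereal (norm ?q) < fps_conv_radius (logser ^ k)"
    using less_le_trans[OF rl fps_conv_radius_power] by blast
  have rc: "ereal (norm ?q) < fps_conv_radius (fps_const (1 / fact k) * logser ^ k)"
    by (rule less_le_trans[OF _ fps_conv_radius_mult]) (use rp in simp)
  have "suminf (\<lambda>n. es n k * ?q ^ n) = eval_fps (Abs_fps (\<lambda>n. es n k)) ?q"
    by (simp add: eval_fps_def)
  also have "\<dots> = eval_fps geo ?q * (eval_fps (fps_const (1 / fact k)) ?q * eval_fps logser ?q ^ k)"
    unfolding es_series using rg rc rp rl by (simp add: eval_fps_mult eval_fps_power)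
  finally have "suminf (\<lambda>n. es n k * ?q ^ n) = 1 / (1 - ?q) * (1 / fact k * of_real (ln (real N + 1)) ^ k)"
    using norm_qq by (simp add: eval_geo eval_logser)
  moreover have "1 - ?q \<noteq> 0"
    using qq_bounds(2)[of N] by (metis of_real_1 of_real_diff of_real_eq_0_iff diff_gt_0_iff_gt less_irrefl)
  ultimately show ?thesis by (simp add: abel_def)
qed

section \<open>Factorization of exp(u H_n) as a power series in u\<close>

definition esser :: "nat \<Rightarrow> complex fps" where "esser n = Abs_fps (es n)"

text \<open>Thus \<open>esser n\<close> is the product of the factors 1 + u/j for 1 \<le> j \<le>
  n.\<close>

lemma esser_Suc: "esser (Suc n) = esser n * (1 + fps_const (1 / of_nat (Suc n)) * fps_X)"
proof (rule fps_ext)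
  fix k
  show "fps_nth (esser (Suc n)) k = fps_nth (esser n * (1 + fps_const (1 / of_nat (Suc n)) * fps_X)) k"
    by (cases k) (auto simp: esser_def distrib_left mult.left_commute[of "Abs_fps _"] fps_X_mult_right_nth
        simp del: of_nat_Suc)
qed

text \<open>The series of 1 / (1 + a u).\<close>

definition altgeo :: "complex \<Rightarrow> complex fps" where "altgeo a = Abs_fps (\<lambda>i. (- a) ^ i)"

lemma altgeo_mult: "(1 + fps_const a * fps_X) * altgeo a = 1"
proof (rule fps_ext)
  fix n
  show "fps_nth ((1 + fps_const a * fps_X) * altgeo a) n = fps_nth 1 n"
    by (cases n) (auto simp: altgeo_def distrib_right mult.assoc fps_X_mult_nth)
qed

lemma deriv_altgeo: "fps_deriv (altgeo a) = - (fps_const a * altgeo a * altgeo a)"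
proof -
  let ?b = "1 + fps_const a * fps_X"
  have "fps_deriv (?b * altgeo a) = 0" unfolding altgeo_mult by simp
  hence "fps_const a * altgeo a + ?b * fps_deriv (altgeo a) = 0" by (simp add: add.commute)
  hence "altgeo a * (fps_const a * altgeo a + ?b * fps_deriv (altgeo a)) = 0" by simp
  hence "fps_const a * altgeo a * altgeo a + (?b * altgeo a) * fps_deriv (altgeo a) = 0"
    by (simp only: distrib_left mult_ac)
  thus ?thesis unfolding altgeo_mult by (simp add: eq_neg_iff_add_eq_0 add.commute)
qed

text \<open>Partial products of (1 + u/j)^(-1) exp(u/j), the Weierstrass product of exp(\<gamma> u)
  \<Gamma>(1 + u).\<close>

fun vser :: "nat \<Rightarrow> complex fps" where
  "vser 0 = 1"
| "vser (Suc n) = vser n * (altgeo (1 / of_nat (Suc n)) * fps_exp (1 / of_nat (Suc n)))"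

lemma esser_vser: "esser n * vser n = fps_exp (Harmonic_Numbers.harm n)"
proof (induction n)
  case 0
  have "esser 0 = 1"
  proof (rule fps_ext)
    fix k show "fps_nth (esser 0) k = fps_nth 1 k" by (cases k) (auto simp: esser_def)
  qed
  thus ?case by (simp add: harm_expand)
next
  case (Suc n)
  let ?a = "1 / of_nat (Suc n) :: complex"
  have "esser (Suc n) * vser (Suc n) = ((1 + fps_const ?a * fps_X) * altgeo ?a) * (esser n * vser n) * fps_exp ?a"
    unfolding esser_Suc vser.simps by (simp only: mult_ac)
  also have "\<dots> = fps_exp (Harmonic_Numbers.harm n + ?a)"
    unfolding altgeo_mult Suc by (simp only: fps_exp_add_mult mult_1)
  finally show ?case by (simp add: harm_Suc inverse_eq_divide)
qed

text \<open>Coefficients of the logarithmic derivative of \<open>vser n\<close>. The constant one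
  vanishes, since the derivative 1/j of the exponent cancels the leading term of -(1/j) / (1 +
  u/j).\<close>

definition psum :: "nat \<Rightarrow> nat \<Rightarrow> complex" where
  "psum n i = (if i = 0 then 0 else (-1) ^ Suc i * (\<Sum>j<n. 1 / of_nat (Suc j) ^ Suc i))"

lemma deriv_vser: "fps_deriv (vser n) = vser n * Abs_fps (psum n)"
proof (induction n)
  case 0
  have "psum 0 = (\<lambda>_. 0)" by (auto simp: psum_def)
  thus ?case by (simp add: fps_eq_iff)
next
  case (Suc n)
  define a where "a = (1 / of_nat (Suc n) :: complex)"
  have ps: "Abs_fps (psum (Suc n)) = Abs_fps (psum n) + (fps_const a - fps_const a * altgeo a)"
  proof (rule fps_ext)
    fix i
    show "fps_nth (Abs_fps (psum (Suc n))) i = fps_nth (Abs_fps (psum n) + (fps_const a - fps_const a * altgeo a)) i"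
    proof (cases i)
      case (Suc k)
      have "(-1) ^ Suc i * (1 / of_nat (Suc n) ^ Suc i) = - (a * (- a) ^ i)"
      proof -
        have "(-1) ^ Suc i * (1 / of_nat (Suc n) ^ Suc i) = (- a) ^ Suc i"
          unfolding a_def power_minus[of "1 / of_nat (Suc n)"] by (simp only: power_one_over)
        thus ?thesis by simp
      qed
      thus ?thesis using Suc by (simp add: psum_def altgeo_def distrib_left del: of_nat_Suc power_Suc)
    qed (simp add: psum_def altgeo_def)
  qed
  have "fps_deriv (vser (Suc n)) = fps_deriv (vser n) * (altgeo a * fps_exp a) + vser n * fps_deriv (altgeo a * fps_exp a)"
    by (simp add: a_def algebra_simps del: of_nat_Suc)
  also have "fps_deriv (altgeo a * fps_exp a) = (altgeo a * fps_exp a) * (fps_const a - fps_const a * altgeo a)"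
    by (simp add: deriv_altgeo algebra_simps)
  finally have "fps_deriv (vser (Suc n)) = vser (Suc n) * (Abs_fps (psum n) + (fps_const a - fps_const a * altgeo a))"
    unfolding Suc vser.simps a_def[symmetric] by (simp only: distrib_left mult_ac)
  thus ?case unfolding ps .
qed

lemma vser_nth_0: "fps_nth (vser n) 0 = 1"
  by (induction n) (auto simp: altgeo_def)

lemma vser_rec: "of_nat (Suc k) * fps_nth (vser n) (Suc k) = (\<Sum>i\<le>k. fps_nth (vser n) (k - i) * psum n i)"
proof -
  have "of_nat (Suc k) * fps_nth (vser n) (Suc k) = fps_nth (fps_deriv (vser n)) k"
    by (simp add: fps_deriv_nth)
  also have "\<dots> = (\<Sum>i\<le>k. fps_nth (vser n) (k - i) * psum n i)"
    unfolding deriv_vser fps_mult_nth atLeast0AtMost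
    by (rule sum.reindex_bij_witness[of _ "\<lambda>i. k - i" "\<lambda>i. k - i"]) auto
  finally show ?thesis .
qed

text \<open>For i > 0 this is (-1)^(i+1) \<zeta>(i+1), the limit of \<open>psum n i\<close>.\<close>

definition plim :: "nat \<Rightarrow> complex" where
  "plim i = (if i = 0 then 0 else (-1) ^ Suc i * suminf (\<lambda>j. 1 / of_nat (Suc j) ^ Suc i))"

lemma decays_rapid: "decays c \<Longrightarrow> rapid c"
  unfolding decays_def by (auto intro!: rapidI_powr[of "7/4"])

lemma rapid_psum: "rapid (\<lambda>n. psum n i - plim i)"
proof (cases "i = 0")
  case False
  define c where "c j = (1 / of_nat (Suc j) ^ Suc i :: complex)" for j
  have "norm (c j) \<le> 1 * (real j + 1) powr (-7/4)" for j
  proof -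
    have "norm (c j) = (real j + 1) powr (- real (Suc i))"
      unfolding powr_minus powr_realpow[of "real j + 1", simplified]
      by (simp add: c_def norm_divide norm_power inverse_eq_divide add.commute del: power_Suc of_nat_Suc) simp
    also have "\<dots> \<le> (real j + 1) powr (-7/4)" using False by (intro powr_mono) auto
    finally show ?thesis by simp
  qed
  hence d: "decays c" unfolding decays_def by (intro exI[of _ 1]) auto
  \<comment> \<open>\<open>psum\<close> sums over j < n, the tail estimate over j \<le> n; the
    surplus term is itself rapid.\<close>
  have "rapid (\<lambda>n. ((\<Sum>j\<le>n. c j) - suminf c) - c n)"
    by (intro rapid_diff decays_tail_rapid decays_rapid d)
  moreover have "((\<Sum>j\<le>n. c j) - suminf c) - c n = (\<Sum>j<n. c j) - suminf c" for n
    by (simp flip: lessThan_Suc_atMost)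
  ultimately have "rapid (\<lambda>n. (-1) ^ Suc i * ((\<Sum>j<n. c j) - suminf c))"
    by (intro rapid_cmult) simp
  thus ?thesis using False by (simp add: psum_def plim_def c_def[abs_def] right_diff_distrib)
qed (simp add: psum_def plim_def)

text \<open>The logarithmic derivative of exp(\<gamma> u) \<Gamma>(1 + u) is \<gamma> + Digamma(1 +
  u). Its constant term is 0 because Digamma(1) = -\<gamma>, and its higher coefficients are
  Polygamma values at 1, which are zeta values up to sign and factorial.\<close>

lemma gamma_ode:
  defines "F \<equiv> fps_expansion (\<lambda>u. exp (euler_mascheroni * u) * Gamma (1 + u)) 0"
  shows "fps_deriv F = F * Abs_fps plim" "fps_nth F 0 = 1"
proof -
  define f where "f u = exp (euler_mascheroni * u) * Gamma (1 + u :: complex)" for u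
  have F: "F = fps_expansion f 0" by (simp add: F_def f_def[abs_def])
  have nonpos: "1 + u \<notin> \<int>\<^sub>\<le>\<^sub>0" if "norm u < 1" for u :: complex
  proof
    assume "1 + u \<in> \<int>\<^sub>\<le>\<^sub>0"
    then obtain n where n: "1 + u = - of_nat n" by (auto elim!: nonpos_Ints_cases')
    hence "u = - of_nat n - 1" by (simp add: eq_diff_eq add.commute)
    hence "u = - of_nat (Suc n)" by simp
    hence "norm u = real (Suc n)" by (simp only: norm_minus_cancel norm_of_nat)
    thus False using that by simp
  qed
  have an: "f analytic_on {0}"
    unfolding f_def[abs_def] using nonpos[of 0] by (intro analytic_intros) auto
  have 1: "f has_fps_expansion F" unfolding F by (rule analytic_at_imp_has_fps_expansion_0[OF an])
  have 2: "(\<lambda>u. Digamma (1 + u :: complex)) has_fps_expansion fps_expansion Digamma 1"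
    by (rule analytic_at_imp_has_fps_expansion) (use nonpos[of 0] in \<open>auto intro!: analytic_on_Polygamma\<close>)
  have 3: "(\<lambda>u. f u * (euler_mascheroni + Digamma (1 + u))) has_fps_expansion
      F * (fps_const euler_mascheroni + fps_expansion Digamma 1)"
    by (intro fps_expansion_intros 1 2)
  have "eventually (\<lambda>u. u \<in> ball 0 1) (nhds (0::complex))" by (intro eventually_nhds_in_open) auto
  hence "eventually (\<lambda>u. deriv f u = f u * (euler_mascheroni + Digamma (1 + u))) (nhds 0)"
  proof eventually_elim
    case (elim u)
    have "(f has_field_derivative f u * (euler_mascheroni + Digamma (1 + u))) (at u)"
      unfolding f_def[abs_def] using nonpos[of u] elim
      by (auto intro!: derivative_eq_intros simp: algebra_simps)
    thus ?case by (rule DERIV_imp_deriv)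
  qed
  from has_fps_expansion_cong[OF this refl]
  have "deriv f has_fps_expansion F * (fps_const euler_mascheroni + fps_expansion Digamma 1)"
    using 3 by simp
  moreover have "deriv f has_fps_expansion fps_deriv F" by (rule has_fps_expansion_deriv[OF 1])
  ultimately have "fps_deriv F = F * (fps_const euler_mascheroni + fps_expansion Digamma 1)"
    by (rule fps_expansion_unique_complex[rotated])
  moreover have "fps_const euler_mascheroni + fps_expansion Digamma 1 = Abs_fps plim"
  proof (rule fps_ext)
    fix i
    have D: "fps_nth (fps_expansion Digamma 1) i = Polygamma i 1 / fact i"
      using higher_deriv_Polygamma[of "1::complex" i 0] nonpos[of 0] by (simp add: fps_expansion_def)
    show "fps_nth (fps_const euler_mascheroni + fps_expansion Digamma 1) i = fps_nth (Abs_fps plim) i"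
    proof (cases "i = 0")
      case True
      thus ?thesis using D by (simp add: plim_def)
    next
      case False
      have "(\<lambda>k. inverse ((1 + of_nat k) ^ Suc i)) sums ((-1) ^ Suc i * Polygamma i 1 / fact i :: complex)"
        using False by (intro Polygamma_LIMSEQ) auto
      hence "suminf (\<lambda>j. 1 / of_nat (Suc j) ^ Suc i) = ((-1) ^ Suc i * Polygamma i 1 / fact i :: complex)"
        by (simp add: sums_unique[symmetric] inverse_eq_divide)
      hence "plim i = ((-1) ^ Suc i * (-1) ^ Suc i) * (Polygamma i 1 / fact i)"
        using False by (simp add: plim_def)
      also have "(-1) ^ Suc i * (-1) ^ Suc i = (1::complex)"
        by (simp flip: power_mult_distrib)
      finally show ?thesis using False D by simp
    qed
  qed
  ultimately show "fps_deriv F = F * Abs_fps plim" by simp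
  show "fps_nth F 0 = 1" by (simp add: F fps_expansion_def f_def)
qed

lemma gamma_coeff_0: "gamma_coeff 0 = 1"
  using gamma_ode(2) by (simp add: gamma_coeff_def)

lemma gamma_rec: "of_nat (Suc k) * gamma_coeff (Suc k) = (\<Sum>i\<le>k. gamma_coeff (k - i) * plim i)"
proof -
  let ?F = "fps_expansion (\<lambda>u. exp (euler_mascheroni * u) * Gamma (1 + u)) 0"
  have "of_nat (Suc k) * gamma_coeff (Suc k) = fps_nth (fps_deriv ?F) k"
    by (simp add: fps_deriv_nth gamma_coeff_def)
  also have "\<dots> = (\<Sum>i\<le>k. gamma_coeff (k - i) * plim i)"
    unfolding gamma_ode(1) fps_mult_nth atLeast0AtMost gamma_coeff_def
    by (rule sum.reindex_bij_witness[of _ "\<lambda>i. k - i" "\<lambda>i. k - i"]) auto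
  finally show ?thesis .
qed

text \<open>Both coefficient sequences obey the same recursion, one driven by \<open>psum\<close>,
  the other by \<open>plim\<close>, so the rapid convergence of the power sums propagates by
  induction on k. This avoids any uniform estimate in u.\<close>

lemma rapid_vser: "rapid (\<lambda>n. fps_nth (vser n) k - gamma_coeff k)"
proof (induction k rule: less_induct)
  case (less k)
  show ?case
  proof (cases k)
    case 0
    thus ?thesis by (simp add: vser_nth_0 gamma_coeff_0)
  next
    case (Suc l)
    let ?v = "\<lambda>i n. fps_nth (vser n) i"
    have "rapid (\<lambda>n. plim i * (?v (l - i) n - gamma_coeff (l - i)) +
        (?v (l - i) n - gamma_coeff (l - i)) * (psum n i - plim i) + gamma_coeff (l - i) * (psum n i - plim i))" for i
      using less[of "l - i"] Suc by (intro rapid_add rapid_cmult rapid_mult_rapid rapid_psum) auto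
    hence "rapid (\<lambda>n. ?v (l - i) n * psum n i - gamma_coeff (l - i) * plim i)" for i
      by (simp add: algebra_simps)
    hence "rapid (\<lambda>n. inverse (of_nat (Suc l)) * (\<Sum>i\<le>l. ?v (l - i) n * psum n i - gamma_coeff (l - i) * plim i))"
      by (intro rapid_cmult rapid_sum)
    moreover have "inverse (of_nat (Suc l)) * (\<Sum>i\<le>l. ?v (l - i) n * psum n i - gamma_coeff (l - i) * plim i)
        = ?v k n - gamma_coeff k" for n
      unfolding sum_subtractf vser_rec[symmetric] gamma_rec[symmetric] Suc right_diff_distrib
      by (simp flip: mult.assoc del: of_nat_Suc)
    ultimately show ?thesis by simp
  qed
qed

text \<open>H_n^k / k! is the coefficient of u^k in exp(u H_n) = \<open>vser n\<close> *
  \<open>esser n\<close>. Replacing the coefficients of \<open>vser\<close> by their limits is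
  harmless precisely because that error is rapid: it gets multiplied by \<open>es\<close>, which may
  grow like a power of log.\<close>

lemma abel_harm_power:
  "(\<lambda>N. abel N (\<lambda>n. Harmonic_Numbers.harm n ^ k / fact k) -
     (\<Sum>i\<le>k. gamma_coeff i * (of_real (ln (real N + 1)) ^ (k - i) / fact (k - i)))) \<longlonglongrightarrow> 0"
proof -
  let ?v = "\<lambda>i n. fps_nth (vser n) i"
  have eq: "Harmonic_Numbers.harm n ^ k / fact k = (\<Sum>i\<le>k. ?v i n * es n (k - i))" for n
  proof -
    have "Harmonic_Numbers.harm n ^ k / fact k = fps_nth (vser n * esser n) k"
      using esser_vser[of n] by (simp add: mult.commute)
    thus ?thesis by (simp add: fps_mult_nth atLeast0AtMost esser_def)
  qed
  define d where "d n = (\<Sum>i\<le>k. (?v i n - gamma_coeff i) * es n (k - i))" for n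
  have rd: "rapid d" unfolding d_def[abs_def]
    by (intro rapid_sum rapid_mult_bounded[OF rapid_vser, where C = 1]) (rule es_bound_hn)
  have se: "slow (\<lambda>n. es n j)" for j by (rule slow_hn[OF es_bound_hn])
  have s2: "slow (\<lambda>n. gamma_coeff i * es n (k - i))" for i by (rule slow_cmult[OF se])
  have "abel N (\<lambda>n. Harmonic_Numbers.harm n ^ k / fact k) -
     (\<Sum>i\<le>k. gamma_coeff i * (of_real (ln (real N + 1)) ^ (k - i) / fact (k - i))) = abel N d" for N
  proof -
    have "Harmonic_Numbers.harm n ^ k / fact k = d n + (\<Sum>i\<le>k. gamma_coeff i * es n (k - i))" for n
      by (simp add: eq d_def left_diff_distrib sum_subtractf)
    hence "abel N (\<lambda>n. Harmonic_Numbers.harm n ^ k / fact k) = abel N d + abel N (\<lambda>n. \<Sum>i\<le>k. gamma_coeff i * es n (k - i))"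
      using abel_add[OF slow_tendsto[OF rapid_tendsto[OF rd]] slow_sum[OF s2]] by simp
    also have "abel N (\<lambda>n. \<Sum>i\<le>k. gamma_coeff i * es n (k - i)) =
       (\<Sum>i\<le>k. gamma_coeff i * (of_real (ln (real N + 1)) ^ (k - i) / fact (k - i)))"
      by (subst abel_sum[OF s2]) (simp add: abel_cmult[OF se] abel_es)
    finally show ?thesis by simp
  qed
  thus ?thesis using abel_tendsto_0[OF rapid_tendsto[OF rd]] by simp
qed

section \<open>The function \<open>H\<close>\<close>

text \<open>For Re s < 0 the integrand is singular at 0, but the antiderivative t^(s+1) / (s+1)
  extends continuously by 0, and the fundamental theorem asks for derivatives in the interior
  only.\<close>

lemma has_integral_cpowr:
  fixes s :: complex
  assumes s: "Re s > -1"
  shows "((\<lambda>t::real. of_real t powr s) has_integral 1 / (s + 1)) {0..1}"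
proof -
  have nz: "s + 1 \<noteq> 0" using s by (auto simp: add_eq_0_iff2)
  define F where "F t = complex_of_real t powr (s + 1) / (s + 1)" for t :: real
  have der: "(F has_vector_derivative of_real t powr s) (at t)" if "t > 0" for t
  proof -
    have "complex_of_real t \<notin> \<real>\<^sub>\<le>\<^sub>0" using that by simp
    from DERIV_cdivide[OF has_field_derivative_powr[OF this, of "s + 1"], of "s + 1"]
    have "((\<lambda>z. z powr (s + 1) / (s + 1)) has_field_derivative of_real t powr s) (at (of_real t))"
      using nz by simp
    from has_vector_derivative_real_field[OF this] show ?thesis
      by (simp add: F_def[abs_def])
  qed
  have cont: "continuous_on {0..1} F"
    unfolding continuous_on_eq_continuous_within
  proof
    fix t :: real assume t: "t \<in> {0..1}"
    show "continuous (at t within {0..1}) F"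
    proof (cases "t = 0")
      case False
      hence "(F has_vector_derivative of_real t powr s) (at t)" using t by (intro der) auto
      hence "isCont F t" by (rule has_vector_derivative_continuous)
      thus ?thesis by (rule continuous_at_imp_continuous_at_within)
    next
      case True
      have "((\<lambda>t::real. t powr (Re s + 1) / norm (s + 1)) \<longlongrightarrow> 0 powr (Re s + 1) / norm (s + 1)) (at 0 within {0..1})"
        using s nz by (intro tendsto_intros tendsto_powr2) (auto simp: eventually_at_filter)
      hence "((\<lambda>t::real. t powr (Re s + 1) / norm (s + 1)) \<longlongrightarrow> 0) (at 0 within {0..1})" by simp
      hence "(F \<longlongrightarrow> 0) (at 0 within {0..1})"
      proof (rule Lim_null_comparison[rotated])
        show "eventually (\<lambda>t. norm (F t) \<le> t powr (Re s + 1) / norm (s + 1)) (at 0 within {0..1})"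
          by (auto simp: eventually_at_filter F_def norm_divide norm_powr_real_powr)
      qed
      thus ?thesis using True by (simp add: continuous_within F_def)
    qed
  qed
  have "((\<lambda>t. of_real t powr s) has_integral F 1 - F 0) {0..1}"
    by (rule fundamental_theorem_of_calculus_interior[OF _ cont der]) auto
  thus ?thesis by (simp add: F_def)
qed

text \<open>The interval is split at 1/2. On the left the denominator is at least 1/2 and only t^x
  can be singular. On the right t^x = exp(x ln t) with |ln t| \<le> 2 (1 - t), so the numerator
  carries a factor 1 - t that cancels the denominator.\<close>

lemma H_integrand_bound:
  fixes x :: complex and t :: real
  assumes t: "t \<in> {0..1}"
  shows "norm ((1 - of_real t powr x) / (1 - of_real t)) \<le> 2 * (1 + t powr Re x) + 2 * (norm x * exp (norm x))"
proof -
  have n1: "norm (1 - complex_of_real t) = 1 - t"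
    using t by (metis atLeastAtMost_iff norm_of_real of_real_1 of_real_diff abs_of_nonneg diff_ge_0_iff_ge)
  consider (a) "t \<le> 1/2" | (b) "t > 1/2" "t < 1" | (c) "t = 1" using t by force
  thus ?thesis
  proof cases
    case a
    have "norm (1 - complex_of_real t powr x) \<le> 1 + t powr Re x"
      using norm_triangle_ineq4[of 1 "complex_of_real t powr x"] t by (simp add: norm_powr_real_powr)
    moreover have "1 / (1 - t) \<le> 2" using a by (simp add: field_simps)
    ultimately have "norm (1 - complex_of_real t powr x) * (1 / (1 - t)) \<le> (1 + t powr Re x) * 2"
      using t a by (intro mult_mono) auto
    hence "norm ((1 - of_real t powr x) / (1 - of_real t)) \<le> 2 * (1 + t powr Re x)"
      by (simp add: norm_divide n1)
    thus ?thesis by (simp add: add_increasing2)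
  next
    case b
    define z where "z = x * of_real (ln t)"
    have pz: "complex_of_real t powr x = exp z"
      using b by (simp add: powr_def z_def Ln_of_real)
    have "ln (1 / t) \<le> 1 / t - 1" by (rule ln_le_minus_one) (use b in auto)
    also have "\<dots> = (1 - t) / t" using b by (simp add: field_simps)
    also have "\<dots> \<le> 2 * (1 - t)" using b divide_left_mono[of "1/2" t "1 - t"] by simp
    finally have "- ln t \<le> 2 * (1 - t)" using b by (simp add: ln_div)
    moreover have "ln t < 0" using b by simp
    ultimately have l: "\<bar>ln t\<bar> \<le> 2 * (1 - t)" "\<bar>ln t\<bar> \<le> 1" using b by auto
    have nz: "norm z \<le> norm x * (2 * (1 - t))" "norm z \<le> norm x"
      using mult_left_mono[OF l(1) norm_ge_zero[of x]] mult_left_mono[OF l(2) norm_ge_zero[of x]]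
      by (simp_all add: z_def norm_mult)
    have "norm (exp z - 1) \<le> exp \<bar>Re z\<bar> * norm z"
      using Taylor_exp[of z 0] by simp
    also have "\<dots> \<le> exp (norm x) * (norm x * (2 * (1 - t)))"
      using nz abs_Re_le_cmod[of z] by (intro mult_mono) auto
    finally have "norm (1 - complex_of_real t powr x) \<le> 2 * (norm x * exp (norm x)) * (1 - t)"
      by (simp add: pz norm_minus_commute algebra_simps)
    hence "norm ((1 - of_real t powr x) / (1 - of_real t)) \<le> 2 * (norm x * exp (norm x))"
      using b by (simp add: norm_divide n1 pos_divide_le_eq)
    thus ?thesis by (simp add: add_increasing)
  next
    \<comment> \<open>At t = 1 the quotient is 0 / 0 = 0.\<close>
    case c
    thus ?thesis by simp
  qed
qed

text \<open>Multiplying the integrand by 1 - t^N turns 1 / (1 - t) into a finite geometric sum that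
  integrates term by term; dominated convergence then removes the factor.\<close>

lemma H_series:
  assumes a: "Re a > 0"
  shows "(\<lambda>N. \<Sum>j<N. 1 / (of_nat j + 1) - 1 / (of_nat j + a)) \<longlonglongrightarrow> H (a - 1)"
proof -
  define x where "x = a - 1"
  have x: "Re x > -1" using a by (simp add: x_def)
  define f where "f t = (1 - complex_of_real t powr x) / (1 - of_real t)" for t :: real
  define fN where "fN N t = (1 - complex_of_real t ^ N) * f t" for N t
  have fN_sum: "fN N t = (\<Sum>j<N. of_real t powr (of_nat j) - of_real t powr (x + of_nat j))" if "t \<in> {0<..1}" for N t
  proof -
    have t0: "complex_of_real t \<noteq> 0" using that by auto
    have "fN N t = (\<Sum>j<N. of_real t ^ j) * (1 - of_real t powr x)"
    proof (cases "t = 1")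
      case False
      hence "1 - complex_of_real t \<noteq> 0" by (metis of_real_1 of_real_eq_iff right_minus_eq)
      thus ?thesis by (simp add: fN_def f_def one_diff_power_eq)
    qed (simp add: fN_def f_def)
    also have "\<dots> = (\<Sum>j<N. of_real t powr (of_nat j) - of_real t powr (x + of_nat j))"
      unfolding sum_distrib_right using t0
      by (intro sum.cong refl) (simp add: powr_add right_diff_distrib mult.commute)
    finally show ?thesis .
  qed
  have fN_int: "(fN N has_integral (\<Sum>j<N. 1 / (of_nat j + 1) - 1 / (of_nat j + a))) {0..1}" for N
  proof -
    have "((\<lambda>t. \<Sum>j<N. of_real t powr (of_nat j) - of_real t powr (x + of_nat j)) has_integral
        (\<Sum>j<N. 1 / (of_nat j + 1) - 1 / (x + of_nat j + 1))) {0..1}"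
      using x by (intro has_integral_sum has_integral_diff has_integral_cpowr) auto
    \<comment> \<open>The point t = 0 is exempted: there t^0 = 1, whereas
      \<open>0 powr 0 = 0\<close>.\<close>
    hence "(fN N has_integral (\<Sum>j<N. 1 / (of_nat j + 1) - 1 / (x + of_nat j + 1))) {0..1}"
      by (rule has_integral_spike[of "{0}", rotated 2]) (auto simp: fN_sum)
    thus ?thesis by (simp add: x_def add.commute)
  qed
  define h where "h t = 2 * (1 + t powr Re x) + 2 * (norm x * exp (norm x))" for t :: real
  have h: "h integrable_on {0..1}"
    unfolding h_def using x integrable_on_powr_from_0[of "Re x" 1]
    by (intro integrable_add integrable_on_mult_right integrable_on_const) auto
  have "(\<lambda>N. integral {0..1} (fN N)) \<longlonglongrightarrow> integral {0..1} f"
  proof (rule dominated_convergence(2)[OF _ h])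
    show "fN N integrable_on {0..1}" for N using fN_int by blast
    show "norm (fN N t) \<le> h t" if "t \<in> {0..1}" for N t
    proof -
      have "norm (1 - complex_of_real t ^ N) = norm (complex_of_real (1 - t ^ N))" by simp
      also have "\<dots> \<le> 1" unfolding norm_of_real using that power_le_one[of t N] zero_le_power[of t N] by auto
      finally have "norm (fN N t) \<le> 1 * norm (f t)"
        unfolding fN_def norm_mult by (intro mult_right_mono) auto
      also have "\<dots> \<le> h t" using H_integrand_bound[OF that, of x] by (simp add: f_def h_def)
      finally show ?thesis .
    qed
    show "(\<lambda>N. fN N t) \<longlonglongrightarrow> f t" if "t \<in> {0..1}" for t
    proof (cases "t = 1")
      case False
      hence pw: "(\<lambda>N. complex_of_real t ^ N) \<longlonglongrightarrow> 0"
        using that by (intro LIMSEQ_power_zero) auto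
      have "(\<lambda>N. (1 - complex_of_real t ^ N) * f t) \<longlonglongrightarrow> (1 - 0) * f t"
        by (rule tendsto_mult[OF tendsto_diff[OF tendsto_const pw] tendsto_const])
      thus ?thesis by (simp add: fN_def)
    qed (simp add: fN_def f_def)
  qed
  moreover have "integral {0..1} (fN N) = (\<Sum>j<N. 1 / (of_nat j + 1) - 1 / (of_nat j + a))" for N
    using fN_int by (rule integral_unique)
  ultimately show ?thesis by (simp add: H_def f_def[abs_def] x_def)
qed

section \<open>Asymptotics of the two generators\<close>

text \<open>The constant term of the divergent letter with parameter m, common to truncation and to
  the series; \<open>cmu \<mu> a b\<close> equals
  \<open>hconst \<mu> a - hconst \<mu> b\<close>.\<close>

definition hconst :: "complex \<Rightarrow> rat \<Rightarrow> complex" where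
  "hconst \<mu> m = - H (of_rat m / \<mu> - 1)"

text \<open>Removing the coefficients of -log(1 - q) leaves a decaying sequence. Its ordinary sum
  and its Abel limit coincide, which is why both generators have the same constant term.\<close>

definition dgen :: "complex \<Rightarrow> rat \<Rightarrow> nat \<Rightarrow> complex" where
  "dgen \<mu> m n = lterm \<mu> (1, m) n - fps_nth logser n"

lemma sum_logser: "(\<Sum>j\<le>n. fps_nth logser j) = Harmonic_Numbers.harm n"
  by (induction n) (auto simp: logser_def harm_Suc harm_expand inverse_eq_divide)

lemma Re_div_pos:
  assumes "Re \<mu> > 0" "m > 0"
  shows "Re (of_rat m / \<mu>) > 0"
proof -
  have r: "(of_rat m :: complex) = of_real (of_rat m)" by (cases m) (simp add: of_rat_rat)
  have nz: "\<mu> \<noteq> 0" using assms(1) by auto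
  hence "0 < cmod \<mu> ^ 2" by simp
  thus ?thesis using assms unfolding r Re_complex_div_gt_0 by (simp add: Re_complex_div_gt_0)
qed

lemma lterm_1:
  assumes "Re \<mu> > 0"
  shows "lterm \<mu> (1, m) n = 1 / (of_nat n + of_rat m / \<mu>)"
proof -
  have nz: "\<mu> \<noteq> 0" using assms by auto
  hence "of_nat n * \<mu> + of_rat m = \<mu> * (of_nat n + of_rat m / \<mu>)" by (simp add: field_simps)
  thus ?thesis using nz by (simp add: lterm_def factor_def)
qed

text \<open>With a = m/\<mu>, the difference 1/(n + a) - 1/n passes through 1/(n + 1):
  \<open>g\<close> and \<open>l\<close> are the two resulting differences, each O(1/n^2). The detour
  keeps the term n = 0 finite.\<close>

lemma decays_dgen:
  assumes \<mu>: "Re \<mu> > 0" and m: "m > 0"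
  shows "decays (dgen \<mu> m)"
proof -
  define a where "a = of_rat m / \<mu>"
  have a: "Re a > 0" using Re_div_pos[OF assms] by (simp add: a_def)
  have na: "of_nat n + a \<noteq> 0" for n
  proof -
    have "Re (of_nat n + a) > 0" using a by simp
    thus ?thesis by (metis less_irrefl zero_complex.sel(1))
  qed
  obtain C where C: "C \<ge> 0" "\<And>n. norm (lterm \<mu> (1, m) n) \<le> C / (real n + 1)"
    using lterm_bound[OF \<mu>, of "(1, m)"] m by auto
  define g where "g n = (1 - a) * (lterm \<mu> (1, m) n / (of_nat n + 1))" for n
  have g: "norm (g n) \<le> norm (1 - a) * C / (real n + 1) ^ 2" for n
  proof -
    have "norm (of_nat n + 1 :: complex) = real n + 1"
      using norm_of_nat[of "Suc n", where ?'a = complex] by (simp add: add.commute)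
    hence "norm (g n) = norm (1 - a) * (norm (lterm \<mu> (1, m) n) / (real n + 1))"
      by (simp add: g_def norm_mult norm_divide)
    also have "\<dots> \<le> norm (1 - a) * (C / (real n + 1) / (real n + 1))"
      by (intro mult_left_mono divide_right_mono C) auto
    finally show ?thesis by (simp add: power2_eq_square)
  qed
  have "decays g"
    using decays_mult_hn[OF g, of "\<lambda>_. 1 :: complex" 1 0] by (simp add: decays_def)
  moreover define l where "l n = (1 / (of_nat n + 1) - fps_nth logser n :: complex)" for n
  \<comment> \<open>The constant 2 covers (n + 1)/n \<le> 2 for n \<ge> 1 and the value 1 at n =
    0.\<close>
  have l: "norm (l n) \<le> 2 / (real n + 1) ^ 2" for n
  proof (cases "n = 0")
    case False
    have "l n = complex_of_real (1 / (real n + 1) - 1 / real n)"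
      using False by (simp add: l_def logser_def)
    hence "norm (l n) = \<bar>1 / (real n + 1) - 1 / real n\<bar>" by (simp only: norm_of_real)
    also have "\<dots> = 1 / (real n * (real n + 1))" using False by (simp add: field_simps)
    also have "\<dots> \<le> 2 / (real n + 1) ^ 2"
    proof -
      have "(real n + 1) ^ 2 \<le> 2 * (real n * (real n + 1))" using False mult_mono[of 1 "real n" 1 "real n"] by (simp add: power2_eq_square algebra_simps)
      thus ?thesis using False by (simp add: divide_simps)
    qed
    finally show ?thesis .
  qed (simp add: l_def logser_def)
  have "decays l"
    using decays_mult_hn[OF l, of "\<lambda>_. 1 :: complex" 1 0] by (simp add: decays_def)
  ultimately have "decays (\<lambda>n. g n + l n)" by (intro decays_add)
  moreover have "g n + l n = dgen \<mu> m n" for n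
  proof -
    have "of_nat n + 1 \<noteq> (0 :: complex)" by (metis of_nat_Suc of_nat_eq_0_iff nat.distinct(1) add.commute)
    hence "(1 - a) * (1 / (of_nat n + a) / (of_nat n + 1)) = 1 / (of_nat n + a) - 1 / (of_nat n + 1)"
      using na[of n] by (simp add: divide_simps)
    thus ?thesis unfolding g_def l_def dgen_def lterm_1[OF \<mu>] a_def[symmetric] by simp
  qed
  ultimately show ?thesis by (simp add: decays_def)
qed

lemma sum_dgen: "(\<Sum>j\<le>n. dgen \<mu> m j) = zeta_trunc \<mu> n [(1, m)] - Harmonic_Numbers.harm n"
  using zeta_trunc_snoc[of \<mu> n "[]" "(1, m)"] by (simp add: dgen_def sum_subtractf sum_logser)

lemma suminf_dgen:
  assumes \<mu>: "Re \<mu> > 0" and m: "m > 0"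
  shows "suminf (dgen \<mu> m) = hconst \<mu> m"
proof -
  have "(\<lambda>N. - (\<Sum>j<N. 1 / (of_nat j + 1) - 1 / (of_nat j + of_rat m / \<mu>))) \<longlonglongrightarrow> hconst \<mu> m"
    unfolding hconst_def by (intro tendsto_minus H_series Re_div_pos assms)
  hence "(\<lambda>N. - (\<Sum>j<Suc N. 1 / (of_nat j + 1) - 1 / (of_nat j + of_rat m / \<mu>))) \<longlonglongrightarrow> hconst \<mu> m"
    by (rule LIMSEQ_Suc)
  \<comment> \<open>Partial sums of \<open>dgen\<close> subtract the harmonic number of N, those of
    the series for \<open>H\<close> the one of N + 1; the discrepancy 1/(N + 1) tends to 0.\<close>
  moreover have eq: "- (\<Sum>j<Suc N. 1 / (of_nat j + 1) - 1 / (of_nat j + of_rat m / \<mu>)) =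
      (\<Sum>j\<le>N. dgen \<mu> m j) - 1 / (of_nat N + 1)" for N
  proof -
    have "- (\<Sum>j<Suc N. 1 / (of_nat j + 1) - 1 / (of_nat j + of_rat m / \<mu>)) =
       (\<Sum>j\<le>N. lterm \<mu> (1, m) j) - (\<Sum>j<Suc N. 1 / (of_nat j + 1))"
      by (simp only: lterm_1[OF \<mu>] sum_subtractf lessThan_Suc_atMost) simp
    also have "(\<Sum>j<Suc N. 1 / (of_nat j + 1 :: complex)) = Harmonic_Numbers.harm (Suc N)"
      unfolding harm_altdef by (intro sum.cong refl) (simp add: inverse_eq_divide add.commute)
    finally show ?thesis
      using zeta_trunc_snoc[of \<mu> N "[]" "(1, m)"] by (simp add: sum_dgen harm_Suc inverse_eq_divide add.commute)
  qed
  ultimately have "(\<lambda>N. (\<Sum>j\<le>N. dgen \<mu> m j) - 1 / (of_nat N + 1)) \<longlonglongrightarrow> hconst \<mu> m"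
    unfolding eq by blast
  moreover have "(\<lambda>N. 1 / (of_nat N + 1 :: complex)) \<longlonglongrightarrow> 0"
    using LIMSEQ_inverse_real_of_nat[THEN tendsto_of_real[where ?'a = complex]]
    by (simp add: inverse_eq_divide add.commute)
  ultimately have "(\<lambda>N. ((\<Sum>j\<le>N. dgen \<mu> m j) - 1 / (of_nat N + 1)) + 1 / (of_nat N + 1)) \<longlonglongrightarrow> hconst \<mu> m + 0"
    by (rule tendsto_add)
  hence "(\<lambda>N. \<Sum>j\<le>N. dgen \<mu> m j) \<longlonglongrightarrow> hconst \<mu> m" by simp
  moreover have "(\<lambda>N. \<Sum>j\<le>N. dgen \<mu> m j) \<longlonglongrightarrow> suminf (dgen \<mu> m)"
    using summable_sums[OF summable_norm_cancel[OF decays_summable[OF decays_dgen[OF assms]]]]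
    by (simp add: sums_def_le)
  ultimately show ?thesis by (rule LIMSEQ_unique[symmetric])
qed

lemma harmonic_generator_rapid:
  assumes "Re \<mu> > 0" "m > 0"
  shows "rapid (\<lambda>n. zeta_trunc \<mu> n [(1, m)] - (Harmonic_Numbers.harm n + hconst \<mu> m))"
  using decays_tail_rapid[OF decays_dgen[OF assms]] by (simp add: sum_dgen suminf_dgen[OF assms] algebra_simps)

lemma shuffle_generator_rapid:
  assumes "Re \<mu> > 0" "m > 0"
  shows "rapid (\<lambda>N. suminf (\<lambda>n. lterm \<mu> (1, m) n * of_real (qq N) ^ n) - (of_real (ln (real N + 1)) + hconst \<mu> m))"
proof -
  have "suminf (\<lambda>n. lterm \<mu> (1, m) n * of_real (qq N) ^ n) =
     suminf (\<lambda>n. dgen \<mu> m n * of_real (qq N) ^ n) + of_real (ln (real N + 1))" for N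
  proof -
    have "slow (dgen \<mu> m)" using decays_dgen[OF assms] by (intro slow_tendsto[OF rapid_tendsto] decays_rapid)
    hence 1: "summable (\<lambda>n. dgen \<mu> m n * of_real (qq N) ^ n)" by (rule slow_summable_qq)
    have "slow (fps_nth logser)" by (rule slow_bounded[of _ 1]) (simp add: logser_def norm_divide)
    hence 2: "summable (\<lambda>n. fps_nth logser n * of_real (qq N) ^ n)" by (rule slow_summable_qq)
    have "suminf (\<lambda>n. fps_nth logser n * of_real (qq N) ^ n) = of_real (ln (real N + 1))"
      using eval_logser[of N] by (simp add: eval_fps_def)
    thus ?thesis using suminf_add[OF 1 2] by (simp add: dgen_def left_diff_distrib)
  qed
  thus ?thesis using decays_abel_rapid[OF decays_dgen[OF assms]]
    by (simp add: suminf_dgen[OF assms] algebra_simps)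
qed

section \<open>The two regularizations\<close>

lemma of_real_at_infinity:
  fixes r :: "nat \<Rightarrow> real"
  assumes "filterlim r at_top sequentially"
  shows "filterlim (\<lambda>n. complex_of_real (r n)) at_infinity sequentially"
proof (rule filterlim_norm_at_top_imp_at_infinity)
  show "filterlim (\<lambda>n. norm (complex_of_real (r n))) at_top sequentially"
    by (rule filterlim_at_top_mono[OF assms]) (auto intro!: always_eventually)
qed

lemma filterlim_at_infinity_near:
  fixes f :: "nat \<Rightarrow> complex" and r :: "nat \<Rightarrow> real"
  assumes "(\<lambda>n. f n - (of_real (r n) + c)) \<longlonglongrightarrow> 0" "filterlim r at_top sequentially"
  shows "filterlim f at_infinity sequentially"
proof -
  have "filterlim (\<lambda>n. complex_of_real (r n)) at_infinity sequentially"
    by (rule of_real_at_infinity[OF assms(2)])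
  moreover have "(\<lambda>n. (f n - (of_real (r n) + c)) + c) \<longlonglongrightarrow> 0 + c"
    by (intro tendsto_add assms(1) tendsto_const)
  ultimately have "filterlim (\<lambda>n. ((f n - (of_real (r n) + c)) + c) + of_real (r n)) at_infinity sequentially"
    by (intro tendsto_add_filterlim_at_infinity)
  thus ?thesis by simp
qed

lemma bound_near:
  fixes f :: "nat \<Rightarrow> complex" and r :: "nat \<Rightarrow> real"
  assumes "(\<lambda>n. f n - (of_real (r n) + c)) \<longlonglongrightarrow> 0" "\<And>n. 0 \<le> r n" "\<And>n. r n \<le> hn n"
  shows "\<exists>C. \<forall>n. norm (f n) \<le> C * hn n"
proof -
  have "Bseq (\<lambda>n. f n - (of_real (r n) + c))"
    using assms(1) by (intro convergent_imp_Bseq convergentI)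
  then obtain B where B: "B > 0" "\<And>n. norm (f n - (of_real (r n) + c)) \<le> B" by (auto simp: Bseq_def)
  have "norm (f n) \<le> (1 + B + norm c) * hn n" for n
  proof -
    have "norm (f n) \<le> norm (f n - (of_real (r n) + c)) + (norm (complex_of_real (r n)) + norm c)"
      using norm_triangle_ineq[of "f n - (of_real (r n) + c)" "of_real (r n) + c"]
        norm_triangle_ineq[of "complex_of_real (r n)" c] by simp
    also have "\<dots> \<le> B + (hn n + norm c)" using B(2)[of n] assms(2,3)[of n] by simp
    also have "\<dots> \<le> B * hn n + (hn n + norm c * hn n)"
      using B(1) hn_ge_1[of n] by (intro add_mono mult_left_mono[of 1 _ B, simplified]
        mult_left_mono[of 1 _ "norm c", simplified]) auto
    finally show ?thesis by (simp add: algebra_simps)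
  qed
  thus ?thesis by blast
qed

lemma ln_le_hn: "0 \<le> ln (real N + 1)" "ln (real N + 1) \<le> hn N"
  using ln_le_harm[of N] harm_le_hn[of N] by simp_all

lemma ln_at_top: "filterlim (\<lambda>N. ln (real N + 1)) at_top sequentially"
  by real_asymp

section \<open>Evaluation of the generating series at the sample points\<close>

definition sev :: "complex \<Rightarrow> nat \<Rightarrow> letter nc \<Rightarrow> complex" where
  "sev \<mu> N p = lin (\<lambda>v. eval_fps (genser \<mu> v) (of_real (qq N))) p"

lemma slow_genser:
  assumes \<mu>: "Re \<mu> > 0" and "good v"
  shows "slow (fps_nth (genser \<mu> v))"
proof -
  obtain w where w: "positive w" "yx w = v" using good_obtain_yx[OF assms(2)] by blast
  show ?thesis
  proof (cases w rule: rev_cases)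
    case Nil
    thus ?thesis using w by (intro slow_bounded[of _ 1]) auto
  next
    case (snoc u y)
    obtain k m where y: "y = (k, m)" by (cases y)
    have p: "positive u" "k \<ge> 1" "positive [(k, m)]" using w snoc y by auto
    obtain C where C: "\<And>n. norm (lterm \<mu> (k, m) n) \<le> C / (real n + 1)"
      using lterm_bound_1[OF \<mu> p(3)] by blast
    have C0: "C \<ge> 0" using order_trans[OF norm_ge_zero C[of 0]] by simp
    obtain C' where C': "C' \<ge> 0" "\<And>n. norm (zeta_trunc \<mu> n u) \<le> C' * hn n ^ length u"
      using zeta_trunc_bound[OF \<mu> p(1)] by blast
    show ?thesis
    proof (rule slow_hn)
      fix n
      have "norm (fps_nth (genser \<mu> v) n) = norm (lterm \<mu> (k, m) n) * norm (zeta_trunc \<mu> n u)"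
        using p by (simp add: w(2)[symmetric] snoc y genser_yx_snoc sum_genser_yx norm_mult)
      also have "\<dots> \<le> C * (C' * hn n ^ length u)"
      proof (intro mult_mono C')
        have "C / (real n + 1) \<le> C" using C0 mult_left_mono[of 1 "real n + 1" C] by (simp add: divide_le_eq)
        thus "norm (lterm \<mu> (k, m) n) \<le> C" using C[of n] by linarith
      qed (use C0 in auto)
      finally show "norm (fps_nth (genser \<mu> v) n) \<le> (C * C') * hn n ^ length u" by (simp add: mult.assoc)
    qed
  qed
qed

lemma genser_radius:
  assumes "Re \<mu> > 0" "good v"
  shows "fps_conv_radius (genser \<mu> v) \<ge> 1"
  unfolding fps_conv_radius_def
proof (rule conv_radius_geI_ex')
  fix r :: real assume "0 < r" "ereal r < 1"
  hence "norm (complex_of_real r) < 1" by (simp add: one_ereal_def)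
  thus "summable (\<lambda>n. fps_nth (genser \<mu> v) n * of_real r ^ n)"
    by (rule summable_norm_cancel[OF slow_summable[OF slow_genser[OF assms]]])
qed

lemma cf_sums_sev:
  assumes \<mu>: "Re \<mu> > 0" and "p \<in> QX1 \<mu>"
  shows "(\<lambda>n. cf \<mu> p n * of_real (qq N) ^ n) sums sev \<mu> N p"
proof -
  let ?q = "complex_of_real (qq N)"
  let ?M = "{p. (\<lambda>n. cf \<mu> p n * ?q ^ n) sums sev \<mu> N p}"
  have "span_over (Qmu \<mu>) scale {word v | v. good v} \<subseteq> ?M"
  proof (rule span_subset)
    show "submod (Qmu \<mu>) scale ?M"
    proof (rule submodI)
      show "0 \<in> ?M" by (simp add: sev_def cf_linear)
    next
      fix p p' assume "p \<in> ?M" "p' \<in> ?M"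
      hence "(\<lambda>n. cf \<mu> p n * ?q ^ n + cf \<mu> p' n * ?q ^ n) sums (sev \<mu> N p + sev \<mu> N p')"
        by (intro sums_add) auto
      thus "p + p' \<in> ?M"
        by (simp add: sev_def lin_add cf_linear distrib_right)
    next
      fix c p assume "p \<in> ?M"
      hence "(\<lambda>n. c * (cf \<mu> p n * ?q ^ n)) sums (c * sev \<mu> N p)"
        by (intro sums_mult) auto
      thus "scale c p \<in> ?M"
        by (simp add: sev_def lin_scale cf_linear mult.assoc)
    qed
    show "{word v | v. good v} \<subseteq> ?M"
    proof safe
      fix v assume v: "good v"
      have "summable (\<lambda>n. fps_nth (genser \<mu> v) n * ?q ^ n)"
        by (rule slow_summable_qq[OF slow_genser[OF \<mu> v]])
      thus "(\<lambda>n. cf \<mu> (word v) n * ?q ^ n) sums sev \<mu> N (word v)"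
        by (simp add: sev_def cf_def eval_fps_def summable_sums)
    qed
  qed
  thus ?thesis using assms(2) unfolding QX1_eq by blast
qed

lemmas lin_eq_on_QX1 = lin_eq_on_span[of _ \<mu> good for \<mu>, folded QX1_eq]

lemma sev_shuffle_word:
  assumes \<mu>: "Re \<mu> > 0" and uv: "good u" "good v"
  shows "sev \<mu> N (shuffle_word u v) = sev \<mu> N (word u) * sev \<mu> N (word v)"
proof -
  let ?q = "complex_of_real (qq N)"
  have r: "ereal (norm ?q) < 1" using norm_qq[of N] by (simp add: one_ereal_def)
  have "shuffle_word u v \<in> QX1 \<mu>" using shuffle_word_wspan[OF uv] wspan_sub_QX1 by blast
  from sums_unique[OF cf_sums_sev[OF \<mu> this, of N]]
  have "sev \<mu> N (shuffle_word u v) = suminf (\<lambda>n. fps_nth (genser \<mu> u * genser \<mu> v) n * ?q ^ n)"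
    by (simp add: cf_def genser_shuffle_word[OF \<mu> uv])
  also have "\<dots> = eval_fps (genser \<mu> u * genser \<mu> v) ?q" by (simp add: eval_fps_def)
  also have "\<dots> = eval_fps (genser \<mu> u) ?q * eval_fps (genser \<mu> v) ?q"
    using less_le_trans[OF r genser_radius[OF \<mu> uv(1)]] less_le_trans[OF r genser_radius[OF \<mu> uv(2)]]
    by (rule eval_fps_mult)
  finally show ?thesis by (simp add: sev_def)
qed

lemma sev_shuffle:
  assumes \<mu>: "Re \<mu> > 0" and pq: "p \<in> QX1 \<mu>" "q \<in> QX1 \<mu>"
  shows "sev \<mu> N (shuffle p q) = sev \<mu> N p * sev \<mu> N q"
proof -
  let ?e = "\<lambda>v. eval_fps (genser \<mu> v) (of_real (qq N))"
  have "sev \<mu> N (shuffle p q) = lin (\<lambda>u. lin (\<lambda>v. sev \<mu> N (shuffle_word u v)) q) p"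
    by (simp add: shuffle_eq sev_def lin_lext)
  also have "\<dots> = lin (\<lambda>u. lin ?e q * ?e u) p"
  proof (rule lin_eq_on_QX1[OF pq(1)])
    fix u assume u: "good u"
    have "lin (\<lambda>v. sev \<mu> N (shuffle_word u v)) q = lin (\<lambda>v. ?e u * ?e v) q"
      by (rule lin_eq_on_QX1[OF pq(2)]) (simp add: sev_shuffle_word[OF \<mu> u], simp add: sev_def)
    thus "lin (\<lambda>v. sev \<mu> N (shuffle_word u v)) q = lin ?e q * ?e u"
      by (simp add: lin_mult_const)
  qed
  finally show ?thesis by (simp add: lin_mult_const sev_def)
qed

lemma sev_generator:
  assumes \<mu>: "Re \<mu> > 0" and m: "m > 0"
  shows "sev \<mu> N (word [LY m]) = suminf (\<lambda>n. lterm \<mu> (1, m) n * of_real (qq N) ^ n)"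
proof -
  have yx: "yx [(1, m)] = [LY m]" by (simp add: yx_def)
  have "good [LY m]" using good_snoc[of "[]" "LY m"] m by simp
  hence "word [LY m] \<in> QX1 \<mu>" by (rule QX1_word)
  from sums_unique[OF cf_sums_sev[OF \<mu> this, of N]] show ?thesis
    using cf_yx_snoc[of "[]" 1 m \<mu>] m by (simp add: yx[simplified])
qed

text \<open>In this instance of the locale, \<open>is_reg\<close> is the defining property itself,
  so the definite description denotes the asymptotic polynomial. The error on \<open>QY0\<close> is
  the tail of the coefficient series of \<open>phi p\<close>.\<close>

lemma zeta_star_reg_props:
  assumes \<mu>: "Re \<mu> > 0" and m: "m > 0"
  shows "is_zeta_star_reg \<mu> m (zeta_star_reg \<mu> m)"
    and "p \<in> QY \<mu> \<Longrightarrow> rapid (\<lambda>n. lin (zeta_trunc \<mu> n) p - poly (zeta_star_reg \<mu> m p) (zeta_trunc \<mu> n [(1, m)]))"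
proof -
  note rap = rapid_tendsto[OF harmonic_generator_rapid[OF assms]]
  have lim: "(\<lambda>n. zeta_trunc \<mu> n [(1, m)] - (of_real (Harmonic_Numbers.harm n) + hconst \<mu> m)) \<longlonglongrightarrow> 0"
    using rap by (simp add: of_real_harm)
  obtain C where C: "\<And>n. norm (zeta_trunc \<mu> n [(1, m)]) \<le> C * hn n"
    using bound_near[OF lim harm_nonneg harm_le_hn] by blast
  interpret hr: regularization \<mu> "QY \<mu>" "QY0 \<mu>" "harm \<mu>" "word [(1, m)]" "\<lambda>n. lin (zeta_trunc \<mu> n)" "zeta_star \<mu>" C
  proof
    show "word [(1, m)] \<in> QY \<mu>" using m by (intro QY_word) simp
    show "filterlim (\<lambda>n. lin (zeta_trunc \<mu> n) (word [(1, m)])) at_infinity sequentially"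
      using filterlim_at_infinity_near[OF lim harm_at_top] by simp
    show "rapid (\<lambda>n. lin (zeta_trunc \<mu> n) p - zeta_star \<mu> p)" if "p \<in> QY0 \<mu>" for p
      using decays_tail_rapid[OF decays_cf[OF \<mu> phi_QX0[OF that]]] sum_cf_phi[OF subsetD[OF QY0_sub_QY that]]
      by (simp add: zeta_star_eq[OF \<mu> that] zval_def)
    show "zeta_star \<mu> p \<in> Zmu \<mu>" if "p \<in> QY0 \<mu>" for p
      using zval_Zmu[OF \<mu> phi_QX0[OF that]] by (simp add: zeta_star_eq[OF \<mu> that])
  qed (use QY_submod QY0_submod QY0_sub_QY harm_QY QY_generated[OF m] C zeta_star_trunc_harm[OF \<mu>]
        in \<open>auto simp: lin_add lin_scale\<close>)
  have eq: "is_zeta_star_reg \<mu> m = hr.is_reg"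
    unfolding fun_eq_iff is_zeta_star_reg_def hr.is_reg_def by blast
  have reg: "zeta_star_reg \<mu> m = hr.reg"
    unfolding zeta_star_reg_def eq by (rule hr.the_reg)
  show "is_zeta_star_reg \<mu> m (zeta_star_reg \<mu> m)"
    unfolding eq reg by (rule hr.is_reg_reg)
  show "p \<in> QY \<mu> \<Longrightarrow> rapid (\<lambda>n. lin (zeta_trunc \<mu> n) p - poly (zeta_star_reg \<mu> m p) (zeta_trunc \<mu> n [(1, m)]))"
    using hr.reg_asymp[of p] by (simp add: reg)
qed

text \<open>The same locale with evaluation at q = N/(N+1); the error on \<open>QX0\<close> is now
  the rate of Abel's limit theorem.\<close>

lemma zeta_sh_reg_asymp:
  assumes \<mu>: "Re \<mu> > 0" and m: "m > 0" and p: "p \<in> QX1 \<mu>"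
  shows "rapid (\<lambda>N. sev \<mu> N p - poly (zeta_sh_reg \<mu> m p) (sev \<mu> N (word [LY m])))"
proof -
  have lim: "(\<lambda>N. sev \<mu> N (word [LY m]) - (of_real (ln (real N + 1)) + hconst \<mu> m)) \<longlonglongrightarrow> 0"
    using rapid_tendsto[OF shuffle_generator_rapid[OF \<mu> m]] by (simp add: sev_generator[OF \<mu> m])
  obtain C where C: "\<And>N. norm (sev \<mu> N (word [LY m])) \<le> C * hn N"
    using bound_near[OF lim ln_le_hn] by blast
  interpret sr: regularization \<mu> "QX1 \<mu>" "QX0 \<mu>" "shuffle" "word [LY m]" "sev \<mu>" "zeta_sh \<mu>" C
  proof
    show "word [LY m] \<in> QX1 \<mu>" using good_snoc[of "[]" "LY m"] m by (intro QX1_word) simp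
    show "filterlim (\<lambda>N. sev \<mu> N (word [LY m])) at_infinity sequentially"
      by (rule filterlim_at_infinity_near[OF lim ln_at_top])
    show "rapid (\<lambda>N. sev \<mu> N p - zeta_sh \<mu> p)" if "p \<in> QX0 \<mu>" for p
      using decays_abel_rapid[OF decays_cf[OF \<mu> that]] that
        sums_unique[OF cf_sums_sev[OF \<mu> subsetD[OF QX0_sub_QX1 that]], symmetric]
      by (simp add: zeta_sh_eq[OF \<mu>] zval_def)
    show "zeta_sh \<mu> p \<in> Zmu \<mu>" if "p \<in> QX0 \<mu>" for p
      using zval_Zmu[OF \<mu> that] that by (simp add: zeta_sh_eq[OF \<mu>])
    show "sev \<mu> n (p + q) = sev \<mu> n p + sev \<mu> n q" "sev \<mu> n (scale c p) = c * sev \<mu> n p" for n p q c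
      by (simp_all add: sev_def lin_add lin_scale)
  qed (use QX1_submod QX0_submod QX0_sub_QX1 shuffle_QX1 QX1_generated[OF m] C sev_shuffle[OF \<mu>] in auto)
  have eq: "is_zeta_sh_reg \<mu> m = sr.is_reg"
    unfolding fun_eq_iff is_zeta_sh_reg_def sr.is_reg_def by blast
  have "zeta_sh_reg \<mu> m = sr.reg"
    unfolding zeta_sh_reg_def eq by (rule sr.the_reg)
  thus ?thesis using sr.reg_asymp[OF p] by simp
qed

section \<open>The comparison map\<close>

lemma smult_sum_right: "smult c (sum f A) = (\<Sum>x\<in>A. smult c (f x))"
  by (induction A rule: infinite_finite_induct) (auto simp: smult_add_right)

lemma poly_linear_ext_superset:
  assumes "degree P \<le> d"
  shows "poly_linear_ext F P = (\<Sum>n\<le>d. smult (coeff P n) (F n))"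
  unfolding poly_linear_ext_def using assms
  by (intro sum.mono_neutral_left) (auto simp: coeff_eq_0)

lemma poly_linear_ext_add: "poly_linear_ext F (P + Q) = poly_linear_ext F P + poly_linear_ext F Q"
proof -
  let ?d = "max (degree P) (degree Q)"
  have "degree (P + Q) \<le> ?d" by (rule degree_add_le_max)
  thus ?thesis
    by (simp add: poly_linear_ext_superset[of _ ?d] smult_add_left sum.distrib)
qed

lemma poly_linear_ext_smult: "poly_linear_ext F (smult c P) = smult c (poly_linear_ext F P)"
  by (simp add: poly_linear_ext_superset[of _ "degree P"] degree_smult_le smult_sum_right)

lemma poly_linear_ext_eqI:
  assumes L: "\<And>P Q. L (P + Q) = L P + L Q" "\<And>c P. L (smult c P) = smult c (L P)"
    and F: "\<And>n. L ([:0, 1:] ^ n) = F n"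
  shows "L P = poly_linear_ext F P"
proof -
  have L0: "L 0 = 0" using L(2)[of 0 0] by simp
  have Ls: "L (sum f A) = (\<Sum>x\<in>A. L (f x))" for f :: "nat \<Rightarrow> complex poly" and A
    by (induction A rule: infinite_finite_induct) (auto simp: L0 L)
  have "P = (\<Sum>i\<le>degree P. smult (coeff P i) ([:0, 1:] ^ i))"
    using poly_as_sum_of_monoms[of P] by (simp add: monom_altdef)
  hence "L P = L (\<Sum>i\<le>degree P. smult (coeff P i) ([:0, 1:] ^ i))" by simp
  also have "\<dots> = poly_linear_ext F P" by (simp add: Ls L F poly_linear_ext_def)
  finally show ?thesis .
qed

lemma poly_linear_ext_power: "poly_linear_ext F ([:0, 1:] ^ n) = F n"
proof -
  have m: "[:0, 1:] ^ n = (monom 1 n :: complex poly)" by (simp add: monom_altdef)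
  have "poly_linear_ext F (monom 1 n) = (\<Sum>i\<le>n. smult (coeff (monom 1 n) i) (F i))"
    by (rule poly_linear_ext_superset) (simp add: degree_monom_le)
  also have "\<dots> = (\<Sum>i\<le>n. if i = n then F i else 0)" by (intro sum.cong) auto
  finally show ?thesis by (simp add: m)
qed

section \<open>\<open>R11\<close> and translations\<close>

lemma R11_linear: "R11 (P + Q) = R11 P + R11 Q" "R11 (smult c P) = smult c (R11 P)"
  by (simp_all add: R11_def poly_linear_ext_add poly_linear_ext_smult)

lemma R11_sum: "R11 (sum f A) = (\<Sum>x\<in>A. R11 (f x))"
proof (induction A rule: infinite_finite_induct)
  case (insert x A)
  thus ?case by (simp add: R11_linear)
qed (use R11_linear(2)[of 0 0] in auto)

text \<open>In divided powers the coefficients of \<open>R11\<close> and of a translation no longer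
  depend on n: they are \<open>gamma_coeff k\<close> and c^j / j!.\<close>

definition dpow :: "nat \<Rightarrow> complex poly" where
  "dpow n = smult (1 / fact n) ([:0, 1:] ^ n)"

lemma power_eq_dpow: "[:0, 1:] ^ n = smult (fact n) (dpow n)"
  by (simp add: dpow_def)

lemma R11_dpow: "R11 (dpow n) = (\<Sum>k\<le>n. smult (gamma_coeff k) (dpow (n - k)))"
  by (simp add: dpow_def R11_linear) (simp add: R11_def poly_linear_ext_power)

lemma power_shift: "[:c, 1:] ^ n = (\<Sum>k\<le>n. smult (of_nat (n choose k) * c ^ (n - k)) ([:0, 1:] ^ k))"
proof -
  have "[:c, 1:] ^ n = ([:0, 1:] + [:c:]) ^ n" by simp
  also have "\<dots> = (\<Sum>k\<le>n. of_nat (n choose k) * [:0, 1:] ^ k * [:c:] ^ (n - k))" by (rule binomial_ring)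
  finally show ?thesis by (simp add: of_nat_poly poly_const_pow mult_ac)
qed

lemma dpow_shift: "pcompose (dpow n) [:c, 1:] = (\<Sum>j\<le>n. smult (c ^ j / fact j) (dpow (n - j)))"
proof -
  have "pcompose ([:0, 1:] ^ n) [:c, 1:] = [:c, 1:] ^ n"
    by (induction n) (auto simp: pcompose_mult pcompose_1 pcompose_pCons)
  hence "pcompose (dpow n) [:c, 1:] = (\<Sum>k\<le>n. smult (of_nat (n choose k) * c ^ (n - k) / fact n) ([:0, 1:] ^ k))"
    unfolding dpow_def pcompose_smult by (simp only: power_shift[of c n] smult_sum_right smult_smult) simp
  also have "\<dots> = (\<Sum>k\<le>n. smult (c ^ (n - k) / fact (n - k)) (dpow k))"
    by (intro sum.cong refl) (simp add: dpow_def binomial_fact mult.commute)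
  also have "\<dots> = (\<Sum>j\<le>n. smult (c ^ j / fact j) (dpow (n - j)))"
    by (rule sum.reindex_bij_witness[of _ "\<lambda>i. n - i" "\<lambda>i. n - i"]) auto
  finally show ?thesis .
qed

lemma triangle_swap:
  fixes f :: "nat \<Rightarrow> nat \<Rightarrow> 'a::comm_monoid_add"
  shows "(\<Sum>j\<le>n. \<Sum>k\<le>n - j. f j k) = (\<Sum>k\<le>n. \<Sum>j\<le>n - k. f j k)"
proof -
  have *: "{..n - j} = {k \<in> {..n}. j + k \<le> n}" if "j \<le> n" for j using that by auto
  have **: "{..n - k} = {j \<in> {..n}. j + k \<le> n}" if "k \<le> n" for k using that by auto
  have "(\<Sum>j\<le>n. \<Sum>k\<le>n - j. f j k) = (\<Sum>j\<le>n. sum (f j) {k \<in> {..n}. j + k \<le> n})"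
    by (intro sum.cong refl) (simp add: *)
  also have "\<dots> = (\<Sum>k\<le>n. \<Sum>j\<in>{j \<in> {..n}. j + k \<le> n}. f j k)"
    by (rule sum.swap_restrict) auto
  also have "\<dots> = (\<Sum>k\<le>n. \<Sum>j\<le>n - k. f j k)"
    by (intro sum.cong refl) (simp add: **)
  finally show ?thesis .
qed

text \<open>On divided powers both maps are convolutions with fixed sequences, so they commute after
  exchanging a double sum over a triangle.\<close>

lemma R11_shift: "R11 (pcompose P [:c, 1:]) = pcompose (R11 P) [:c, 1:]"
proof -
  let ?F = "\<lambda>n. pcompose (R11 ([:0, 1:] ^ n)) [:c, 1:]"
  have d: "R11 (pcompose (dpow n) [:c, 1:]) = pcompose (R11 (dpow n)) [:c, 1:]" for n
  proof -
    have "R11 (pcompose (dpow n) [:c, 1:]) =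
      (\<Sum>j\<le>n. \<Sum>k\<le>n - j. smult (c ^ j / fact j * gamma_coeff k) (dpow (n - j - k)))"
      by (simp add: dpow_shift R11_sum R11_linear R11_dpow smult_sum_right)
    also have "\<dots> = (\<Sum>k\<le>n. \<Sum>j\<le>n - k. smult (c ^ j / fact j * gamma_coeff k) (dpow (n - j - k)))"
      by (rule triangle_swap)
    also have "\<dots> = pcompose (R11 (dpow n)) [:c, 1:]"
      by (simp add: R11_dpow pcompose_sum pcompose_smult dpow_shift smult_sum_right mult.commute diff_right_commute add.commute)
    finally show ?thesis .
  qed
  have "R11 (pcompose P [:c, 1:]) = poly_linear_ext ?F P"
    by (rule poly_linear_ext_eqI)
       (simp_all add: R11_linear pcompose_add pcompose_smult power_eq_dpow d)
  moreover have "pcompose (R11 P) [:c, 1:] = poly_linear_ext ?F P"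
    by (rule poly_linear_ext_eqI[of "\<lambda>P. pcompose (R11 P) [:c, 1:]"])
       (simp_all add: R11_linear pcompose_add pcompose_smult)
  ultimately show ?thesis by simp
qed

text \<open>Explains the formula for \<open>R\<close>: the outer binomial sum expands (T +
  c_{m,1})^n, the inner one is \<open>R11\<close> on T^k, followed by the translation by
  c_{1,m'}.\<close>

lemma R_eq: "R \<mu> m m' P = pcompose (R11 (pcompose P [:cmu \<mu> m 1, 1:])) [:cmu \<mu> 1 m', 1:]"
  unfolding R_def
proof (rule poly_linear_ext_eqI[symmetric])
  fix n
  let ?c = "cmu \<mu> m 1" and ?d = "cmu \<mu> 1 m'"
  have pw: "pcompose ([:0, 1:] ^ n) [:c, 1:] = [:c, 1:] ^ n" for n and c :: complex
    by (induction n) (auto simp: pcompose_mult pcompose_1 pcompose_pCons)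
  have "R11 ([:0, 1:] ^ k) = smult (fact k) (\<Sum>l\<le>k. smult (gamma_coeff l / fact (k - l)) ([:0, 1:] ^ (k - l)))" for k
    by (simp add: R11_def poly_linear_ext_power)
  thus "pcompose (R11 (pcompose ([:0, 1:] ^ n) [:?c, 1:])) [:?d, 1:] =
     (\<Sum>k\<le>n. smult (of_nat (n choose k) * ?c ^ (n - k))
       (smult (fact k) (\<Sum>l\<le>k. smult (gamma_coeff l / fact (k - l)) ([:?d, 1:] ^ (k - l)))))"
    unfolding pw power_shift[of ?c n]
    by (simp add: R11_sum R11_linear pcompose_sum pcompose_smult pw)
qed (simp_all add: R11_linear pcompose_add pcompose_smult)

text \<open>Lets the divergent generator inside a polynomial be replaced by its model, H_n or log(N
  + 1) plus a constant. One Horner step multiplies a rapid error by a factor of logarithmic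
  growth.\<close>

lemma poly_near_rapid:
  assumes "rapid (\<lambda>n. t n - s n)" "\<And>n. norm (t n) \<le> C * hn n" "\<And>n. norm (s n) \<le> D * hn n"
  shows "rapid (\<lambda>n. poly P (t n) - poly P (s n))"
proof (induction P)
  case (pCons a P)
  have "rapid (\<lambda>n. (t n - s n) * poly P (t n) + (poly P (t n) - poly P (s n)) * s n)"
    using rapid_mult_bounded[OF pCons(2), of s D 1] assms(3)
    by (intro rapid_add rapid_mult_poly[OF assms(1,2)]) auto
  thus ?case by (simp add: algebra_simps)
qed simp

lemma slow_harm_power: "slow (\<lambda>n. Harmonic_Numbers.harm n ^ k / fact k)"
proof (rule slow_hn)
  fix n
  have "norm (Harmonic_Numbers.harm n ^ k / fact k :: complex) \<le> Harmonic_Numbers.harm n ^ k / 1"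
    unfolding norm_divide norm_power norm_harm
    by (intro divide_left_mono) (auto simp: fact_ge_1 harm_nonneg)
  also have "\<dots> \<le> 1 * hn n ^ k"
    using power_mono[OF harm_le_hn harm_nonneg, of n k] by simp
  finally show "norm (Harmonic_Numbers.harm n ^ k / fact k :: complex) \<le> 1 * hn n ^ k" .
qed

lemma poly_dpow: "poly (dpow k) x = x ^ k / fact k"
  by (simp add: dpow_def)

lemma poly_eq_sum_dpow: "P = (\<Sum>i\<le>degree P. smult (coeff P i * fact i) (dpow i))"
  using poly_as_sum_of_monoms[of P] by (simp add: dpow_def monom_altdef)

lemma abel_poly_harm:
  "(\<lambda>N. abel N (\<lambda>n. poly P (Harmonic_Numbers.harm n)) - poly (R11 P) (of_real (ln (real N + 1)))) \<longlonglongrightarrow> 0"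
proof -
  let ?L = "\<lambda>N. complex_of_real (ln (real N + 1))"
  define a where "a i = coeff P i * fact i" for i
  have P: "P = (\<Sum>i\<le>degree P. smult (a i) (dpow i))"
    unfolding a_def by (rule poly_eq_sum_dpow)
  have "abel N (\<lambda>n. poly P (Harmonic_Numbers.harm n)) =
     (\<Sum>i\<le>degree P. a i * abel N (\<lambda>n. Harmonic_Numbers.harm n ^ i / fact i))" for N
  proof -
    have "poly P x = (\<Sum>i\<le>degree P. a i * (x ^ i / fact i))" for x
      by (subst P) (simp add: poly_sum poly_dpow)
    hence "abel N (\<lambda>n. poly P (Harmonic_Numbers.harm n)) = abel N (\<lambda>n. \<Sum>i\<le>degree P. a i * (Harmonic_Numbers.harm n ^ i / fact i))"
      by simp
    also have "\<dots> = (\<Sum>i\<le>degree P. abel N (\<lambda>n. a i * (Harmonic_Numbers.harm n ^ i / fact i)))"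
      by (rule abel_sum) (rule slow_cmult[OF slow_harm_power])
    also have "\<dots> = (\<Sum>i\<le>degree P. a i * abel N (\<lambda>n. Harmonic_Numbers.harm n ^ i / fact i))"
      by (simp only: abel_cmult[OF slow_harm_power])
    finally show ?thesis .
  qed
  moreover have "poly (R11 P) x = (\<Sum>i\<le>degree P. a i * (\<Sum>k\<le>i. gamma_coeff k * (x ^ (i - k) / fact (i - k))))" for x
  proof -
    have "R11 P = (\<Sum>i\<le>degree P. smult (a i) (\<Sum>k\<le>i. smult (gamma_coeff k) (dpow (i - k))))"
      by (subst P) (simp add: R11_sum R11_linear R11_dpow)
    thus ?thesis by (simp add: poly_sum poly_dpow)
  qed
  ultimately have "abel N (\<lambda>n. poly P (Harmonic_Numbers.harm n)) - poly (R11 P) (?L N) =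
     (\<Sum>i\<le>degree P. a i * (abel N (\<lambda>n. Harmonic_Numbers.harm n ^ i / fact i) -
        (\<Sum>k\<le>i. gamma_coeff k * (?L N ^ (i - k) / fact (i - k)))))" for N
    by (simp only: right_diff_distrib sum_subtractf)
  moreover have "(\<lambda>N. \<Sum>i\<le>degree P. a i * (abel N (\<lambda>n. Harmonic_Numbers.harm n ^ i / fact i) -
        (\<Sum>k\<le>i. gamma_coeff k * (?L N ^ (i - k) / fact (i - k))))) \<longlonglongrightarrow> 0"
    by (intro tendsto_null_sum tendsto_mult_right_zero abel_harm_power)
  ultimately show ?thesis by simp
qed

section \<open>Comparison of the two regularizations\<close>

lemma slow_trunc:
  assumes \<mu>: "Re \<mu> > 0" and "p \<in> QY \<mu>"
  shows "slow (\<lambda>n. lin (zeta_trunc \<mu> n) p)"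
proof -
  have "span_over (Qmu \<mu>) scale {word w | w. positive w} \<subseteq> {p. slow (\<lambda>n. lin (zeta_trunc \<mu> n) p)}"
  proof (rule span_subset)
    show "submod (Qmu \<mu>) scale {p. slow (\<lambda>n. lin (zeta_trunc \<mu> n) p)}"
      by (rule submodI) (auto simp: lin_add lin_scale intro: slow_add slow_cmult slow_bounded[of _ 0])
    show "{word w | w. positive w} \<subseteq> {p. slow (\<lambda>n. lin (zeta_trunc \<mu> n) p)}"
    proof safe
      fix w :: biindex assume "positive w"
      then obtain C where "\<And>n. norm (zeta_trunc \<mu> n w) \<le> C * hn n ^ length w"
        using zeta_trunc_bound[OF \<mu>] by blast
      thus "slow (\<lambda>n. lin (zeta_trunc \<mu> n) (word w))"
        unfolding lin_word by (rule slow_hn)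
    qed
  qed
  thus ?thesis using assms(2) unfolding QY_def by blast
qed

lemma sev_phi:
  assumes \<mu>: "Re \<mu> > 0" and p: "p \<in> QY \<mu>"
  shows "sev \<mu> N (phi p) = abel N (\<lambda>n. lin (zeta_trunc \<mu> n) p)"
proof -
  have "slow (\<lambda>n. \<Sum>j\<le>n. cf \<mu> (phi p) j)"
    using slow_trunc[OF \<mu> p] by (simp add: sum_cf_phi[OF p])
  from abel_parts[OF this, of N] have "(\<lambda>n. cf \<mu> (phi p) n * of_real (qq N) ^ n) sums abel N (\<lambda>n. lin (zeta_trunc \<mu> n) p)"
    by (simp add: sum_cf_phi[OF p])
  thus ?thesis using cf_sums_sev[OF \<mu> phi_QX1[OF p], of N] by (rule sums_unique2[symmetric])
qed

text \<open>The series of \<open>phi w\<close> at q = N/(N+1) is expressed as a polynomial in L =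
  log(N + 1) in two ways. As the Abel mean of the truncated sums, which are P'(H_n) + o(1), it is
  (\<open>R11\<close> P')(L) + o(1); through the shuffle regularization Q it is Q(L + c') + o(1).
  Since L is unbounded, the two polynomials coincide.\<close>

lemma comparison_shifted:
  assumes \<mu>: "Re \<mu> > 0" and m: "m > 0" "m' > 0" and w: "w \<in> QY \<mu>"
  shows "pcompose (zeta_sh_reg \<mu> m' (phi w)) [:hconst \<mu> m', 1:] =
    R11 (pcompose (zeta_star_reg \<mu> m w) [:hconst \<mu> m, 1:])"
proof -
  define P Q where "P = zeta_star_reg \<mu> m w" and "Q = zeta_sh_reg \<mu> m' (phi w)"
  define c c' where "c = hconst \<mu> m" and "c' = hconst \<mu> m'"
  define P' where "P' = pcompose P [:c, 1:]"
  let ?h = "\<lambda>n. Harmonic_Numbers.harm n :: complex"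
  let ?L = "\<lambda>N. complex_of_real (ln (real N + 1))"
  let ?t = "\<lambda>n. zeta_trunc \<mu> n [(1, m)]" and ?g = "\<lambda>N. sev \<mu> N (word [LY m'])"
  let ?S = "\<lambda>n. lin (zeta_trunc \<mu> n) w"
  have rt: "rapid (\<lambda>n. ?t n - (?h n + c))"
    unfolding c_def by (rule harmonic_generator_rapid[OF \<mu> m(1)])
  have rg: "rapid (\<lambda>N. ?g N - (?L N + c'))"
    unfolding c'_def sev_generator[OF \<mu> m(2)] by (rule shuffle_generator_rapid[OF \<mu> m(2)])
  have lt: "(\<lambda>n. ?t n - (of_real (Harmonic_Numbers.harm n) + c)) \<longlonglongrightarrow> 0"
    using rapid_tendsto[OF rt] by (simp add: of_real_harm)
  obtain C1 where C1: "\<And>n. norm (?t n) \<le> C1 * hn n"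
    using bound_near[OF lt harm_nonneg harm_le_hn] by blast
  have "(\<lambda>n. (?h n + c) - (of_real (Harmonic_Numbers.harm n) + c)) \<longlonglongrightarrow> 0"
    by (simp add: of_real_harm)
  from bound_near[OF this harm_nonneg harm_le_hn] obtain C2 where C2: "\<And>n. norm (?h n + c) \<le> C2 * hn n"
    by blast
  obtain C3 where C3: "\<And>N. norm (?g N) \<le> C3 * hn N"
    using bound_near[OF rapid_tendsto[OF rg] ln_le_hn] by blast
  have "(\<lambda>N. (?L N + c') - (?L N + c')) \<longlonglongrightarrow> 0" by simp
  from bound_near[OF this ln_le_hn] obtain C4 where C4: "\<And>N. norm (?L N + c') \<le> C4 * hn N"
    by blast
  have P'p: "poly P' x = poly P (x + c)" for x
    by (simp add: P'_def poly_pcompose add.commute)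
  have "rapid (\<lambda>n. (?S n - poly P (?t n)) + (poly P (?t n) - poly P (?h n + c)))"
    unfolding P_def by (intro rapid_add zeta_star_reg_props(2)[OF \<mu> m(1) w] poly_near_rapid[OF rt C1 C2])
  hence d: "(\<lambda>n. ?S n - poly P' (?h n)) \<longlonglongrightarrow> 0"
    by (intro rapid_tendsto) (simp add: P'p)
  have sS: "slow ?S" by (rule slow_trunc[OF \<mu> w])
  have "slow (\<lambda>n. ?S n - (?S n - poly P' (?h n)))"
    by (rule slow_diff[OF sS slow_tendsto[OF d]])
  hence sP: "slow (\<lambda>n. poly P' (?h n))" by simp
  have 1: "(\<lambda>N. sev \<mu> N (phi w) - abel N (\<lambda>n. poly P' (?h n))) \<longlonglongrightarrow> 0"
    using abel_tendsto_0[OF d] by (simp add: sev_phi[OF \<mu> w] abel_diff[OF sS sP])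
  have 2: "(\<lambda>N. abel N (\<lambda>n. poly P' (?h n)) - poly (R11 P') (?L N)) \<longlonglongrightarrow> 0"
    by (rule abel_poly_harm)
  have "rapid (\<lambda>N. (sev \<mu> N (phi w) - poly Q (?g N)) + (poly Q (?g N) - poly Q (?L N + c')))"
    unfolding Q_def by (intro rapid_add zeta_sh_reg_asymp[OF \<mu> m(2) phi_QX1[OF w]] poly_near_rapid[OF rg C3 C4])
  hence 3: "(\<lambda>N. sev \<mu> N (phi w) - poly Q (?L N + c')) \<longlonglongrightarrow> 0"
    by (intro rapid_tendsto) simp
  have "(\<lambda>N. (sev \<mu> N (phi w) - abel N (\<lambda>n. poly P' (?h n))) + (abel N (\<lambda>n. poly P' (?h n)) - poly (R11 P') (?L N))
      - (sev \<mu> N (phi w) - poly Q (?L N + c'))) \<longlonglongrightarrow> 0 + 0 - 0"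
    by (intro tendsto_diff tendsto_add 1 2 3)
  hence lim: "(\<lambda>N. poly (pcompose Q [:c', 1:] - R11 P') (?L N)) \<longlonglongrightarrow> 0"
    by (simp add: poly_pcompose add.commute)
  have "filterlim ?L at_infinity sequentially"
    by (rule of_real_at_infinity[OF ln_at_top])
  from poly_tendsto_0_imp_0[OF this lim] show ?thesis
    by (simp add: P_def Q_def P'_def c_def c'_def)
qed

lemma pcompose_shift: "pcompose (pcompose P [:a, 1:]) [:b, 1:] = pcompose P [:a + b, 1:]" for a b :: complex
  by (simp add: pcompose_assoc[symmetric] pcompose_pCons)

lemma comparison:
  assumes "Re \<mu> > 0" "m > 0" "m' > 0" "w \<in> QY \<mu>"
  shows "zeta_sh_reg \<mu> m' (phi w) = R \<mu> m m' (zeta_star_reg \<mu> m w)"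
proof -
  define P Q where "P = zeta_star_reg \<mu> m w" and "Q = zeta_sh_reg \<mu> m' (phi w)"
  let ?h = "hconst \<mu>"
  have "Q = pcompose (pcompose Q [:?h m', 1:]) [:- ?h m', 1:]"
    by (simp add: pcompose_shift)
  also have "\<dots> = pcompose (R11 (pcompose P [:?h m, 1:])) [:- ?h m', 1:]"
    using comparison_shifted[OF assms] by (simp add: P_def Q_def)
  also have "\<dots> = pcompose (R11 P) [:?h m - ?h m', 1:]"
    by (simp add: R11_shift pcompose_shift)
  \<comment> \<open>The two translations in \<open>R\<close> telescope: c_{m,1} + c_{1,m'} =
    \<open>hconst \<mu> m - hconst \<mu> m'\<close>.\<close>
  also have "\<dots> = R \<mu> m m' P"
    by (simp add: R_eq R11_shift pcompose_shift cmu_def hconst_def)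
  finally show ?thesis by (simp add: P_def Q_def)
qed

lemma R_1_1: "R \<mu> 1 1 = R11"
  by (rule ext) (simp add: R_eq cmu_def)

section \<open>Uniqueness of the comparison map\<close>

lemma vector_space_smult: "vector_space (smult :: complex \<Rightarrow> complex poly \<Rightarrow> complex poly)"
  by unfold_locales (simp_all add: smult_add_left smult_add_right)

lemma R_linear: "Vector_Spaces.linear smult smult (R \<mu> m m')"
  unfolding Vector_Spaces.linear_iff R_def
  by (simp add: vector_space_smult poly_linear_ext_add poly_linear_ext_smult)

text \<open>Iterated harmonic products of y_{1,m} produce all T^n. These span C[T] over the complex
  numbers, so a complex-linear map is determined by its values on the image of the regularization,
  although that image is only a Q[\<mu>]-module.\<close>

lemma power_in_image:
  assumes \<mu>: "Re \<mu> > 0" and m: "m > 0"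
  shows "\<exists>w\<in>QY \<mu>. zeta_star_reg \<mu> m w = [:0, 1:] ^ n"
proof (induction n)
  case 0
  have w: "word [] \<in> QY0 \<mu>" by (rule QY0_base)
  have "zeta_star \<mu> (word []) = 1"
    using zeta_star_eq[OF \<mu> w] zval_values(1)[OF \<mu>] by (simp add: phi_word)
  hence "zeta_star_reg \<mu> m (word []) = 1"
    using zeta_star_reg_props(1)[OF assms] w by (auto simp: is_zeta_star_reg_def one_pCons)
  thus ?case using w QY0_sub_QY by auto
next
  case (Suc n)
  then obtain w where w: "w \<in> QY \<mu>" "zeta_star_reg \<mu> m w = [:0, 1:] ^ n" by blast
  have y: "word [(1, m)] \<in> QY \<mu>" using m by (intro QY_word) simp
  have "zeta_star_reg \<mu> m (harm \<mu> w (word [(1, m)])) = [:0, 1:] ^ n * [:0, 1:]"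
    using zeta_star_reg_props(1)[OF assms] w y unfolding is_zeta_star_reg_def by metis
  thus ?case using harm_QY[OF w(1) y] by (auto simp: mult.commute simp del: mult_pCons_left mult_pCons_right)
qed

lemma rho_eq:
  assumes \<mu>: "Re \<mu> > 0" and m: "m > 0" "m' > 0"
  shows "rho \<mu> m m' = R \<mu> m m'"
  unfolding rho_def
proof (rule the_equality)
  show "Vector_Spaces.linear smult smult (R \<mu> m m') \<and>
     (\<forall>w\<in>QY \<mu>. zeta_sh_reg \<mu> m' (phi w) = R \<mu> m m' (zeta_star_reg \<mu> m w))"
    using R_linear comparison[OF assms] by blast
next
  fix \<rho> assume \<rho>: "Vector_Spaces.linear smult smult \<rho> \<and>
     (\<forall>w\<in>QY \<mu>. zeta_sh_reg \<mu> m' (phi w) = \<rho> (zeta_star_reg \<mu> m w))"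
  have pw: "\<rho> ([:0, 1:] ^ n) = R \<mu> m m' ([:0, 1:] ^ n)" for n
  proof -
    obtain w where "w \<in> QY \<mu>" "zeta_star_reg \<mu> m w = [:0, 1:] ^ n"
      using power_in_image[OF \<mu> m(1)] by blast
    thus ?thesis using \<rho> comparison[OF assms, of w] by metis
  qed
  have lin: "\<rho> (P + Q) = \<rho> P + \<rho> Q" "\<rho> (smult c P) = smult c (\<rho> P)" for P Q c
    using \<rho> by (auto simp: Vector_Spaces.linear_iff)
  show "\<rho> = R \<mu> m m'"
  proof
    fix P
    have "\<rho> P = poly_linear_ext (\<lambda>n. R \<mu> m m' ([:0, 1:] ^ n)) P"
      by (rule poly_linear_ext_eqI) (simp_all add: lin pw)
    also have "\<dots> = R \<mu> m m' P"
      by (rule poly_linear_ext_eqI[symmetric])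
         (simp_all add: R_def poly_linear_ext_add poly_linear_ext_smult)
    finally show "\<rho> P = R \<mu> m m' P" .
  qed
qed

theorem theorem1p7:
  fixes \<mu> :: complex
  assumes "Re \<mu> > 0"
  shows "(\<forall>w\<in>QY \<mu>. zeta_sh_reg \<mu> 1 (phi w) = R11 (zeta_star_reg \<mu> 1 w)) \<and>
         rho \<mu> 1 1 = R11 \<and>
         (\<forall>m m' :: rat. 0 < m \<longrightarrow> 0 < m' \<longrightarrow>
            (\<forall>w\<in>QY \<mu>. zeta_sh_reg \<mu> m' (phi w) = R \<mu> m m' (zeta_star_reg \<mu> m w)) \<and>
            rho \<mu> m m' = R \<mu> m m')"
proof (intro conjI ballI allI impI)
  show "zeta_sh_reg \<mu> 1 (phi w) = R11 (zeta_star_reg \<mu> 1 w)" if "w \<in> QY \<mu>" for w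
    using comparison[OF assms _ _ that, of 1 1] by (simp add: R_1_1)
  show "rho \<mu> 1 1 = R11"
    using rho_eq[OF assms, of 1 1] by (simp add: R_1_1)
qed (use comparison[OF assms] rho_eq[OF assms] in blast)+

end
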